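(* Let $\Gamma$ be a discrete subgroup of $\mathrm{PSL}_2(\mathbb{C})$ which is a BH group. Then $\Gamma$ is of the first kind, i.e. its limit set satisfies $\Lambda(\Gamma)=\hat{\mathbb{C}}$.
   Context: $\hat{\mathbb{C}}$ is the Riemann sphere, on which $\mathrm{PSL}_2(\mathbb{C})$ acts by Möbius transformations; it is identified with the ideal boundary of hyperbolic $3$-space $\mathbb{H}^3$, on which $\mathrm{PSL}_2(\mathbb{C})$ acts by isometries extending this action. $\mathcal{K}$ denotes the set of non-empty compact subsets of $\hat{\mathbb{C}}$ with the Hausdorff distance, and $\mathcal{K}_0\subset\mathcal{K}$ is the subset of those elements that are not singletons, with the subspace topology. $\mathrm{PSL}_2(\mathbb{C})$ acts on $\mathcal{K}$ and $\mathcal{K}_0$ by $g\cdot A=g(A)$. A Jordan curve on $\hat{\mathbb{C}}$ is a simple closed curve (image of a continuous injective map $S^1\to\hat{\mathbb{C}}$), regarded as an element of $\mathcal{K}_0$. For $K\ge 1$, an orientation-preserving homeomorphism $h$ between domains of $\hat{\mathbb{C}}$ is $K$-quasiconformal if it is absolutely continuous on lines and $|h_{\bar z}|\le \frac{K-1}{K+1}|h_z|$ almost everywhere. A $K$-quasicircle is a Jordan curve which is the image of a round circle under a $K$-quasiconformal homeomorphism of $\hat{\mathbb{C}}$. A subgroup $\Gamma$ of $\mathrm{PSL}_2(\mathbb{C})$ is a BH group (Benoist--Hulin group; satisfies the BH condition) if for every closed $\Gamma$-invariant subset $\mathcal{C}$ of $\mathcal{K}_0$ all of whose elements are Jordan curves,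 there exists $K\ge 1$ such that every element of $\mathcal{C}$ is a $K$-quasicircle. For a discrete subgroup $\Gamma$ of $\mathrm{PSL}_2(\mathbb{C})$ (a Kleinian group), the limit set $\Lambda(\Gamma)\subset\hat{\mathbb{C}}$ is the set of accumulation points in $\hat{\mathbb{C}}$ of the $\Gamma$-orbit of a point of $\mathbb{H}^3$. $\Gamma$ is of the first kind if $\Lambda(\Gamma)=\hat{\mathbb{C}}$. *)

theory Defs
  imports
    "HOL-Complex_Analysis.Complex_Analysis"
    "HOL-Algebra.Coset"
begin

unbundle no fps_syntax

text \<open>The Riemann sphere, with the chordal metric it receives from the unit sphere of
  \<open>complex \<times> real\<close> by stereographic projection.\<close>

datatype riemann_sphere = Fin complex | Infty

fun stereo :: "riemann_sphere \<Rightarrow> complex \<times> real" where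
  "stereo (Fin z) = (2 * z / of_real (1 + (cmod z)\<^sup>2), ((cmod z)\<^sup>2 - 1) / ((cmod z)\<^sup>2 + 1))"
| "stereo Infty = (0, 1)"

lemma inj_stereo: "inj stereo"
proof (rule injI)
  have pos: "(cmod z)\<^sup>2 + 1 > 0" "(cmod z)\<^sup>2 + 1 \<noteq> 0" for z
    by (smt (verit) zero_le_power2)+
  have 1: "((cmod z)\<^sup>2 - 1) / ((cmod z)\<^sup>2 + 1) \<noteq> 1" for z
    using pos[of z] by (simp add: divide_simps)
  fix x y assume eq: "stereo x = stereo y"
  show "x = y"
  proof (cases x; cases y)
    fix z w assume xy: "x = Fin z" "y = Fin w"
    have "((cmod z)\<^sup>2 - 1) / ((cmod z)\<^sup>2 + 1) = ((cmod w)\<^sup>2 - 1) / ((cmod w)\<^sup>2 + 1)"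
      using eq xy by simp
    then have "(cmod z)\<^sup>2 = (cmod w)\<^sup>2"
      using pos[of z] pos[of w] by (simp add: frac_eq_eq algebra_simps)
    then have "2 * z / of_real (1 + (cmod z)\<^sup>2) = 2 * w / of_real (1 + (cmod z)\<^sup>2)"
      using eq xy by simp
    moreover have "complex_of_real (1 + (cmod z)\<^sup>2) \<noteq> 0"
      using pos[of z] by (simp only: of_real_eq_0_iff add.commute) simp
    ultimately show ?thesis using xy by (simp del: of_real_add)
  qed (use eq 1 in \<open>auto simp: eq_commute[of 1]\<close>)
qed

instantiation riemann_sphere :: metric_space
begin

definition dist_riemann_sphere :: "riemann_sphere \<Rightarrow> riemann_sphere \<Rightarrow> real" where
  "dist_riemann_sphere x y = dist (stereo x) (stereo y)"

definition uniformity_riemann_sphere :: "(riemann_sphere \<times> riemann_sphere) filter" where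
  "uniformity_riemann_sphere = (INF e\<in>{0<..}. principal {(x, y). dist x y < e})"

definition open_riemann_sphere :: "riemann_sphere set \<Rightarrow> bool" where
  "open_riemann_sphere U \<longleftrightarrow> (\<forall>x\<in>U. \<forall>\<^sub>F (x', y) in uniformity. x' = x \<longrightarrow> y \<in> U)"

instance
proof
  fix x y z :: riemann_sphere
  show "dist x y = 0 \<longleftrightarrow> x = y"
    using inj_stereo by (auto simp: dist_riemann_sphere_def inj_eq)
  show "dist x y \<le> dist x z + dist y z"
    by (simp add: dist_riemann_sphere_def dist_triangle2)
qed (rule uniformity_riemann_sphere_def open_riemann_sphere_def)+

end

lemma bounded_riemann_sphere [simp]: "bounded (A :: riemann_sphere set)"
proof -
  have "dist Infty x \<le> 4" for x
  proof (cases x)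
    case (Fin z)
    let ?n = "cmod z"
    have "2 * ?n / (1 + ?n\<^sup>2) \<le> 1"
      using sum_squares_bound[of 1 ?n] by (simp add: divide_simps power2_eq_square add_pos_nonneg)
    moreover have "\<bar>1 - (?n\<^sup>2 - 1) / (?n\<^sup>2 + 1)\<bar> \<le> 2"
      by (simp add: divide_simps abs_le_iff add_nonneg_pos)
    moreover have "norm (complex_of_real (1 + ?n\<^sup>2)) = 1 + ?n\<^sup>2"
      by (subst norm_of_real) simp
    ultimately have "norm (fst (stereo x)) \<le> 1" "\<bar>1 - snd (stereo x)\<bar> \<le> 2"
      using Fin by (simp_all add: norm_divide norm_mult del: of_real_add)
    then show ?thesis
      using norm_Pair_le[of "0 - fst (stereo x)" "1 - snd (stereo x)"]
      by (cases "stereo x") (simp add: dist_riemann_sphere_def dist_norm)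
  qed (simp add: dist_riemann_sphere_def)
  then show ?thesis unfolding bounded_def by blast
qed


text \<open>The value for an empty argument is irrelevant; it only makes the function non-negative.\<close>

definition hausdorff_dist :: "'a::metric_space set \<Rightarrow> 'a set \<Rightarrow> real" where
  "hausdorff_dist A B =
     (if A = {} \<or> B = {} then 0 else max (SUP a\<in>A. infdist a B) (SUP b\<in>B. infdist b A))"

definition compacta :: "riemann_sphere set set" where
  "compacta = {A. compact A \<and> A \<noteq> {}}"

definition compacta\<^sub>0 :: "riemann_sphere set set" where
  "compacta\<^sub>0 = {A \<in> compacta. \<not> is_singleton A}"

lemma infdist_bdd_above:
  fixes A B :: "riemann_sphere set"
  shows "bdd_above ((\<lambda>a. infdist a B) ` A)"
proof (cases "B = {}")
  case False
  then obtain b where b: "b \<in> B" by blast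
  obtain M where M: "dist b x \<le> M" for x
    using bounded_riemann_sphere[of UNIV] unfolding bounded_any_center[of UNIV b] by auto
  show ?thesis
    by (rule bdd_aboveI2[of _ _ M]) (metis M b dist_commute infdist_le2)
qed (auto simp: infdist_def)

lemma hausdorff_dist_le_iff:
  fixes A B :: "riemann_sphere set"
  assumes "A \<noteq> {}" "B \<noteq> {}"
  shows "hausdorff_dist A B \<le> r \<longleftrightarrow> (\<forall>a\<in>A. infdist a B \<le> r) \<and> (\<forall>b\<in>B. infdist b A \<le> r)"
  using assms by (simp add: hausdorff_dist_def cSUP_le_iff infdist_bdd_above)

lemma Metric_space_compacta: "Metric_space compacta hausdorff_dist"
proof
  fix A B :: "riemann_sphere set"
  show "0 \<le> hausdorff_dist A B"
  proof (cases "A = {} \<or> B = {}")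
    case False
    then obtain a where "a \<in> A" by blast
    then have "0 \<le> (SUP a\<in>A. infdist a B)"
      by (rule cSUP_upper2[OF infdist_bdd_above]) (rule infdist_nonneg)
    then show ?thesis using False by (simp add: hausdorff_dist_def)
  qed (auto simp: hausdorff_dist_def)
  show "hausdorff_dist A B = hausdorff_dist B A"
    by (auto simp: hausdorff_dist_def max.commute)
next
  fix A B assume AB: "A \<in> compacta" "B \<in> compacta"
  then have ne: "A \<noteq> {}" "B \<noteq> {}" and cl: "closed A" "closed B"
    by (auto simp: compacta_def compact_imp_closed)
  show "hausdorff_dist A B = 0 \<longleftrightarrow> A = B"
  proof
    assume "hausdorff_dist A B = 0"
    then have "\<forall>a\<in>A. infdist a B \<le> 0" "\<forall>b\<in>B. infdist b A \<le> 0"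
      using hausdorff_dist_le_iff[OF ne, of 0] by auto
    then have "\<forall>a\<in>A. infdist a B = 0" "\<forall>b\<in>B. infdist b A = 0"
      by (simp_all add: infdist_nonneg antisym)
    then show "A = B"
      using in_closed_iff_infdist_zero[OF cl(1) ne(1)] in_closed_iff_infdist_zero[OF cl(2) ne(2)]
      by blast
  next
    assume "A = B"
    then show "hausdorff_dist A B = 0" using ne by (simp add: hausdorff_dist_def)
  qed
next
  fix A B C assume "A \<in> compacta" "B \<in> compacta" "C \<in> compacta"
  then have ne: "A \<noteq> {}" "B \<noteq> {}" "C \<noteq> {}" and cpt: "compact B"
    by (auto simp: compacta_def)
  have *: "infdist x Z \<le> hausdorff_dist X B + hausdorff_dist B Z"
    if "x \<in> X" "X \<noteq> {}" "Z \<noteq> {}" for x :: riemann_sphere and X Z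
  proof -
    have "infdist x B \<le> hausdorff_dist X B"
      using hausdorff_dist_le_iff[OF that(2) ne(2), of "hausdorff_dist X B"] that(1) by blast
    moreover obtain b where "b \<in> B" "dist x b \<le> infdist x B"
    proof -
      have "continuous_on B (dist x)" by (intro continuous_intros)
      then obtain b where "b \<in> B" "\<forall>y\<in>B. dist x b \<le> dist x y"
        using continuous_attains_inf[OF cpt ne(2)] by blast
      then show ?thesis
        using that ne(2) by (metis cINF_greatest infdist_notempty)
    qed
    moreover have "infdist b Z \<le> hausdorff_dist B Z" if "b \<in> B" for b
      using hausdorff_dist_le_iff[OF ne(2) \<open>Z \<noteq> {}\<close>, of "hausdorff_dist B Z"] that by blast
    ultimately show ?thesis
      using infdist_triangle[of x Z b] by force
  qed
  have sym: "hausdorff_dist X Y = hausdorff_dist Y X" for X Y :: "riemann_sphere set"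
    by (auto simp: hausdorff_dist_def max.commute)
  show "hausdorff_dist A C \<le> hausdorff_dist A B + hausdorff_dist B C"
    unfolding hausdorff_dist_le_iff[OF ne(1,3)]
    using *[of _ A C] *[of _ C A] ne by (metis add.commute sym)
qed

definition compacta\<^sub>0_topology :: "riemann_sphere set topology" where
  "compacta\<^sub>0_topology = subtopology (Metric_space.mtopology compacta hausdorff_dist) compacta\<^sub>0"


definition SL2 :: "(complex^2^2) monoid" where
  "SL2 = \<lparr>carrier = {A. det A = 1}, mult = (**), one = mat 1\<rparr>"

definition PSL2 :: "(complex^2^2) set monoid" where
  "PSL2 = SL2 Mod {mat 1, - mat 1}"

lemma matrix_mult_neg:
  fixes A B :: "complex^2^2"
  shows "(- A) ** B = - (A ** B)" "A ** (- B) = - (A ** B)"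
  by (simp_all add: matrix_matrix_mult_def vec_eq_iff sum_negf)

lemma det_neg_2: "det (- A :: complex^2^2) = det A"
  by (simp add: det_2)

lemma group_SL2: "group SL2"
proof (rule groupI)
  fix A assume "A \<in> carrier SL2"
  then have A: "det A = 1" by (simp add: SL2_def)
  then have "invertible A" by (simp add: invertible_det_nz)
  then obtain B where B: "A ** B = mat 1" "B ** A = mat 1" unfolding invertible_def by blast
  then have "det B = 1" using A det_mul[of A B] by (simp add: det_I)
  then show "\<exists>B\<in>carrier SL2. B \<otimes>\<^bsub>SL2\<^esub> A = \<one>\<^bsub>SL2\<^esub>"
    using B by (auto simp: SL2_def)
qed (auto simp: SL2_def det_mul det_I matrix_mul_assoc)

lemma r_coset_SL2: "{mat 1, - mat 1} #>\<^bsub>SL2\<^esub> A = {A, - A}"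
  by (auto simp: r_coset_def SL2_def matrix_mult_neg)

lemma normal_SL2: "{mat 1, - mat 1} \<lhd> SL2"
proof -
  interpret group SL2 by (rule group_SL2)
  have sub: "subgroup {mat 1, - mat 1} SL2"
  proof (rule subgroupI)
    have "- mat 1 \<in> carrier SL2" "(- mat 1) \<otimes>\<^bsub>SL2\<^esub> (- mat 1) = \<one>\<^bsub>SL2\<^esub>"
      by (simp_all add: SL2_def det_neg_2 det_I matrix_mult_neg)
    then have "inv\<^bsub>SL2\<^esub> (- mat 1) = - mat 1" by (intro inv_equality) auto
    moreover have "inv\<^bsub>SL2\<^esub> (mat 1) = mat 1" using inv_one by (simp add: SL2_def)
    ultimately show "inv\<^bsub>SL2\<^esub> A \<in> {mat 1, - mat 1}" if "A \<in> {mat 1, - mat 1}" for A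
      using that by auto
  qed (auto simp: SL2_def det_neg_2 det_I matrix_mult_neg)
  show ?thesis
    by (rule normalI[OF sub])
      (auto simp: r_coset_def l_coset_def SL2_def matrix_mult_neg)
qed

lemma group_PSL2: "group PSL2"
  unfolding PSL2_def by (rule normal.factorgroup_is_group[OF normal_SL2])

lemma carrier_PSL2: "carrier PSL2 = (\<lambda>A. {A, - A}) ` {A. det A = 1}"
  by (simp add: PSL2_def carrier_FactGroup r_coset_SL2) (simp add: SL2_def)

text \<open>The quotient topology: the points of \<open>PSL2\<close> are the cosets in \<open>SL2\<close>, so \<open>\<Union>U\<close> is the
  preimage of \<open>U\<close> under the projection.\<close>

definition PSL2_topology :: "(complex^2^2) set topology" where
  "PSL2_topology =
     topology (\<lambda>U. U \<subseteq> carrier PSL2 \<and> openin (top_of_set (carrier SL2)) (\<Union>U))"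

lemma openin_PSL2_topology:
  "openin PSL2_topology U \<longleftrightarrow> U \<subseteq> carrier PSL2 \<and> openin (top_of_set (carrier SL2)) (\<Union>U)"
proof -
  have Int: "\<Union>(U \<inter> V) = \<Union>U \<inter> \<Union>V" if "U \<subseteq> carrier PSL2" "V \<subseteq> carrier PSL2" for U V
  proof -
    have "g = h" if "g \<in> carrier PSL2" "h \<in> carrier PSL2" "A \<in> g" "A \<in> h" for g h A
      using that by (auto simp: carrier_PSL2)
    with that show ?thesis by blast
  qed
  have "istopology (\<lambda>U. U \<subseteq> carrier PSL2 \<and> openin (top_of_set (carrier SL2)) (\<Union>U))"
    unfolding istopology_def
  proof (intro conjI allI impI)
    fix \<U> assume *: "\<forall>U\<in>\<U>. U \<subseteq> carrier PSL2 \<and> openin (top_of_set (carrier SL2)) (\<Union>U)"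
    have "openin (top_of_set (carrier SL2)) (\<Union>(Union ` \<U>))"
      by (rule openin_Union) (use * in auto)
    moreover have "\<Union>(Union ` \<U>) = \<Union>(\<Union>\<U>)" by blast
    ultimately show "openin (top_of_set (carrier SL2)) (\<Union>(\<Union>\<U>))" by simp
  qed (auto simp: Int)
  then show ?thesis by (simp add: PSL2_topology_def topology_inverse')
qed

definition discrete_subgroup :: "(complex^2^2) set set \<Rightarrow> bool" where
  "discrete_subgroup \<Gamma> \<longleftrightarrow>
     subgroup \<Gamma> PSL2 \<and> subtopology PSL2_topology \<Gamma> = discrete_topology \<Gamma>"

fun moebius :: "complex^2^2 \<Rightarrow> riemann_sphere \<Rightarrow> riemann_sphere" where
  "moebius A (Fin z) =
     (if A$2$1 * z + A$2$2 = 0 then Infty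
      else Fin ((A$1$1 * z + A$1$2) / (A$2$1 * z + A$2$2)))"
| "moebius A Infty = (if A$2$1 = 0 then Infty else Fin (A$1$1 / A$2$1))"

text \<open>Hyperbolic 3-space in the upper half-space model, and the Poincare extension of a Moebius
  transformation to it.\<close>

definition hyp3 :: "(complex \<times> real) set" where
  "hyp3 = {(z, t). t > 0}"

fun poincare_ext :: "complex^2^2 \<Rightarrow> complex \<times> real \<Rightarrow> complex \<times> real" where
  "poincare_ext A (z, t) =
     (let a = A$1$1; b = A$1$2; c = A$2$1; d = A$2$2;
          N = (cmod (c * z + d))\<^sup>2 + (cmod c)\<^sup>2 * t\<^sup>2
      in (((a * z + b) * cnj (c * z + d) + a * cnj c * of_real (t\<^sup>2)) / of_real N, t / N))"

text \<open>An element of \<open>PSL2\<close> acts through either of its two representing matrices.\<close>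

definition sphere_act :: "(complex^2^2) set \<Rightarrow> riemann_sphere \<Rightarrow> riemann_sphere" where
  "sphere_act g = moebius (SOME A. A \<in> g)"

definition hyp3_act :: "(complex^2^2) set \<Rightarrow> complex \<times> real \<Rightarrow> complex \<times> real" where
  "hyp3_act g = poincare_ext (SOME A. A \<in> g)"

lemma moebius_neg: "moebius (- A) = moebius A"
proof
  have neg: "- u - v = - (u + v)" for u v :: complex
    by simp
  have *: "- u - v = 0 \<longleftrightarrow> u + v = 0" "(- u - v) / (- w - x) = (u + v) / (w + x)"
    for u v w x :: complex
    by (simp_all only: neg neg_equal_0_iff_equal minus_divide_divide)
  show "moebius (- A) x = moebius A x" for x
    by (cases x) (auto simp: * add_eq_0_iff)
qed

lemma poincare_ext_neg: "poincare_ext (- A) = poincare_ext A"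
proof
  have *: "cmod (- u - v) = cmod (u + v)" for u v :: complex
    using norm_minus_cancel[of "u + v"] by simp
  show "poincare_ext (- A) p = poincare_ext A p" for p
    by (cases p) (simp add: Let_def *, simp add: algebra_simps)
qed

lemma some_in_PSL2:
  assumes "g \<in> carrier PSL2" "A \<in> g"
  shows "(SOME A. A \<in> g) = A \<or> (SOME A. A \<in> g) = - A"
  using assms someI[of "\<lambda>A. A \<in> g" A] by (auto simp: carrier_PSL2)

lemma sphere_act_eq: "g \<in> carrier PSL2 \<Longrightarrow> A \<in> g \<Longrightarrow> sphere_act g = moebius A"
  using some_in_PSL2[of g A] by (auto simp: sphere_act_def moebius_neg)

lemma hyp3_act_eq: "g \<in> carrier PSL2 \<Longrightarrow> A \<in> g \<Longrightarrow> hyp3_act g = poincare_ext A"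
  using some_in_PSL2[of g A] by (auto simp: hyp3_act_def poincare_ext_neg)


text \<open>The union of hyperbolic space and its ideal boundary is the one-point compactification of
  the closed half-space; its point \<open>None\<close> is the ideal point \<open>Infty\<close>.\<close>

definition hyp3_compactification :: "(complex \<times> real) option topology" where
  "hyp3_compactification = Alexandroff_compactification (top_of_set {(z, t). t \<ge> 0})"

fun ideal_point :: "riemann_sphere \<Rightarrow> (complex \<times> real) option" where
  "ideal_point (Fin z) = Some (z, 0)"
| "ideal_point Infty = None"

definition limit_set :: "(complex^2^2) set set \<Rightarrow> complex \<times> real \<Rightarrow> riemann_sphere set" where
  "limit_set \<Gamma> p =
     {x. ideal_point x \<in> hyp3_compactification derived_set_of ((\<lambda>g. Some (hyp3_act g p)) ` \<Gamma>)}"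

text \<open>The limit set of a discrete group does not depend on the base point. Rather than fix a base
  point, we ask for equality with the sphere for all of them.\<close>

definition first_kind :: "(complex^2^2) set set \<Rightarrow> bool" where
  "first_kind \<Gamma> \<longleftrightarrow> (\<forall>p\<in>hyp3. limit_set \<Gamma> p = UNIV)"


definition jordan_curve :: "riemann_sphere set \<Rightarrow> bool" where
  "jordan_curve J \<longleftrightarrow>
     (\<exists>\<gamma> :: complex \<Rightarrow> riemann_sphere.
        continuous_on (sphere 0 1) \<gamma> \<and> inj_on \<gamma> (sphere 0 1) \<and> J = \<gamma> ` sphere 0 1)"

definition round_circle :: "riemann_sphere set \<Rightarrow> bool" where
  "round_circle C \<longleftrightarrow>
     (\<exists>c r. r > 0 \<and> C = Fin ` sphere c r) \<or>
     (\<exists>a u. u \<noteq> 0 \<and> C = insert Infty (Fin ` range (\<lambda>t::real. a + of_real t * u)))"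

definition abs_continuous_on_interval :: "real \<Rightarrow> real \<Rightarrow> (real \<Rightarrow> complex) \<Rightarrow> bool" where
  "abs_continuous_on_interval a b f \<longleftrightarrow>
     (\<forall>\<epsilon>>0. \<exists>\<delta>>0. \<forall>\<D>. \<D> division_of \<Union>\<D> \<and> \<Union>\<D> \<subseteq> {a..b} \<and> (\<Sum>I\<in>\<D>. Sup I - Inf I) < \<delta> \<longrightarrow>
        (\<Sum>I\<in>\<D>. dist (f (Inf I)) (f (Sup I))) < \<epsilon>)"

definition abs_continuous_on_lines :: "complex set \<Rightarrow> (complex \<Rightarrow> complex) \<Rightarrow> bool" where
  "abs_continuous_on_lines D f \<longleftrightarrow>
     (\<forall>p q. cbox p q \<subseteq> D \<longrightarrow>
        (AE y in lebesgue. y \<in> {Im p..Im q} \<longrightarrow>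
           abs_continuous_on_interval (Re p) (Re q) (\<lambda>x. f (Complex x y))) \<and>
        (AE x in lebesgue. x \<in> {Re p..Re q} \<longrightarrow>
           abs_continuous_on_interval (Im p) (Im q) (\<lambda>y. f (Complex x y))))"

definition has_partials_at :: "(complex \<Rightarrow> complex) \<Rightarrow> complex \<Rightarrow> bool" where
  "has_partials_at f z \<longleftrightarrow>
     (\<lambda>t::real. f (z + of_real t)) differentiable at 0 \<and>
     (\<lambda>t::real. f (z + \<i> * of_real t)) differentiable at 0"

definition partial_x :: "(complex \<Rightarrow> complex) \<Rightarrow> complex \<Rightarrow> complex" where
  "partial_x f z = vector_derivative (\<lambda>t. f (z + of_real t)) (at 0)"

definition partial_y :: "(complex \<Rightarrow> complex) \<Rightarrow> complex \<Rightarrow> complex" where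
  "partial_y f z = vector_derivative (\<lambda>t. f (z + \<i> * of_real t)) (at 0)"

definition partial_z :: "(complex \<Rightarrow> complex) \<Rightarrow> complex \<Rightarrow> complex" where
  "partial_z f z = (partial_x f z - \<i> * partial_y f z) / 2"

definition partial_zbar :: "(complex \<Rightarrow> complex) \<Rightarrow> complex \<Rightarrow> complex" where
  "partial_zbar f z = (partial_x f z + \<i> * partial_y f z) / 2"

text \<open>Orientation is preserved if the local degree is 1 at every point.\<close>

definition orientation_preserving_on :: "complex set \<Rightarrow> (complex \<Rightarrow> complex) \<Rightarrow> bool" where
  "orientation_preserving_on D f \<longleftrightarrow>
     (\<forall>z\<in>D. \<forall>\<^sub>F r in at_right 0. winding_number (f \<circ> circlepath z r) (f z) = 1)"

text \<open>The conditions on a homeomorphism between domains of the sphere are local and are imposed in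
  the coordinates \<open>z\<close> and \<open>1/z\<close>, both in the source and in the target. The charts below are the
  inverses of these coordinates.\<close>

definition recip_chart :: "complex \<Rightarrow> riemann_sphere" where
  "recip_chart z = (if z = 0 then Infty else Fin (1 / z))"

definition quasiconformal ::
  "real \<Rightarrow> riemann_sphere set \<Rightarrow> riemann_sphere set \<Rightarrow> (riemann_sphere \<Rightarrow> riemann_sphere) \<Rightarrow> bool"
where
  "quasiconformal K U V h \<longleftrightarrow>
     K \<ge> 1 \<and> open U \<and> connected U \<and> U \<noteq> {} \<and> open V \<and> connected V \<and> V \<noteq> {} \<and>
     (\<exists>k. homeomorphism U V h k) \<and>
     (\<forall>\<phi>\<in>{Fin, recip_chart}. \<forall>\<psi>\<in>{Fin, recip_chart}.
        let D = {z. \<phi> z \<in> U \<and> h (\<phi> z) \<in> range \<psi>}; f = inv_into UNIV \<psi> \<circ> h \<circ> \<phi> in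
          orientation_preserving_on D f \<and>
          abs_continuous_on_lines D f \<and>
          (AE z in lebesgue. z \<in> D \<longrightarrow>
             has_partials_at f z \<and>
             cmod (partial_zbar f z) \<le> (K - 1) / (K + 1) * cmod (partial_z f z)))"

lemma inj_charts: "inj Fin" "inj recip_chart"
  by (auto intro!: injI simp: recip_chart_def split: if_splits)

definition quasicircle :: "real \<Rightarrow> riemann_sphere set \<Rightarrow> bool" where
  "quasicircle K J \<longleftrightarrow>
     jordan_curve J \<and> (\<exists>h C. quasiconformal K UNIV UNIV h \<and> round_circle C \<and> J = h ` C)"

definition BH_group :: "(complex^2^2) set set \<Rightarrow> bool" where
  "BH_group \<Gamma> \<longleftrightarrow>
     subgroup \<Gamma> PSL2 \<and>
     (\<forall>\<C>. closedin compacta\<^sub>0_topology \<C> \<and>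
          (\<forall>g\<in>\<Gamma>. \<forall>A\<in>\<C>. sphere_act g ` A \<in> \<C>) \<and>
          (\<forall>J\<in>\<C>. jordan_curve J) \<longrightarrow>
        (\<exists>K\<ge>1. \<forall>J\<in>\<C>. quasicircle K J))"

end

theory Submission
  imports Defs
begin

text \<open>Suppose that some point of the sphere is not a limit point of the orbit of \<open>p\<close>. Then some half-ball,
of radius \<open>\<delta>\<close> about a finite ideal point \<open>z0\<close>, contains no point of the orbit
(\<open>not_limit_point_avoids_half_ball\<close>). Let \<open>J\<close> be a Jordan curve in the planar disc of radius \<open>\<delta> / 2\<close>
about \<open>z0\<close>. The translates of \<open>J\<close> shrink: for every \<open>d > 0\<close> only finitely many of the transformations
move two points of \<open>J\<close> to points at distance more than \<open>d\<close> (\<open>large_images_finite\<close>). A limit of pairwise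
different translates is therefore a singleton, so the orbit of \<open>J\<close> is closed among the compact sets that
are not singletons (\<open>closedin_orbit\<close>). The orbit is invariant and consists of Jordan curves, so the BH
condition makes \<open>J\<close> a quasicircle. This is absurd if \<open>J\<close> has a cusp, and every disc contains such
a curve (\<open>cusp_curve_not_quasicircle\<close>).

The translates shrink for the following reason. In homogeneous coordinates the chordal distance of the
images of \<open>z\<close> and \<open>w\<close> under a matrix \<open>A\<close> of determinant 1 is \<open>2 * cmod (z - w)\<close> divided by the product of
the norms of \<open>A (z, 1)\<close> and \<open>A (w, 1)\<close>. The square of such a norm is, up to a factor that depends only on
\<open>p\<close>, at least \<open>N * (\<bar>z - \<zeta>\<bar>\<^sup>2 + (t / N)\<^sup>2)\<close>, where \<open>(\<zeta>, t / N)\<close> is the image of \<open>p = (w, t)\<close> under the inverse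
of \<open>A\<close>. For \<open>z\<close> in the disc the second factor is at least \<open>(\<delta> / 2)\<^sup>2\<close> because the orbit avoids the half-ball, so a
bounded norm forces a bounded \<open>N\<close>, hence a bounded matrix, and a discrete group has only finitely many of
those (\<open>escaping_matrices_finite\<close>).

A curve with cusps is not a quasicircle by a length-area argument. Near the tip of a cusp two points
\<open>P\<close> and \<open>Q\<close> with the same abscissa are much closer to each other than to the tips, so that for every \<open>n\<close> there
is a round ring about \<open>P\<close> with ratio \<open>2 ^ n\<close> of its radii that separates \<open>P\<close> and \<open>Q\<close> from both tips. Suppose
that the curve is the image of a round circle under a quasiconformal map \<open>h\<close>. The preimages of \<open>P\<close> and
\<open>Q\<close> lie on opposite sides of the preimage \<open>t\<close> of the tip. If \<open>c\<close> is the one nearer to \<open>t\<close>, then all square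
frames about \<open>c\<close> with radii in an interval \<open>(s, 3 / 2 * s)\<close> separate \<open>c\<close> and \<open>t\<close> from the preimage of the
other point and from that of the other tip. Hence they meet the preimages of both complementary components
of the ring, and \<open>ln \<bar>h - P\<bar>\<close> oscillates along each frame by a multiple of \<open>n\<close>. But the Cauchy-Schwarz
inequality and the quasi-invariance of area allow only a multiple of the square root of \<open>n\<close>
(\<open>quasiconformal_ring_bound\<close>).

The area inequality that is needed (\<open>conformal_density\<close>) is
\<open>\<integral> \<rho>(f)\<^sup>2 m\<^sup>2 \<le> C \<integral> \<rho>\<^sup>2\<close>, where \<open>m\<close> bounds the partial derivatives of \<open>f\<close>. It holds
because the points where the dilatation condition holds and the derivative does not vanish are covered by countably many pieces on which \<open>f\<close> is nearly affine along horizontals and verticals, and on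
each piece the inverse of \<open>f\<close> is Lipschitz.\<close>


section \<open>The area of Lipschitz images\<close>

text \<open>Cover \<open>T\<close> by non-overlapping squares whose total area is close to that of \<open>T\<close>. The image of the part of \<open>T\<close>
in a square of side \<open>s\<close> lies in a disc of radius \<open>M * sqrt 2 * s\<close>; the constant 8 comes from \<open>2 * pi \<le> 8\<close>.\<close>

lemma emeasure_Lipschitz_image_bounded:
  fixes g :: "complex \<Rightarrow> complex"
  assumes T: "T \<in> sets borel" "T \<subseteq> cbox (Complex (-N) (-N)) (Complex N N)" and N: "N > 0"
    and lip: "\<And>x y. x \<in> T \<Longrightarrow> y \<in> T \<Longrightarrow> dist (g x) (g y) \<le> M * dist x y" and M: "M > 0"
  shows "emeasure lborel (g ` T) \<le> ennreal (8 * M\<^sup>2) * emeasure lborel T"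
proof -
  have *: "emeasure lborel (g ` T) \<le> ennreal (8 * M\<^sup>2) * emeasure lborel T + ennreal (8 * M\<^sup>2) * ennreal e"
    if "e > 0" for e :: real
  proof -
    let ?a = "Complex (-N) (-N)" and ?b = "Complex N N"
    have Tm: "T \<in> lmeasurable"
      by (rule bounded_set_imp_lmeasurable[OF bounded_subset[OF bounded_cbox T(2)]]) (use T in simp)
    obtain \<D> where D: "countable \<D>"
        "\<And>K. K \<in> \<D> \<Longrightarrow> K \<subseteq> cbox ?a ?b \<and> K \<noteq> {} \<and> (\<exists>c d. K = cbox c d)"
        "pairwise (\<lambda>A B. interior A \<inter> interior B = {}) \<D>"
        "\<And>u v. cbox u v \<in> \<D> \<Longrightarrow> \<exists>n. \<forall>i \<in> Basis. v \<bullet> i - u \<bullet> i = (?b \<bullet> i - ?a \<bullet> i)/2^n"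
        "\<And>K. \<lbrakk>K \<in> \<D>; box ?a ?b \<noteq> {}\<rbrakk> \<Longrightarrow> interior K \<noteq> {}"
        "T \<subseteq> \<Union>\<D>" "\<Union>\<D> \<in> lmeasurable" "measure lebesgue (\<Union>\<D>) \<le> measure lebesgue T + e"
      by (rule measurable_outer_intervals_bounded[OF Tm T(2) \<open>e > 0\<close>]) (rule that; assumption)
    have each: "\<exists>c. g ` (T \<inter> K) \<subseteq> c \<and> c \<in> sets borel \<and> emeasure lborel c \<le> ennreal (8 * M\<^sup>2) * emeasure lborel K"
      if "K \<in> \<D>" for K
    proof -
      obtain u v where K: "K = cbox u v" "K \<noteq> {}" using D(2) \<open>K \<in> \<D>\<close> by blast
      obtain n where n: "\<forall>i \<in> Basis. v \<bullet> i - u \<bullet> i = (?b \<bullet> i - ?a \<bullet> i)/2^n"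
        using D(4)[of u v] \<open>K \<in> \<D>\<close> K by blast
      define s where "s = 2 * N / 2 ^ n"
      have s: "Re v - Re u = s" "Im v - Im u = s" "s > 0"
        using n[rule_format, of 1] n[rule_format, of \<i>] N by (auto simp: s_def Basis_complex_def)
      have mK: "emeasure lborel K = ennreal (s\<^sup>2)"
        using s K by (simp add: emeasure_lborel_cbox_eq Basis_complex_def power2_eq_square)
      show ?thesis
      proof (cases "T \<inter> K = {}")
        case False
        then obtain x0 where x0: "x0 \<in> T" "x0 \<in> K" by blast
        have "cmod (x - x0) \<le> sqrt 2 * s" if "x \<in> K" for x
        proof -
          have "\<bar>Re (x - x0)\<bar> \<le> s" "\<bar>Im (x - x0)\<bar> \<le> s"
            using that x0(2) s K by (auto simp: in_cbox_complex_iff)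
          then have "(Re (x - x0))\<^sup>2 \<le> s\<^sup>2" "(Im (x - x0))\<^sup>2 \<le> s\<^sup>2"
            by (metis abs_le_square_iff abs_of_pos s(3))+
          then have "(cmod (x - x0))\<^sup>2 \<le> 2 * s\<^sup>2" by (simp add: cmod_power2)
          then have "cmod (x - x0) \<le> sqrt (2 * s\<^sup>2)" using real_le_rsqrt by blast
          then show ?thesis using s by (simp add: real_sqrt_mult)
        qed
        then have "dist (g x) (g x0) \<le> M * (sqrt 2 * s)" if "x \<in> T" "x \<in> K" for x
          using lip[OF that(1) x0(1)] that M by (smt (verit, best) dist_norm mult_left_mono)
        then have sub: "g ` (T \<inter> K) \<subseteq> cball (g x0) (M * (sqrt 2 * s))"
          by (auto simp: dist_commute)
        have "emeasure lborel (cball (g x0) (M * (sqrt 2 * s))) = ennreal (unit_ball_vol 2 * (M * (sqrt 2 * s))^2)"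
          using emeasure_cball[of "M * (sqrt 2 * s)" "g x0"] M s by simp
        also have "\<dots> \<le> ennreal (8 * M\<^sup>2 * s\<^sup>2)"
        proof (rule ennreal_leI)
          have "(M * (sqrt 2 * s))\<^sup>2 = 2 * (M\<^sup>2 * s\<^sup>2)" by (simp add: power_mult_distrib)
          moreover have "pi * (2 * (M\<^sup>2 * s\<^sup>2)) \<le> 4 * (2 * (M\<^sup>2 * s\<^sup>2))"
            by (rule mult_right_mono) (use pi_less_4 in auto)
          ultimately show "unit_ball_vol 2 * (M * (sqrt 2 * s))^2 \<le> 8 * M\<^sup>2 * s\<^sup>2"
            by (simp only: unit_ball_vol_2)
        qed
        also have "\<dots> = ennreal (8 * M\<^sup>2) * emeasure lborel K"
          unfolding mK by (rule ennreal_mult) auto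
        finally show ?thesis
          using sub by (intro exI[of _ "cball (g x0) (M * (sqrt 2 * s))"]) simp
      qed auto
    qed
    from each have "\<forall>K\<in>\<D>. \<exists>c. g ` (T \<inter> K) \<subseteq> c \<and> c \<in> sets borel \<and>
        emeasure lborel c \<le> ennreal (8 * M\<^sup>2) * emeasure lborel K" by blast
    then obtain c where c: "\<forall>K\<in>\<D>. g ` (T \<inter> K) \<subseteq> c K \<and> c K \<in> sets borel \<and>
        emeasure lborel (c K) \<le> ennreal (8 * M\<^sup>2) * emeasure lborel K" by (rule bchoice[THEN exE])
    define KK where "KK n = (if n \<in> to_nat_on \<D> ` \<D> then from_nat_into \<D> n else {})" for n
    define cc where "cc n = (if n \<in> to_nat_on \<D> ` \<D> then c (KK n) else {})" for n
    have KD: "KK n \<in> \<D>" if "n \<in> to_nat_on \<D> ` \<D>" for n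
      using that by (auto simp: KK_def intro!: from_nat_into)
    have cc: "cc n \<in> sets borel" "emeasure lborel (cc n) \<le> ennreal (8 * M\<^sup>2) * emeasure lborel (interior (KK n))" for n
    proof -
      show "cc n \<in> sets borel" using c KD by (auto simp: cc_def)
      show "emeasure lborel (cc n) \<le> ennreal (8 * M\<^sup>2) * emeasure lborel (interior (KK n))"
      proof (cases "n \<in> to_nat_on \<D> ` \<D>")
        case True
        then obtain u v where uv: "KK n = cbox u v" using D(2) KD by meson
        have "emeasure lborel (interior (KK n)) = emeasure lborel (KK n)"
          unfolding uv by (simp add: emeasure_lborel_cbox_eq emeasure_lborel_box_eq)
        then show ?thesis using c KD True by (simp add: cc_def)
      qed (simp add: cc_def)
    qed
    have "\<exists>n. g x \<in> cc n" if x: "x \<in> T" for x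
    proof -
      obtain K where K: "x \<in> K" "K \<in> \<D>" using x D(6) by blast
      have "KK (to_nat_on \<D> K) = K" using K D(1) by (simp add: KK_def)
      then have "cc (to_nat_on \<D> K) = c K" using K by (simp add: cc_def)
      then show ?thesis using c K x by blast
    qed
    then have "g ` T \<subseteq> (\<Union>n. cc n)" by blast
    then have "emeasure lborel (g ` T) \<le> emeasure lborel (\<Union>n. cc n)"
      by (rule emeasure_mono) (use cc in auto)
    also have "\<dots> \<le> (\<Sum>n. emeasure lborel (cc n))"
      by (rule emeasure_subadditive_countably) (use cc in auto)
    also have "\<dots> \<le> (\<Sum>n. ennreal (8 * M\<^sup>2) * emeasure lborel (interior (KK n)))"
      by (intro suminf_le cc) auto
    also have "\<dots> = ennreal (8 * M\<^sup>2) * (\<Sum>n. emeasure lborel (interior (KK n)))"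
      by (rule ennreal_suminf_cmult)
    also have "(\<Sum>n. emeasure lborel (interior (KK n))) = emeasure lborel (\<Union>n. interior (KK n))"
    proof (rule suminf_emeasure)
      have "interior (KK m) \<inter> interior (KK n) = {}" if "m \<noteq> n" for m n
      proof (cases "m \<in> to_nat_on \<D> ` \<D> \<and> n \<in> to_nat_on \<D> ` \<D>")
        case True
        then have "KK m \<noteq> KK n" using that D(1) by (auto simp: KK_def)
        then show ?thesis using True KD D(3) unfolding pairwise_def by blast
      qed (auto simp: KK_def)
      then show "disjoint_family (\<lambda>n. interior (KK n))" by (auto simp: disjoint_family_on_def)
    qed auto
    also have "\<dots> = emeasure lebesgue (\<Union>n. interior (KK n))"
    proof -
      have "(\<Union>n. interior (KK n)) \<in> sets lborel" by auto
      then show ?thesis by simp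
    qed
    also have "\<dots> \<le> emeasure lebesgue (\<Union>\<D>)"
    proof (rule emeasure_mono)
      show "(\<Union>n. interior (KK n)) \<subseteq> \<Union>\<D>"
        using KD interior_subset unfolding KK_def by (fastforce split: if_splits)
    qed (use D(7) in auto)
    also have "\<dots> = ennreal (measure lebesgue (\<Union>\<D>))"
      by (rule emeasure_eq_measure2[OF D(7)])
    also have "\<dots> \<le> ennreal (measure lebesgue T + e)"
      using D(8) by (rule ennreal_leI)
    also have "\<dots> = emeasure lebesgue T + ennreal e"
      unfolding emeasure_eq_measure2[OF Tm] by (rule ennreal_plus) (use \<open>e > 0\<close> in auto)
    also have "emeasure lebesgue T = emeasure lborel T" using T by simp
    finally show ?thesis by (simp add: distrib_left mult_left_mono)
  qed
  show ?thesis
  proof (rule ennreal_le_epsilon)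
    fix e :: real assume "e > 0"
    then show "emeasure lborel (g ` T) \<le> ennreal (8 * M\<^sup>2) * emeasure lborel T + ennreal e"
      using *[of "e / (8 * M\<^sup>2)"] M by (simp flip: ennreal_mult)
  qed
qed

lemma emeasure_Lipschitz_image:
  fixes g :: "complex \<Rightarrow> complex"
  assumes T: "T \<in> sets borel"
    and gT: "\<And>U. U \<in> sets borel \<Longrightarrow> g ` (T \<inter> U) \<in> sets borel"
    and lip: "\<And>x y. x \<in> T \<Longrightarrow> y \<in> T \<Longrightarrow> dist (g x) (g y) \<le> M * dist x y" and M: "M > 0"
  shows "emeasure lborel (g ` T) \<le> ennreal (8 * M\<^sup>2) * emeasure lborel T"
proof -
  define Q where "Q n = cbox (Complex (- real (Suc n)) (- real (Suc n))) (Complex (real (Suc n)) (real (Suc n)))" for n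
  have x: "x \<in> Q (nat \<lceil>cmod x\<rceil>)" for x
    using abs_Re_le_cmod[of x] abs_Im_le_cmod[of x] real_nat_ceiling_ge[of "cmod x"]
    unfolding Q_def in_cbox_complex_iff by simp linarith
  have "incseq Q" by (intro incseq_SucI subsetI) (auto simp: Q_def in_cbox_complex_iff)
  then have inc: "incseq (\<lambda>n. g ` (T \<inter> Q n))" by (auto simp: incseq_def le_fun_def; blast)
  have "(\<Union>n. g ` (T \<inter> Q n)) = g ` T" using x by blast
  then have "emeasure lborel (g ` T) = (SUP n. emeasure lborel (g ` (T \<inter> Q n)))"
    using SUP_emeasure_incseq[OF _ inc, of lborel] gT by (simp add: image_subset_iff Q_def)
  also have "\<dots> \<le> ennreal (8 * M\<^sup>2) * emeasure lborel T"
  proof (rule SUP_least)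
    fix n
    have "emeasure lborel (g ` (T \<inter> Q n)) \<le> ennreal (8 * M\<^sup>2) * emeasure lborel (T \<inter> Q n)"
      by (rule emeasure_Lipschitz_image_bounded[where N = "real (Suc n)"])
         (use T gT lip M in \<open>auto simp: Q_def\<close>)
    also have "\<dots> \<le> ennreal (8 * M\<^sup>2) * emeasure lborel T"
      by (intro mult_left_mono emeasure_mono) (use T in auto)
    finally show "emeasure lborel (g ` (T \<inter> Q n)) \<le> ennreal (8 * M\<^sup>2) * emeasure lborel T" .
  qed
  finally show ?thesis .
qed

section \<open>Increments of absolutely continuous functions\<close>

lemma sum_content_division_le_emeasure:
  fixes \<D> :: "real set set"
  assumes "\<D> division_of S" "S \<subseteq> U" "U \<in> sets lborel"
  shows "ennreal (sum (measure lborel) \<D>) \<le> emeasure lborel U"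
proof -
  have fin: "finite \<D>" using assms(1) by (rule division_of_finite)
  have K: "\<exists>u v. K = {u..v}" if "K \<in> \<D>" for K
    using division_ofD(4)[OF assms(1) that] by auto
  have "ennreal (sum (measure lborel) \<D>) = (\<Sum>K\<in>\<D>. emeasure lborel (interior K))"
    unfolding sum_ennreal[OF measure_nonneg, symmetric]
  proof (rule sum.cong)
    fix K assume "K \<in> \<D>"
    then obtain u v where "K = {u..v}" using K by blast
    then show "ennreal (measure lborel K) = emeasure lborel (interior K)"
      by (cases "u \<le> v") auto
  qed auto
  also have "\<dots> = emeasure lborel (\<Union>K\<in>\<D>. interior K)"
    by (rule sum_emeasure) (use fin division_ofD(5)[OF assms(1)] in \<open>auto simp: disjoint_family_on_def\<close>)
  also have "\<dots> \<le> emeasure lborel U"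
    by (rule emeasure_mono) (use assms interior_subset division_ofD(6)[OF assms(1)] in blast)+
  finally show ?thesis .
qed

text \<open>A form of the fundamental theorem of calculus in which \<open>m\<close> only bounds the slope of \<open>G\<close>. Choose a tagged division of \<open>{a..b}\<close> that is fine for the
gauge integral of \<open>m\<close>. Off a null set \<open>N\<close> the tag of an interval controls the increment of \<open>G\<close> over it.
The intervals with tags in \<open>N\<close> lie in an open set of small measure, so absolute continuity makes their
total contribution small.\<close>

lemma AC_increment_le_integral_gradient:
  fixes G m :: "real \<Rightarrow> real"
  assumes ab: "a \<le> b"
    and AC: "abs_continuous_on_interval a b (\<lambda>t. complex_of_real (G t))"
    and m: "m \<in> borel_measurable borel" "\<And>t. 0 \<le> m t"
    and ae: "AE t in lborel. t \<in> {a..b} \<longrightarrow> (\<forall>e>0. \<exists>d>0. \<forall>u v. u \<in> {a..b} \<longrightarrow> v \<in> {a..b} \<longrightarrow>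
        u \<le> t \<longrightarrow> t \<le> v \<longrightarrow> v - u < d \<longrightarrow> \<bar>G v - G u\<bar> \<le> (m t + e) * (v - u))"
  shows "ennreal \<bar>G b - G a\<bar> \<le> (\<integral>\<^sup>+t\<in>{a..b}. ennreal (m t) \<partial>lborel)"
proof (cases "(\<integral>\<^sup>+t\<in>{a..b}. ennreal (m t) \<partial>lborel) = \<infinity>")
  case False
  define m0 where "m0 = (\<lambda>t. indicator {a..b} t * m t)"
  have m0: "m0 \<in> borel_measurable borel" "\<And>t. 0 \<le> m0 t"
    using m by (auto simp: m0_def)
  have eq: "(\<integral>\<^sup>+t\<in>{a..b}. ennreal (m t) \<partial>lborel) = (\<integral>\<^sup>+t. ennreal (m0 t) \<partial>lborel)"
    by (rule nn_integral_cong) (auto simp: m0_def indicator_def)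
  have fin: "(\<integral>\<^sup>+t. ennreal (m0 t) \<partial>lborel) < \<infinity>"
    using False unfolding eq by (simp add: top.not_eq_extremum)
  define I where "I = integral {a..b} m"
  have int0: "m0 integrable_on UNIV"
    by (rule nn_integral_integrable_on[OF m0 fin])
  then have "(m0 has_integral integral UNIV m0) UNIV" by blast
  moreover have m0_if: "m0 = (\<lambda>t. if t \<in> {a..b} then m t else 0)" by (auto simp: m0_def)
  ultimately have "(m has_integral integral UNIV m0) {a..b}"
    using has_integral_restrict_UNIV[of "{a..b}" m "integral UNIV m0"] by simp
  then have hasI: "(m has_integral I) {a..b}" and I0: "I = integral UNIV m0"
    unfolding I_def by (auto simp: integral_unique)
  have nnI: "(\<integral>\<^sup>+t. ennreal (m0 t) \<partial>lborel) = ennreal I"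
    unfolding I0 using nn_integral_lborel_eq_integral[OF m0 fin] by simp
  define good where "good t \<longleftrightarrow> t \<in> {a..b} \<longrightarrow> (\<forall>e>0. \<exists>d>0. \<forall>u v. u \<in> {a..b} \<longrightarrow> v \<in> {a..b} \<longrightarrow>
        u \<le> t \<longrightarrow> t \<le> v \<longrightarrow> v - u < d \<longrightarrow> \<bar>G v - G u\<bar> \<le> (m t + e) * (v - u))" for t
  obtain N where N: "N \<in> null_sets lborel" "{t. \<not> good t} \<subseteq> N"
    using ae unfolding good_def[symmetric] by (rule AE_E3) (use that in auto)
  \<comment> \<open>Intervals with a tag in the exceptional set must not contribute to the Riemann sum.\<close>
  define m1 where "m1 t = (if t \<in> N then 0 else m t)" for t
  have m1: "0 \<le> m1 t" for t using m by (simp add: m1_def)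
  have has1: "(m1 has_integral I) {a..b}"
  proof (rule has_integral_spike[OF _ _ hasI])
    show "negligible N" using N(1) by (simp add: negligible_iff_null_sets null_sets_completionI)
  qed (auto simp: m1_def)
  have key: "\<bar>G b - G a\<bar> \<le> I + e * (2 + (b - a))" if e: "e > 0" for e
  proof -
    obtain \<gamma>1 where g1: "gauge \<gamma>1" "\<forall>\<D>. \<D> tagged_division_of {a..b} \<and> \<gamma>1 fine \<D> \<longrightarrow>
        norm (sum (\<lambda>(x,k). measure lborel k *\<^sub>R m1 x) \<D> - I) < e"
      using has1[unfolded has_integral_real, rule_format, OF e] by (elim exE conjE)
    obtain d0 where "d0 > 0" and d0': "\<forall>\<D>. \<D> division_of \<Union>\<D> \<and> \<Union>\<D> \<subseteq> {a..b} \<and>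
        (\<Sum>I\<in>\<D>. Sup I - Inf I) < d0 \<longrightarrow>
        (\<Sum>I\<in>\<D>. dist (complex_of_real (G (Inf I))) (complex_of_real (G (Sup I)))) < e"
      using AC[unfolded abs_continuous_on_interval_def, rule_format, OF e] by (elim exE conjE)
    obtain U where U: "open U" "N \<subseteq> U" "emeasure lborel (U - N) < ennreal d0"
    proof (rule outer_regular_lborel[of N d0])
      show "N \<in> sets borel" using null_setsD2[OF N(1)] by simp
    qed (use \<open>d0 > 0\<close> that in \<open>assumption | simp\<close>)+
    have "emeasure lborel U = emeasure lborel (U - N)"
      by (rule emeasure_Diff_null_set[OF N(1), symmetric]) (use U in auto)
    then have Ud: "emeasure lborel U < ennreal d0" using U by simp
    have "\<exists>d>0. t \<in> {a..b} \<longrightarrow> t \<notin> N \<longrightarrow> (\<forall>u v. u \<in> {a..b} \<longrightarrow> v \<in> {a..b} \<longrightarrow>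
        u \<le> t \<longrightarrow> t \<le> v \<longrightarrow> v - u < d \<longrightarrow> \<bar>G v - G u\<bar> \<le> (m t + e) * (v - u))" for t
    proof (cases "t \<in> {a..b} \<and> t \<notin> N")
      case True
      then have "good t" using N(2) by blast
      then show ?thesis using True e unfolding good_def by simp
    next
      case False
      then show ?thesis using zero_less_one by blast
    qed
    then obtain d where d: "\<And>t. d t > 0" "\<And>t u v. t \<in> {a..b} \<Longrightarrow> t \<notin> N \<Longrightarrow> u \<in> {a..b} \<Longrightarrow> v \<in> {a..b} \<Longrightarrow>
        u \<le> t \<Longrightarrow> t \<le> v \<Longrightarrow> v - u < d t \<Longrightarrow> \<bar>G v - G u\<bar> \<le> (m t + e) * (v - u)"
      by metis
    define \<gamma>2 where "\<gamma>2 t = (if t \<in> N then U else ball t (d t / 2))" for t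
    have g2: "gauge \<gamma>2" unfolding gauge_def \<gamma>2_def using U d(1) by auto
    obtain p where p: "p tagged_division_of {a..b}" "(\<lambda>x. \<gamma>1 x \<inter> \<gamma>2 x) fine p"
      using fine_division_exists_real[OF gauge_Int[OF g1(1) g2]] by blast
    have fp: "\<gamma>1 fine p" "\<gamma>2 fine p" using p(2) by (auto simp: fine_def)
    have finp: "finite p" using p(1) by blast
    have pk: "\<exists>u v. k = {u..v} \<and> u \<le> x \<and> x \<le> v \<and> a \<le> u \<and> v \<le> b" if "(x,k) \<in> p" for x k
    proof -
      obtain u v where "k = {u..v}" using tagged_division_ofD(4)[OF p(1) \<open>(x, k) \<in> p\<close>] by auto
      then show ?thesis
        using tagged_division_ofD(2,3)[OF p(1) that] by auto
    qed
    define pN where "pN = {z \<in> p. fst z \<in> N}"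
    define pG where "pG = {z \<in> p. fst z \<notin> N}"
    define h where "h k = (if k = {} then 0 else \<bar>G (Sup k) - G (Inf k)\<bar>)" for k :: "real set"
    have "G b - G a = (\<Sum>(x,k)\<in>p. G (Sup k) - G (Inf k))"
      using additive_tagged_division_1[OF ab p(1), of G] by simp
    also have "\<bar>\<dots>\<bar> \<le> (\<Sum>(x,k)\<in>p. h k)"
      by (rule order_trans[OF sum_abs], rule sum_mono) (use pk in \<open>fastforce simp: h_def\<close>)
    also have "\<dots> = (\<Sum>(x,k)\<in>pN. h k) + (\<Sum>(x,k)\<in>pG. h k)"
      unfolding pN_def pG_def using finp
      by (subst sum.union_disjoint[symmetric]) (auto intro!: sum.cong)
    finally have 1: "\<bar>G b - G a\<bar> \<le> (\<Sum>(x,k)\<in>pN. h k) + (\<Sum>(x,k)\<in>pG. h k)" .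
    have "(\<Sum>(x,k)\<in>pG. h k) \<le> (\<Sum>(x,k)\<in>pG. measure lborel k *\<^sub>R m1 x + e * measure lborel k)"
    proof (rule sum_mono, clarify)
      fix x k assume xk: "(x,k) \<in> pG"
      then have "(x,k) \<in> p" "x \<notin> N" by (auto simp: pG_def)
      obtain u v where uv: "k = {u..v}" "u \<le> x" "x \<le> v" "a \<le> u" "v \<le> b" using pk \<open>(x,k) \<in> p\<close> by blast
      have "k \<subseteq> ball x (d x / 2)"
        using fineD[OF fp(2) \<open>(x,k) \<in> p\<close>] \<open>x \<notin> N\<close> by (simp add: \<gamma>2_def)
      moreover have "u \<in> k" "v \<in> k" using uv by auto
      ultimately have "u \<in> ball x (d x / 2)" "v \<in> ball x (d x / 2)" by blast+
      then have "v - u < d x" using uv by (auto simp: dist_real_def)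
      then have "\<bar>G v - G u\<bar> \<le> (m x + e) * (v - u)"
        using d(2)[of x u v] uv \<open>x \<notin> N\<close> by auto
      then show "h k \<le> measure lborel k *\<^sub>R m1 x + e * measure lborel k"
        using uv \<open>x \<notin> N\<close> by (simp add: h_def m1_def algebra_simps)
    qed
    also have "\<dots> \<le> (\<Sum>(x,k)\<in>p. measure lborel k *\<^sub>R m1 x + e * measure lborel k)"
      by (rule sum_mono2) (use finp m1 e in \<open>auto simp: pG_def\<close>)
    also have "\<dots> = (\<Sum>(x,k)\<in>p. measure lborel k *\<^sub>R m1 x) + e * (\<Sum>(x,k)\<in>p. measure lborel k)"
      by (simp add: sum.distrib sum_distrib_left case_prod_beta)
    also have "(\<Sum>(x,k)\<in>p. measure lborel k) = b - a"
      using additive_content_tagged_division[of p a b] p(1) ab by simp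
    also have "(\<Sum>(x,k)\<in>p. measure lborel k *\<^sub>R m1 x) \<le> I + e"
      using g1(2)[rule_format, OF conjI, OF p(1) fp(1)] by (simp add: abs_less_iff)
    finally have 2: "(\<Sum>(x,k)\<in>pG. h k) \<le> I + e + e * (b - a)" by simp
    have ptag: "pN tagged_division_of \<Union>(snd ` pN)"
    proof (rule tagged_partial_division_of_Union_self)
      show "pN tagged_partial_division_of {a..b}"
        using p(1) unfolding pN_def tagged_division_of_def
        by (auto intro: tagged_partial_division_subset)
    qed
    define \<D> where "\<D> = snd ` pN"
    have Ddiv: "\<D> division_of \<Union>\<D>"
      unfolding \<D>_def by (rule division_of_tagged_division[OF ptag])
    have Dk: "\<exists>u v. k = {u..v} \<and> u \<le> v \<and> a \<le> u \<and> v \<le> b \<and> k \<subseteq> U" if kD: "k \<in> \<D>" for k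
    proof -
      obtain x where x: "(x,k) \<in> p" "x \<in> N" using kD by (auto simp: \<D>_def pN_def)
      have "k \<subseteq> U" using fineD[OF fp(2) x(1)] x(2) by (simp add: \<gamma>2_def)
      then show ?thesis using pk[OF x(1)] by auto
    qed
    have "(\<Sum>k\<in>\<D>. Sup k - Inf k) = sum (measure lborel) \<D>"
      by (rule sum.cong) (use Dk in fastforce)+
    moreover have "ennreal (sum (measure lborel) \<D>) \<le> emeasure lborel U"
      by (rule sum_content_division_le_emeasure[OF Ddiv]) (use Dk U in auto)
    then have "ennreal (sum (measure lborel) \<D>) < ennreal d0" using Ud by (rule le_less_trans)
    then have "sum (measure lborel) \<D> < d0" using \<open>d0 > 0\<close> by (simp add: ennreal_less_iff sum_nonneg)
    ultimately have "(\<Sum>k\<in>\<D>. Sup k - Inf k) < d0" by simp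
    moreover have "\<Union>\<D> \<subseteq> {a..b}" using Dk by fastforce
    ultimately have "(\<Sum>k\<in>\<D>. dist (complex_of_real (G (Inf k))) (complex_of_real (G (Sup k)))) < e"
      using d0' Ddiv by blast
    moreover have "(\<Sum>k\<in>\<D>. dist (complex_of_real (G (Inf k))) (complex_of_real (G (Sup k)))) = (\<Sum>k\<in>\<D>. h k)"
      by (rule sum.cong) (use Dk in \<open>fastforce simp: h_def dist_real_def\<close>)+
    moreover have "(\<Sum>(x,k)\<in>pN. h k) = (\<Sum>k\<in>\<D>. h k)"
      unfolding \<D>_def
    proof (rule sum.over_tagged_division_lemma[OF ptag])
      fix u v :: real assume "box u v = {}"
      then show "h (cbox u v) = 0" by (cases "u = v") (auto simp: h_def)
    qed
    ultimately have "(\<Sum>(x,k)\<in>pN. h k) < e" by simp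
    then show ?thesis using 1 2 by (simp add: algebra_simps)
  qed
  have "\<bar>G b - G a\<bar> \<le> I"
  proof (rule field_le_epsilon)
    fix e :: real assume "e > 0"
    show "\<bar>G b - G a\<bar> \<le> I + e"
    proof -
      have "e / (2 + (b - a)) * (2 + (b - a)) = e" "e / (2 + (b - a)) > 0"
        using ab \<open>e > 0\<close> by (auto intro: divide_pos_pos)
      then show ?thesis using key by metis
    qed
  qed
  then show ?thesis unfolding eq nnI by (rule ennreal_leI)
qed simp

section \<open>A density for planar quasiconformal maps\<close>

text \<open>The conditions are imposed on whole chords of the rectangle. Hence the two legs of an L-shaped path between two
points of the piece are both controlled, even though the corner need not belong to the piece.\<close>

definition affine_piece :: "(complex \<Rightarrow> complex) \<Rightarrow> complex \<Rightarrow> complex \<Rightarrow> complex \<Rightarrow> complex \<Rightarrow> real \<Rightarrow> complex set"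
  where "affine_piece f p q a b \<epsilon> = {z \<in> box p q.
    (\<forall>t\<in>{Re p<..<Re q}. cmod (f (Complex t (Im z)) - f z - of_real (t - Re z) * a) \<le> \<epsilon> * \<bar>t - Re z\<bar>) \<and>
    (\<forall>t\<in>{Im p<..<Im q}. cmod (f (Complex (Re z) t) - f z - of_real (t - Im z) * b) \<le> \<epsilon> * \<bar>t - Im z\<bar>)}"

text \<open>The chords through all points of the rectangle have the same extent, so for each fixed \<open>t\<close> the condition
makes sense everywhere and is closed relative to the rectangle.\<close>

lemma affine_piece_borel:
  assumes "continuous_on (box p q) f"
  shows "affine_piece f p q a b \<epsilon> \<in> sets borel"
proof -
  let ?B = "box p q"
  define P where "P t = {z \<in> ?B. cmod (f (Complex t (Im z)) - f z - of_real (t - Re z) * a) \<le> \<epsilon> * \<bar>t - Re z\<bar>}" for t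
  define Q where "Q t = {z \<in> ?B. cmod (f (Complex (Re z) t) - f z - of_real (t - Im z) * b) \<le> \<epsilon> * \<bar>t - Im z\<bar>}" for t
  have le_closed: "closedin (top_of_set ?B) {z \<in> ?B. g z \<le> h z}"
    if "continuous_on ?B g" "continuous_on ?B h" for g h :: "complex \<Rightarrow> real"
  proof -
    have "closedin (top_of_set ?B) (?B \<inter> (\<lambda>z. g z - h z) -` {..0})"
      by (intro continuous_closedin_preimage continuous_intros that)
    moreover have "?B \<inter> (\<lambda>z. g z - h z) -` {..0} = {z \<in> ?B. g z \<le> h z}" by auto
    ultimately show ?thesis by simp
  qed
  have C: "continuous_on ?B (\<lambda>z. Complex t (Im z))" "continuous_on ?B (\<lambda>z. Complex (Re z) t)" for t
    unfolding Complex_eq by (intro continuous_intros)+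
  have "closedin (top_of_set ?B) (P t)" if "t \<in> {Re p<..<Re q}" for t
    unfolding P_def
    by (intro le_closed continuous_intros assms continuous_on_compose2[OF assms C(1)])
       (use that in \<open>auto simp: in_box_complex_iff\<close>)
  moreover have "closedin (top_of_set ?B) (Q t)" if "t \<in> {Im p<..<Im q}" for t
    unfolding Q_def
    by (intro le_closed continuous_intros assms continuous_on_compose2[OF assms C(2)])
       (use that in \<open>auto simp: in_box_complex_iff\<close>)
  ultimately have "closedin (top_of_set ?B) (\<Inter> (insert ?B (P ` {Re p<..<Re q} \<union> Q ` {Im p<..<Im q})))"
    by (intro closedin_Inter) auto
  moreover have "\<Inter> (insert ?B (P ` {Re p<..<Re q} \<union> Q ` {Im p<..<Im q})) = affine_piece f p q a b \<epsilon>"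
    by (auto simp: affine_piece_def P_def Q_def)
  ultimately obtain T where "closed T" "affine_piece f p q a b \<epsilon> = ?B \<inter> T"
    by (auto simp: closedin_closed)
  then show ?thesis by auto
qed

text \<open>The corner with the abscissa of \<open>w\<close> and the ordinate of \<open>z\<close> lies on the horizontal chord through \<open>z\<close> and on the
vertical chord through \<open>w\<close>. Going through it shows that \<open>f w - f z\<close> differs by at most \<open>2 * \<epsilon> * cmod (w - z)\<close>
from the value at \<open>v = w - z\<close> of the linear map with the partial derivatives \<open>a\<close> and \<open>b\<close>. This linear map is
\<open>\<alpha> * v + \<beta> * cnj v\<close> with \<open>\<alpha> = (a - \<i> * b) / 2\<close> and \<open>\<beta> = (a + \<i> * b) / 2\<close>.\<close>

lemma affine_piece_lower_bound:
  assumes z: "z \<in> affine_piece f p q a b \<epsilon>" and w: "w \<in> affine_piece f p q a b \<epsilon>"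
  shows "(cmod ((a - \<i> * b) / 2) - cmod ((a + \<i> * b) / 2) - 2 * \<epsilon>) * cmod (w - z) \<le> cmod (f w - f z)"
proof (cases "w = z")
  case False
  let ?c = "Complex (Re w) (Im z)"
  have zB: "z \<in> box p q" and wB: "w \<in> box p q" using z w by (auto simp: affine_piece_def)
  have 1: "cmod (f ?c - f z - of_real (Re w - Re z) * a) \<le> \<epsilon> * \<bar>Re w - Re z\<bar>"
    using z wB unfolding affine_piece_def by (auto simp: in_box_complex_iff)
  have 2: "cmod (f ?c - f w - of_real (Im z - Im w) * b) \<le> \<epsilon> * \<bar>Im z - Im w\<bar>"
    using w zB unfolding affine_piece_def by (auto simp: in_box_complex_iff)
  have "\<epsilon> \<ge> 0"
  proof (rule ccontr)
    assume "\<not> \<epsilon> \<ge> 0"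
    moreover have "Re w \<noteq> Re z \<or> Im z \<noteq> Im w" using False complex_eq_iff by auto
    ultimately have "\<epsilon> * \<bar>Re w - Re z\<bar> < 0 \<or> \<epsilon> * \<bar>Im z - Im w\<bar> < 0" by (auto intro: mult_neg_pos)
    then show False using 1 2 by (smt (verit) norm_ge_zero)
  qed
  let ?L = "of_real (Re w - Re z) * a + of_real (Im w - Im z) * b"
  have L: "?L = ((a - \<i> * b) / 2) * (w - z) + ((a + \<i> * b) / 2) * cnj (w - z)"
    by (simp add: complex_eq_iff field_simps)
  have "f w - f z - ?L = (f ?c - f z - of_real (Re w - Re z) * a) - (f ?c - f w - of_real (Im z - Im w) * b)"
    by (simp add: algebra_simps)
  then have "cmod (f w - f z - ?L) \<le> \<epsilon> * \<bar>Re w - Re z\<bar> + \<epsilon> * \<bar>Im z - Im w\<bar>"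
    using 1 2 norm_triangle_ineq4 by (smt (verit, ccfv_threshold))
  also have "\<dots> \<le> 2 * \<epsilon> * cmod (w - z)"
  proof -
    have "\<bar>Re w - Re z\<bar> + \<bar>Im z - Im w\<bar> \<le> 2 * cmod (w - z)"
      using abs_Re_le_cmod[of "w - z"] abs_Im_le_cmod[of "w - z"] by simp
    then show ?thesis using \<open>\<epsilon> \<ge> 0\<close> mult_left_mono[of _ _ \<epsilon>] by (fastforce simp: algebra_simps)
  qed
  finally have 3: "cmod (f w - f z - ?L) \<le> 2 * \<epsilon> * cmod (w - z)" .
  have "cmod ?L \<ge> cmod ((a - \<i> * b) / 2) * cmod (w - z) - cmod ((a + \<i> * b) / 2) * cmod (w - z)"
    unfolding L using norm_diff_ineq[of "((a - \<i> * b) / 2) * (w - z)" "((a + \<i> * b) / 2) * cnj (w - z)"]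
    by (simp only: norm_mult complex_mod_cnj)
  moreover have "cmod ?L \<le> cmod (f w - f z) + cmod (f w - f z - ?L)"
    by (metis norm_triangle_sub norm_minus_commute)
  ultimately show ?thesis using 3 by (simp add: algebra_simps)
qed simp

lemma has_partials_at_approx:
  assumes "has_partials_at f z" "\<epsilon> > 0"
  obtains \<delta> where "\<delta> > 0"
    "\<And>t. \<bar>t\<bar> < \<delta> \<Longrightarrow> cmod (f (z + of_real t) - f z - of_real t * partial_x f z) \<le> \<epsilon> * \<bar>t\<bar>"
    "\<And>t. \<bar>t\<bar> < \<delta> \<Longrightarrow> cmod (f (z + \<i> * of_real t) - f z - of_real t * partial_y f z) \<le> \<epsilon> * \<bar>t\<bar>"
proof -
  have *: "\<exists>\<delta>>0. \<forall>t. \<bar>t\<bar> < \<delta> \<longrightarrow> cmod (g t - g 0 - of_real t * vector_derivative g (at 0)) \<le> \<epsilon> * \<bar>t\<bar>"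
    if "g differentiable at 0" for g :: "real \<Rightarrow> complex"
  proof -
    have "(g has_derivative (\<lambda>t. t *\<^sub>R vector_derivative g (at 0))) (at 0)"
      using that unfolding vector_derivative_works has_vector_derivative_def .
    then show ?thesis
      unfolding has_derivative_at_alt using assms(2) by (simp add: scaleR_conv_of_real)
  qed
  have d1: "(\<lambda>t. f (z + of_real t)) differentiable at 0" and d2: "(\<lambda>t. f (z + \<i> * of_real t)) differentiable at 0"
    using assms(1) by (auto simp: has_partials_at_def)
  obtain d where d: "d > 0" "\<forall>t. \<bar>t\<bar> < d \<longrightarrow> cmod (f (z + of_real t) - f z - of_real t * partial_x f z) \<le> \<epsilon> * \<bar>t\<bar>"
    using *[OF d1] by (auto simp: partial_x_def)
  obtain d' where d': "d' > 0" "\<forall>t. \<bar>t\<bar> < d' \<longrightarrow> cmod (f (z + \<i> * of_real t) - f z - of_real t * partial_y f z) \<le> \<epsilon> * \<bar>t\<bar>"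
    using *[OF d2] by (auto simp: partial_y_def)
  show thesis by (rule that[of "min d d'"]) (use d d' in auto)
qed

lemma affine_piece_partials_le:
  assumes z: "z \<in> affine_piece f p q a b \<epsilon>" and d: "has_partials_at f z"
  shows "cmod (partial_x f z) \<le> cmod a + \<epsilon>" "cmod (partial_y f z) \<le> cmod b + \<epsilon>"
proof -
  have zB: "Re p < Re z" "Re z < Re q" "Im p < Im z" "Im z < Im q"
    using z by (auto simp: affine_piece_def in_box_complex_iff)
  have slope: "cmod d' \<le> cmod a' + \<epsilon> + e"
    if t: "t > 0" and le: "cmod (w - of_real t * a') \<le> \<epsilon> * t" "cmod (w - of_real t * d') \<le> e * t"
    for w a' d' :: complex and t e :: real
  proof -
    have "cmod (of_real t * (d' - a')) \<le> \<epsilon> * t + e * t"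
      using norm_triangle_ineq4[of "w - of_real t * a'" "w - of_real t * d'"] le by (simp add: right_diff_distrib)
    then have "t * cmod (d' - a') \<le> t * (\<epsilon> + e)" using t by (simp add: norm_mult distrib_left mult.commute)
    then have "cmod (d' - a') \<le> \<epsilon> + e" using t by simp
    then show ?thesis using norm_triangle_sub[of d' a'] by simp
  qed
  have "cmod (partial_x f z) \<le> cmod a + \<epsilon> + e \<and> cmod (partial_y f z) \<le> cmod b + \<epsilon> + e" if e: "e > 0" for e
  proof -
    obtain \<delta> where \<delta>: "\<delta> > 0"
      "\<And>t. \<bar>t\<bar> < \<delta> \<Longrightarrow> cmod (f (z + of_real t) - f z - of_real t * partial_x f z) \<le> e * \<bar>t\<bar>"
      "\<And>t. \<bar>t\<bar> < \<delta> \<Longrightarrow> cmod (f (z + \<i> * of_real t) - f z - of_real t * partial_y f z) \<le> e * \<bar>t\<bar>"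
      by (rule has_partials_at_approx[OF d e]) (rule that; assumption)
    define t where "t = min (\<delta> / 2) (min ((Re q - Re z) / 2) ((Im q - Im z) / 2))"
    have t: "t > 0" "t < \<delta>" "Re z + t < Re q" "Im z + t < Im q"
      using \<delta>(1) zB by (auto simp: t_def min_def field_simps split: if_splits)
    have zt: "Complex (Re z + t) (Im z) = z + of_real t" "Complex (Re z) (Im z + t) = z + \<i> * of_real t"
      by (auto simp: complex_eq_iff)
    have "cmod (f (z + of_real t) - f z - of_real t * a) \<le> \<epsilon> * t"
      using z t zB unfolding affine_piece_def zt[symmetric] by (auto dest!: bspec[of _ _ "Re z + t"])
    moreover have "cmod (f (z + \<i> * of_real t) - f z - of_real t * b) \<le> \<epsilon> * t"
      using z t zB unfolding affine_piece_def zt[symmetric] by (auto dest!: bspec[of _ _ "Im z + t"])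
    moreover have "\<bar>t\<bar> < \<delta>" "\<bar>t\<bar> = t" using t by auto
    ultimately show ?thesis using slope[OF t(1)] \<delta>(2,3)[of t] by metis
  qed
  then show "cmod (partial_x f z) \<le> cmod a + \<epsilon>" "cmod (partial_y f z) \<le> cmod b + \<epsilon>"
    by (auto intro: field_le_epsilon)
qed

definition rat_complex :: "rat \<times> rat \<Rightarrow> complex" where
  "rat_complex r = Complex (of_rat (fst r)) (of_rat (snd r))"

lemma rat_complex_dense:
  assumes "e > 0"
  obtains r where "cmod (rat_complex r - x) < e"
proof -
  obtain s where s: "Re x < of_rat s" "of_rat s < Re x + e / 2"
    using of_rat_dense[of "Re x" "Re x + e / 2"] assms by auto
  obtain t where t: "Im x < of_rat t" "of_rat t < Im x + e / 2"
    using of_rat_dense[of "Im x" "Im x + e / 2"] assms by auto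
  have "cmod (rat_complex (s, t) - x) < e"
    using cmod_le[of "rat_complex (s, t) - x"] s t by (simp add: rat_complex_def)
  then show thesis by (rule that)
qed

lemma rat_complex_box:
  assumes "e > 0"
  obtains r s where "x \<in> box (rat_complex r) (rat_complex s)" "box (rat_complex r) (rat_complex s) \<subseteq> ball x e"
proof -
  obtain a b where ab: "\<forall>i\<in>Basis. a \<bullet> i \<in> \<rat> \<and> b \<bullet> i \<in> \<rat>" "x \<in> box a b" "box a b \<subseteq> ball x e"
    using rational_boxes[OF assms, of x] by blast
  have "\<exists>r. rat_complex r = c" if c: "Re c \<in> \<rat>" "Im c \<in> \<rat>" for c
  proof -
    obtain u where "Re c = of_rat u" using c(1) by (rule Rats_cases)
    moreover obtain v where "Im c = of_rat v" using c(2) by (rule Rats_cases)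
    ultimately show ?thesis by (intro exI[of _ "(u, v)"]) (simp add: rat_complex_def complex_eq_iff)
  qed
  then obtain r s where "rat_complex r = a" "rat_complex s = b"
    using ab(1) by (auto simp: Basis_complex_def) metis
  then show thesis using that ab by blast
qed

text \<open>Rational rectangles and slopes suffice, so there are only countably many pieces. Weakening the dilatation bound from
\<open>k\<close> to \<open>(1 + k) / 2\<close> leaves room for the approximation of the partial derivatives by rational slopes.\<close>

lemma exists_affine_piece:
  assumes D: "open D" "z \<in> D" and d: "has_partials_at f z" and k: "0 \<le> k" "k < 1"
    and le: "cmod (partial_zbar f z) \<le> k * cmod (partial_z f z)" and nz: "partial_z f z \<noteq> 0"
  obtains p q a b where "box (rat_complex p) (rat_complex q) \<subseteq> D"
    "cmod ((rat_complex a + \<i> * rat_complex b) / 2) \<le> (1 + k) / 2 * cmod ((rat_complex a - \<i> * rat_complex b) / 2)"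
    "(rat_complex a - \<i> * rat_complex b) / 2 \<noteq> 0"
    "z \<in> affine_piece f (rat_complex p) (rat_complex q) (rat_complex a) (rat_complex b)
       ((1 - k) / 8 * cmod ((rat_complex a - \<i> * rat_complex b) / 2))"
proof -
  let ?F = "cmod (partial_z f z)"
  \<comment> \<open>One \<open>e\<close> is spent on the slopes and one on the difference quotients; together they stay below
    the tolerance, which is about \<open>4 * e\<close>.\<close>
  define e where "e = (1 - k) / 32 * ?F"
  have F: "?F > 0" using nz by simp
  have e: "e > 0" using k F by (simp add: e_def)
  have eF: "32 * e = ?F - k * ?F" "k * ?F \<ge> 0" "k * e \<le> e" "k * e \<ge> 0" using k F e
  proof -
    have "32 * e = (1 - k) * ?F" by (simp add: e_def)
    then show "32 * e = ?F - k * ?F" by (simp only: left_diff_distrib mult_1)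
    show "k * e \<le> e" using mult_right_mono[of k 1 e] k e by simp
  qed (use k e in auto)
  obtain a where a: "cmod (rat_complex a - partial_x f z) < e" using rat_complex_dense[OF e] by blast
  obtain b where b: "cmod (rat_complex b - partial_y f z) < e" using rat_complex_dense[OF e] by blast
  let ?A = "(rat_complex a - \<i> * rat_complex b) / 2" and ?B = "(rat_complex a + \<i> * rat_complex b) / 2"
  have "cmod (?A - partial_z f z) = cmod ((rat_complex a - partial_x f z) - \<i> * (rat_complex b - partial_y f z)) / 2"
    unfolding norm_divide_numeral[symmetric] by (rule arg_cong[of _ _ cmod]) (simp add: partial_z_def field_simps)
  also have "\<dots> \<le> e"
    using norm_triangle_ineq4[of "rat_complex a - partial_x f z" "\<i> * (rat_complex b - partial_y f z)"] a b
    by (simp add: norm_mult)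
  finally have A: "cmod (?A - partial_z f z) \<le> e" .
  have "cmod (?B - partial_zbar f z) = cmod ((rat_complex a - partial_x f z) + \<i> * (rat_complex b - partial_y f z)) / 2"
    unfolding norm_divide_numeral[symmetric] by (rule arg_cong[of _ _ cmod]) (simp add: partial_zbar_def field_simps)
  also have "\<dots> \<le> e"
    using norm_triangle_ineq[of "rat_complex a - partial_x f z" "\<i> * (rat_complex b - partial_y f z)"] a b
    by (simp add: norm_mult)
  finally have B: "cmod (?B - partial_zbar f z) \<le> e" .
  have A1: "cmod ?A \<ge> ?F - e" using A norm_triangle_sub[of "partial_z f z" ?A] by (simp add: norm_minus_commute)
  have B1: "cmod ?B \<le> k * ?F + e" using B norm_triangle_sub[of ?B "partial_zbar f z"] le by simp
  have c1: "cmod ?B \<le> (1 + k) / 2 * cmod ?A"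
  proof -
    have "(1 + k) / 2 * (?F - e) \<le> (1 + k) / 2 * cmod ?A"
      by (rule mult_left_mono[OF A1]) (use k in auto)
    moreover have "(1 + k) / 2 * (?F - e) = (?F + k * ?F - e - k * e) / 2" by (simp add: field_simps)
    moreover have "k * ?F + e \<le> (?F + k * ?F - e - k * e) / 2" proof -
      have "x + e \<le> (F + x - e - y) / 2" if "32 * e = F - x" "y \<le> e" for x y F :: real
        using that e by (simp add: field_simps)
      then show ?thesis using eF by blast
    qed
    ultimately show ?thesis using B1 by linarith
  qed
  have c2: "?A \<noteq> 0"
  proof
    assume "?A = 0"
    then have "cmod ?A = 0" by (simp only: norm_zero)
    then show False using A1 eF e by linarith
  qed
  have c3: "2 * e \<le> (1 - k) / 8 * cmod ?A"
  proof -
    have "(1 - k) / 8 * (?F - e) \<le> (1 - k) / 8 * cmod ?A"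
      by (rule mult_left_mono[OF A1]) (use k in auto)
    moreover have "(1 - k) / 8 * (?F - e) = (32 * e - e + k * e) / 8" using eF by (simp add: field_simps)
    ultimately show ?thesis using eF(4) e by simp
  qed
  obtain \<delta> where \<delta>: "\<delta> > 0"
      "\<And>t. \<bar>t\<bar> < \<delta> \<Longrightarrow> cmod (f (z + of_real t) - f z - of_real t * partial_x f z) \<le> e * \<bar>t\<bar>"
      "\<And>t. \<bar>t\<bar> < \<delta> \<Longrightarrow> cmod (f (z + \<i> * of_real t) - f z - of_real t * partial_y f z) \<le> e * \<bar>t\<bar>"
    by (rule has_partials_at_approx[OF d e]) (rule that; assumption)
  obtain r where r: "r > 0" "ball z r \<subseteq> D" using D open_contains_ball by blast
  have "min r \<delta> > 0" using r \<delta> by simp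
  then obtain p q where pq: "z \<in> box (rat_complex p) (rat_complex q)" "box (rat_complex p) (rat_complex q) \<subseteq> ball z (min r \<delta>)"
    using rat_complex_box by blast
  have slope: "cmod (w - of_real t * a') \<le> (1 - k) / 8 * cmod ?A * \<bar>t\<bar>"
    if "cmod (w - of_real t * d') \<le> e * \<bar>t\<bar>" "cmod (a' - d') < e" for w a' d' :: complex and t :: real
  proof -
    have "w - of_real t * a' = (w - of_real t * d') - of_real t * (a' - d')" by (simp add: right_diff_distrib)
    then have "cmod (w - of_real t * a') \<le> cmod (w - of_real t * d') + cmod (of_real t * (a' - d'))"
      by (metis norm_triangle_ineq4)
    also have "cmod (of_real t * (a' - d')) \<le> \<bar>t\<bar> * e"
      unfolding norm_mult norm_of_real by (rule mult_left_mono) (use that in auto)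
    finally have "cmod (w - of_real t * a') \<le> 2 * e * \<bar>t\<bar>"
      using that(1) mult.commute[of "\<bar>t\<bar>" e] by linarith
    also have "\<dots> \<le> (1 - k) / 8 * cmod ?A * \<bar>t\<bar>" by (rule mult_right_mono[OF c3]) simp
    finally show ?thesis .
  qed
  show thesis
  proof (rule that)
    show "box (rat_complex p) (rat_complex q) \<subseteq> D"
      by (rule order_trans[OF pq(2) order_trans[OF subset_ball r(2)]]) simp
    show "z \<in> affine_piece f (rat_complex p) (rat_complex q) (rat_complex a) (rat_complex b)
       ((1 - k) / 8 * cmod ((rat_complex a - \<i> * rat_complex b) / 2))"
      unfolding affine_piece_def
    proof (intro CollectI conjI ballI)
      show "z \<in> box (rat_complex p) (rat_complex q)" by (rule pq)
    next
      fix t assume "t \<in> {Re (rat_complex p)<..<Re (rat_complex q)}"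
      then have "Complex t (Im z) \<in> box (rat_complex p) (rat_complex q)"
        using pq(1) by (auto simp: in_box_complex_iff)
      then have "Complex t (Im z) \<in> ball z (min r \<delta>)" using pq(2) by blast
      then have td: "\<bar>t - Re z\<bar> < \<delta>" by (simp add: dist_complex_def complex_diff cmod_def abs_minus_commute)
      have zt: "Complex t (Im z) = z + of_real (t - Re z)" by (simp add: complex_eq_iff)
      show "cmod (f (Complex t (Im z)) - f z - of_real (t - Re z) * rat_complex a) \<le> (1 - k) / 8 * cmod ?A * \<bar>t - Re z\<bar>"
        unfolding zt by (rule slope[OF \<delta>(2)[OF td] a])
    next
      fix t assume "t \<in> {Im (rat_complex p)<..<Im (rat_complex q)}"
      then have "Complex (Re z) t \<in> box (rat_complex p) (rat_complex q)"
        using pq(1) by (auto simp: in_box_complex_iff)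
      then have "Complex (Re z) t \<in> ball z (min r \<delta>)" using pq(2) by blast
      then have td: "\<bar>t - Im z\<bar> < \<delta>" by (simp add: dist_complex_def complex_diff cmod_def abs_minus_commute)
      have zt: "Complex (Re z) t = z + \<i> * of_real (t - Im z)" by (simp add: complex_eq_iff)
      show "cmod (f (Complex (Re z) t) - f z - of_real (t - Im z) * rat_complex b) \<le> (1 - k) / 8 * cmod ?A * \<bar>t - Im z\<bar>"
        unfolding zt by (rule slope[OF \<delta>(3)[OF td] b])
    qed
  qed (use c1 c2 in auto)
qed

text \<open>With \<open>\<alpha> = (a - \<i> * b) / 2\<close>, the partial derivatives are at most \<open>3 * cmod \<alpha>\<close> on a piece, and the inverse of \<open>f\<close>
is Lipschitz there with constant \<open>4 / ((1 - k) * cmod \<alpha>)\<close>. So the choice \<open>m = 3 * cmod \<alpha>\<close> on the piece bounds the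
integral of \<open>m\<^sup>2\<close> over any subset by a multiple of the area of the image. Different pieces, once made
disjoint, have disjoint images. At a point where the derivative vanishes, any value of \<open>m\<close> is large enough.\<close>

lemma conformal_density:
  fixes f g :: "complex \<Rightarrow> complex"
  assumes D: "open D" and cont: "continuous_on D f" and inv: "\<And>z. z \<in> D \<Longrightarrow> g (f z) = z"
    and fD: "open (f ` D)" and gcont: "continuous_on (f ` D) g" and k: "0 \<le> k" "k < 1"
  obtains m :: "complex \<Rightarrow> real" where "m \<in> borel_measurable borel" "\<And>z. 0 \<le> m z"
    "\<And>z. z \<in> D \<Longrightarrow> has_partials_at f z \<Longrightarrow> cmod (partial_zbar f z) \<le> k * cmod (partial_z f z) \<Longrightarrow>
       cmod (partial_x f z) \<le> m z \<and> cmod (partial_y f z) \<le> m z"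
    "\<And>\<phi>. \<phi> \<in> borel_measurable borel \<Longrightarrow>
       (\<integral>\<^sup>+z\<in>D. \<phi> (f z) * ennreal ((m z)\<^sup>2) \<partial>lborel) \<le> ennreal (1152 / (1 - k)\<^sup>2) * (\<integral>\<^sup>+w. \<phi> w \<partial>lborel)"
proof -
  define rc where "rc n = (from_nat n :: ((rat \<times> rat) \<times> (rat \<times> rat)) \<times> ((rat \<times> rat) \<times> (rat \<times> rat)))" for n :: nat
  define p where "p n = rat_complex (fst (fst (rc n)))" for n
  define q where "q n = rat_complex (snd (fst (rc n)))" for n
  define a where "a n = rat_complex (fst (snd (rc n)))" for n
  define b where "b n = rat_complex (snd (snd (rc n)))" for n
  define A where "A n = cmod ((a n - \<i> * b n) / 2)" for n
  define B where "B n = cmod ((a n + \<i> * b n) / 2)" for n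
  define valid where "valid n \<longleftrightarrow> box (p n) (q n) \<subseteq> D \<and> B n \<le> (1 + k) / 2 * A n \<and> A n > 0" for n
  define P where "P n = (if valid n then affine_piece f (p n) (q n) (a n) (b n) ((1 - k) / 8 * A n) else {})" for n
  define P' where "P' = disjointed P"
  define c where "c n = 3 * A n" for n
  define m where "m z = (\<Sum>n. c n * indicator (P' n) z)" for z :: complex
  define C where "C = 1152 / (1 - k)\<^sup>2"
  have A0: "A n \<ge> 0" for n by (simp add: A_def)
  have Pb: "P n \<in> sets borel" for n
  proof (cases "valid n")
    case True
    then have "continuous_on (box (p n) (q n)) f" using cont continuous_on_subset unfolding valid_def by blast
    then show ?thesis by (simp add: P_def affine_piece_borel)
  qed (simp add: P_def)
  then have P'b: "P' n \<in> sets borel" for n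
    unfolding P'_def using sets.range_disjointed_sets[of P borel] by auto
  have P'P: "P' n \<subseteq> P n" for n unfolding P'_def by (rule disjointed_subset)
  have PD: "P n \<subseteq> D" for n by (auto simp: P_def affine_piece_def valid_def)
  have disj: "disjoint_family P'" unfolding P'_def by (rule disjoint_family_disjointed)
  have uniq: "n = n'" if "z \<in> P' n" "z \<in> P' n'" for z n n'
    using disj that unfolding disjoint_family_on_def by blast
  have UP: "(\<Union>n. P' n) = (\<Union>n. P n)" unfolding P'_def by (rule UN_disjointed_eq)
  have m_eq: "m z = c n" if "z \<in> P' n" for z n
  proof -
    have "m z = (\<Sum>n'\<in>{n}. c n' * indicator (P' n') z)"
      unfolding m_def by (rule suminf_finite) (use uniq that in \<open>auto simp: indicator_def\<close>)
    then show ?thesis using that by simp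
  qed
  have m_0: "m z = 0" if "\<And>n. z \<notin> P' n" for z
    using that by (simp add: m_def)
  have m_nonneg: "0 \<le> m z" for z
  proof (cases "\<exists>n. z \<in> P' n")
    case True
    then show ?thesis using m_eq A0 by (auto simp: c_def)
  qed (use m_0 in auto)
  have m_borel: "m \<in> borel_measurable borel"
    unfolding m_def[abs_def] using P'b by measurable
  have ab: "cmod (a n) \<le> 2 * A n" "cmod (b n) \<le> 2 * A n" if v: "valid n" for n
  proof -
    have "(1 + k) / 2 * A n \<le> 1 * A n" by (rule mult_right_mono) (use k A0 in auto)
    moreover have "B n \<le> (1 + k) / 2 * A n" using v by (simp only: valid_def)
    ultimately have BA: "B n \<le> A n" by linarith
    have "a n = (a n - \<i> * b n) / 2 + (a n + \<i> * b n) / 2" by (simp add: field_simps)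
    then have "cmod (a n) \<le> A n + B n" unfolding A_def B_def by (metis norm_triangle_ineq)
    then show "cmod (a n) \<le> 2 * A n" using BA by simp
    have "\<i> * b n = (a n + \<i> * b n) / 2 - (a n - \<i> * b n) / 2" by (simp add: field_simps)
    then have "cmod (\<i> * b n) \<le> B n + A n" unfolding A_def B_def by (metis norm_triangle_ineq4)
    then show "cmod (b n) \<le> 2 * A n" using BA by (simp add: norm_mult)
  qed
  have partials: "cmod (partial_x f z) \<le> m z \<and> cmod (partial_y f z) \<le> m z"
    if z: "z \<in> D" and d: "has_partials_at f z" and le: "cmod (partial_zbar f z) \<le> k * cmod (partial_z f z)" for z
  proof (cases "partial_z f z = 0")
    case True
    then have "partial_zbar f z = 0" using le by simp
    moreover have "partial_x f z = partial_z f z + partial_zbar f z"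
      "partial_y f z = \<i> * (partial_z f z - partial_zbar f z)"
      by (simp_all add: partial_z_def partial_zbar_def field_simps)
    ultimately have "partial_x f z = 0" "partial_y f z = 0"
      using True by simp_all
    then show ?thesis using m_nonneg by simp
  next
    case False
    obtain p0 q0 a0 b0 where *: "box (rat_complex p0) (rat_complex q0) \<subseteq> D"
      "cmod ((rat_complex a0 + \<i> * rat_complex b0) / 2) \<le> (1 + k) / 2 * cmod ((rat_complex a0 - \<i> * rat_complex b0) / 2)"
      "(rat_complex a0 - \<i> * rat_complex b0) / 2 \<noteq> 0"
      "z \<in> affine_piece f (rat_complex p0) (rat_complex q0) (rat_complex a0) (rat_complex b0)
         ((1 - k) / 8 * cmod ((rat_complex a0 - \<i> * rat_complex b0) / 2))"
      by (rule exists_affine_piece[OF D z d k le False])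
    define n where "n = to_nat ((p0, q0), (a0, b0))"
    have n: "p n = rat_complex p0" "q n = rat_complex q0" "a n = rat_complex a0" "b n = rat_complex b0"
      by (simp_all add: p_def q_def a_def b_def rc_def n_def)
    have "valid n" using * unfolding valid_def A_def B_def n zero_less_norm_iff by blast
    then have "z \<in> P n" using *(4) unfolding P_def A_def n by simp
    then obtain n' where n': "z \<in> P' n'" using UP by blast
    then have zP: "z \<in> P n'" using P'P by blast
    then have v: "valid n'" by (auto simp: P_def split: if_splits)
    have zz: "z \<in> affine_piece f (p n') (q n') (a n') (b n') ((1 - k) / 8 * A n')"
      using zP v by (simp add: P_def)
    have "(1 - k) / 8 * A n' \<le> 1 * A n'" by (rule mult_right_mono) (use k A0 in auto)
    then show ?thesis
      using affine_piece_partials_le[OF zz d] ab[OF v] unfolding m_eq[OF n'] c_def by linarith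
  qed
  define F where "F z = (if z \<in> D then f z else 0)" for z
  have Fb: "F \<in> borel_measurable borel" unfolding F_def[abs_def]
    by (rule borel_measurable_continuous_on_if) (use D cont in auto)
  define G where "G w = (if w \<in> f ` D then g w else 0)" for w
  have Gb: "G \<in> borel_measurable borel" unfolding G_def[abs_def]
    by (rule borel_measurable_continuous_on_if) (use fD gcont in auto)
  have pre: "S \<inter> F -` T \<in> sets borel" if "S \<in> sets borel" "T \<in> sets borel" for S T
    using measurable_sets[OF Fb that(2)] that(1) by auto
  have img: "f ` S \<in> sets borel" if "S \<in> sets borel" "S \<subseteq> D" for S
  proof -
    have "f ` S = f ` D \<inter> G -` S" using that(2) inv by (fastforce simp: G_def)
    then show ?thesis using measurable_sets[OF Gb that(1)] fD by auto
  qed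
  have piece: "ennreal ((c n)\<^sup>2) * emeasure lborel S \<le> ennreal C * emeasure lborel (f ` S)"
    if S: "S \<in> sets borel" "S \<subseteq> P' n" for S n
  proof (cases "valid n")
    case True
    then have An: "A n > 0" by (simp add: valid_def)
    define M where "M = 4 / ((1 - k) * A n)"
    have M: "M > 0" using An k by (simp add: M_def)
    have SD: "S \<subseteq> D" using S(2) P'P PD by blast
    have low: "dist (g x) (g y) \<le> M * dist x y" if "x \<in> f ` S" "y \<in> f ` S" for x y
    proof -
      obtain w z where wz: "w \<in> S" "z \<in> S" "x = f w" "y = f z" using \<open>x \<in> f ` S\<close> \<open>y \<in> f ` S\<close> by blast
      have "w \<in> P n" "z \<in> P n" using wz S(2) P'P by blast+
      then have "(A n - B n - 2 * ((1 - k) / 8 * A n)) * cmod (w - z) \<le> cmod (f w - f z)"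
        using affine_piece_lower_bound[of z f "p n" "q n" "a n" "b n" "(1 - k) / 8 * A n" w] True
        unfolding A_def B_def P_def by simp
      moreover have "(1 - k) / 4 * A n \<le> A n - B n - 2 * ((1 - k) / 8 * A n)"
        using True by (simp add: valid_def field_simps)
      ultimately have "(1 - k) / 4 * A n * cmod (w - z) \<le> cmod (f w - f z)"
        by (meson mult_right_mono norm_ge_zero order_trans)
      then have "cmod (w - z) \<le> M * cmod (f w - f z)"
        using An k by (simp add: M_def field_simps)
      then show ?thesis using wz inv SD by (simp add: dist_norm subset_iff)
    qed
    have gf: "g ` (f ` S \<inter> U) = S \<inter> F -` U" for U
      using SD inv by (force simp: F_def)
    have "emeasure lborel (g ` (f ` S)) \<le> ennreal (8 * M\<^sup>2) * emeasure lborel (f ` S)"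
      by (rule emeasure_Lipschitz_image) (use img[OF S(1) SD] low M gf pre[OF S(1)] in auto)
    moreover have "g ` (f ` S) = S" using gf[of UNIV] by simp
    ultimately have "ennreal ((c n)\<^sup>2) * emeasure lborel S \<le> ennreal ((c n)\<^sup>2) * (ennreal (8 * M\<^sup>2) * emeasure lborel (f ` S))"
      by (intro mult_left_mono) auto
    also have "\<dots> = ennreal ((c n)\<^sup>2 * (8 * M\<^sup>2)) * emeasure lborel (f ` S)"
      by (subst ennreal_mult) (auto simp: mult.assoc)
    also have "(c n)\<^sup>2 * (8 * M\<^sup>2) = C"
      using An k by (simp add: C_def M_def c_def power_mult_distrib power_divide)
    finally show ?thesis .
  next
    case False
    then have "S = {}" using S(2) P'P[of n] by (simp add: P_def)
    then show ?thesis by simp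
  qed
  \<comment> \<open>The image of the measure with density \<open>m\<^sup>2\<close> is dominated by a multiple of the area.\<close>
  define N1 where "N1 = distr (density lborel (\<lambda>z. ennreal ((m z)\<^sup>2) * indicator D z)) borel F"
  define N2 where "N2 = density lborel (\<lambda>_::complex. ennreal C)"
  have Db: "D \<in> sets borel" using D by auto
  have dens: "(\<lambda>z. ennreal ((m z)\<^sup>2) * indicator D z) \<in> borel_measurable lborel"
    using m_borel Db by measurable
  have "emeasure N1 T \<le> emeasure N2 T" if T: "T \<in> sets borel" for T
  proof -
    define S where "S n = P' n \<inter> F -` T" for n
    have Sb: "S n \<in> sets borel" for n unfolding S_def by (rule pre[OF P'b T])
    have SP: "S n \<subseteq> P' n" for n by (auto simp: S_def)
    have SD: "S n \<subseteq> D" for n using SP P'P PD by blast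
    have vT: "F -` T \<in> sets borel" using measurable_sets[OF Fb T] by simp
    have "emeasure N1 T = (\<integral>\<^sup>+z. ennreal ((m z)\<^sup>2) * indicator D z * indicator (F -` T) z \<partial>lborel)"
      unfolding N1_def using T Fb vT dens by (simp add: emeasure_distr emeasure_density)
    also have "\<dots> = (\<integral>\<^sup>+z. (\<Sum>n. ennreal ((c n)\<^sup>2) * indicator (S n) z) \<partial>lborel)"
    proof (rule nn_integral_cong)
      fix z
      show "ennreal ((m z)\<^sup>2) * indicator D z * indicator (F -` T) z = (\<Sum>n. ennreal ((c n)\<^sup>2) * indicator (S n) z)"
      proof (cases "\<exists>n. z \<in> P' n")
        case True
        then obtain n where n: "z \<in> P' n" by blast
        have "(\<Sum>n. ennreal ((c n)\<^sup>2) * indicator (S n) z) = (\<Sum>n\<in>{n}. ennreal ((c n)\<^sup>2) * indicator (S n) z)"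
          by (rule suminf_finite) (use uniq n in \<open>auto simp: indicator_def S_def\<close>)
        then show ?thesis using n P'P PD by (auto simp: m_eq[OF n] S_def indicator_def)
      next
        case False
        then have "m z = 0" using m_0 by blast
        moreover have "z \<notin> S n" for n using False by (auto simp: S_def)
        ultimately show ?thesis by simp
      qed
    qed
    also have "\<dots> = (\<Sum>n. ennreal ((c n)\<^sup>2) * emeasure lborel (S n))"
      using Sb by (subst nn_integral_suminf) (auto simp: nn_integral_cmult_indicator)
    also have "\<dots> \<le> (\<Sum>n. ennreal C * emeasure lborel (f ` S n))"
      by (intro suminf_le piece[OF Sb SP]) auto
    also have "\<dots> = ennreal C * (\<Sum>n. emeasure lborel (f ` S n))"
      by (rule ennreal_suminf_cmult)
    also have "(\<Sum>n. emeasure lborel (f ` S n)) = emeasure lborel (\<Union>n. f ` S n)"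
    proof (rule suminf_emeasure)
      have "f ` S n \<inter> f ` S n' = {}" if "n \<noteq> n'" for n n'
      proof -
        have "S n \<inter> S n' = {}" using that uniq SP by blast
        moreover have "z = z'" if "z \<in> S n" "z' \<in> S n'" "f z = f z'" for z z'
          using that SD inv by (metis subsetD)
        ultimately show ?thesis by blast
      qed
      then show "disjoint_family (\<lambda>n. f ` S n)" by (auto simp: disjoint_family_on_def)
    qed (use img[OF Sb SD] in auto)
    also have "\<dots> \<le> emeasure lborel T"
    proof (rule emeasure_mono)
      have "f z \<in> T" if "z \<in> S n" for z n
        using that SD[of n] by (auto simp: S_def F_def split: if_splits)
      then show "(\<Union>n. f ` S n) \<subseteq> T" by blast
    qed (use T in auto)
    finally show ?thesis using T by (simp add: N2_def emeasure_density_const mult_left_mono)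
  qed
  then have N12: "N1 \<le> N2" by (subst le_measure) (auto simp: N1_def N2_def)
  show thesis
  proof (rule that[OF m_borel m_nonneg partials])
    fix \<phi> :: "complex \<Rightarrow> ennreal" assume \<phi>: "\<phi> \<in> borel_measurable borel"
    have "(\<integral>\<^sup>+z\<in>D. \<phi> (f z) * ennreal ((m z)\<^sup>2) \<partial>lborel) =
        (\<integral>\<^sup>+z. (ennreal ((m z)\<^sup>2) * indicator D z) * \<phi> (F z) \<partial>lborel)"
      by (rule nn_integral_cong) (auto simp: F_def indicator_def mult.commute)
    also have "\<dots> = (\<integral>\<^sup>+w. \<phi> w \<partial>N1)"
      unfolding N1_def using \<phi> Fb dens
      by (subst nn_integral_distr) (auto simp: nn_integral_density)
    also have "\<dots> \<le> (\<integral>\<^sup>+w. \<phi> w \<partial>N2)"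
      by (rule nn_integral_mono_measure[OF _ N12]) (auto simp: N1_def N2_def)
    also have "\<dots> = ennreal C * (\<integral>\<^sup>+w. \<phi> w \<partial>lborel)"
      unfolding N2_def using \<phi> by (simp add: nn_integral_density nn_integral_cmult)
    finally show "(\<integral>\<^sup>+z\<in>D. \<phi> (f z) * ennreal ((m z)\<^sup>2) \<partial>lborel) \<le> ennreal (1152 / (1 - k)\<^sup>2) * (\<integral>\<^sup>+w. \<phi> w \<partial>lborel)"
      by (simp add: C_def)
  qed
qed

section \<open>Oscillation along square frames\<close>

lemma Complex_borel_measurable [measurable]:
  "(\<lambda>z. Complex (fst z) (snd z)) \<in> borel_measurable borel"
  "(\<lambda>z. Complex (snd z) (fst z)) \<in> borel_measurable borel"
  unfolding Complex_eq
  by (intro borel_measurable_continuous_onI continuous_intros)+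

lemma distr_lborel_Complex:
  "distr lborel borel (\<lambda>z. Complex (fst z) (snd z)) = lborel"
  "distr lborel borel (\<lambda>z. Complex (snd z) (fst z)) = lborel"
proof -
  have "emeasure (distr lborel borel (\<lambda>z. Complex (fst z) (snd z))) (box l u) = (\<Prod>b\<in>Basis. (u - l) \<bullet> b)"
     "emeasure (distr lborel borel (\<lambda>z. Complex (snd z) (fst z))) (box l u) = (\<Prod>b\<in>Basis. (u - l) \<bullet> b)"
    if *: "\<And>b. b \<in> Basis \<Longrightarrow> l \<bullet> b \<le> u \<bullet> b" for l u :: complex
  proof -
    have le: "Re l \<le> Re u" "Im l \<le> Im u" using *[of 1] *[of \<i>] by (auto simp: Basis_complex_def)
    have p: "(\<Prod>b\<in>Basis. (u - l) \<bullet> b) = (Re u - Re l) * (Im u - Im l)"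
      by (simp add: Basis_complex_def)
    have 1: "(\<lambda>z. Complex (fst z) (snd z)) -` box l u = {Re l<..<Re u} \<times> {Im l<..<Im u}"
      by (auto simp: in_box_complex_iff)
    have 2: "(\<lambda>z. Complex (snd z) (fst z)) -` box l u = {Im l<..<Im u} \<times> {Re l<..<Re u}"
      by (auto simp: in_box_complex_iff)
    have 3: "emeasure lborel ({a<..<b} \<times> {c<..<d}) = ennreal ((b - a) * (d - c))"
      if "a \<le> b" "c \<le> d" for a b c d :: real
      unfolding lborel_prod[symmetric] using that
      by (subst lborel.emeasure_pair_measure_Times) (auto simp: ennreal_mult)
    show "emeasure (distr lborel borel (\<lambda>z. Complex (fst z) (snd z))) (box l u) = (\<Prod>b\<in>Basis. (u - l) \<bullet> b)"
      unfolding p using 3 le by (subst emeasure_distr) (auto simp: 1)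
    show "emeasure (distr lborel borel (\<lambda>z. Complex (snd z) (fst z))) (box l u) = (\<Prod>b\<in>Basis. (u - l) \<bullet> b)"
      unfolding p using 3 le by (subst emeasure_distr) (auto simp: 2 mult.commute)
  qed
  then show "distr lborel borel (\<lambda>z. Complex (fst z) (snd z)) = lborel"
    "distr lborel borel (\<lambda>z. Complex (snd z) (fst z)) = lborel"
    by (auto intro!: lborel_eqI[symmetric])
qed

lemma nn_integral_Complex:
  assumes f: "f \<in> borel_measurable borel"
  shows "(\<integral>\<^sup>+z. f z \<partial>lborel) = (\<integral>\<^sup>+x. \<integral>\<^sup>+y. f (Complex x y) \<partial>lborel \<partial>lborel)"
    "(\<integral>\<^sup>+z. f z \<partial>lborel) = (\<integral>\<^sup>+y. \<integral>\<^sup>+x. f (Complex x y) \<partial>lborel \<partial>lborel)"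
proof -
  have m: "(\<lambda>z. f (Complex (fst z) (snd z))) \<in> borel_measurable borel" "(\<lambda>z. f (Complex (snd z) (fst z))) \<in> borel_measurable borel"
    using f by measurable
  have "(\<integral>\<^sup>+z. f z \<partial>lborel) = (\<integral>\<^sup>+z. f (Complex (fst z) (snd z)) \<partial>lborel)"
    by (subst distr_lborel_Complex(1)[symmetric], subst nn_integral_distr) (use f in auto)
  also have "\<dots> = (\<integral>\<^sup>+x. \<integral>\<^sup>+y. f (Complex x y) \<partial>lborel \<partial>lborel)"
    unfolding lborel_prod[symmetric] using m by (subst lborel.nn_integral_fst[symmetric]) (auto simp: lborel_prod)
  finally show "(\<integral>\<^sup>+z. f z \<partial>lborel) = (\<integral>\<^sup>+x. \<integral>\<^sup>+y. f (Complex x y) \<partial>lborel \<partial>lborel)" .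
  have "(\<integral>\<^sup>+z. f z \<partial>lborel) = (\<integral>\<^sup>+z. f (Complex (snd z) (fst z)) \<partial>lborel)"
    by (subst distr_lborel_Complex(2)[symmetric], subst nn_integral_distr) (use f in auto)
  also have "\<dots> = (\<integral>\<^sup>+x. \<integral>\<^sup>+y. f (Complex y x) \<partial>lborel \<partial>lborel)"
    unfolding lborel_prod[symmetric] using m by (subst lborel.nn_integral_fst[symmetric]) (auto simp: lborel_prod)
  finally show "(\<integral>\<^sup>+z. f z \<partial>lborel) = (\<integral>\<^sup>+y. \<integral>\<^sup>+x. f (Complex x y) \<partial>lborel \<partial>lborel)" .
qed

lemma AE_Complex:
  assumes "AE z in lborel. P z"
  shows "AE x in lborel. AE y in lborel. P (Complex x y)"
    "AE y in lborel. AE x in lborel. P (Complex x y)"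
proof -
  have "AE z in lborel \<Otimes>\<^sub>M lborel. P (Complex (fst z) (snd z))"
    unfolding lborel_prod
  proof (rule AE_distrD[where P = P and f = "\<lambda>z. Complex (fst z) (snd z)"])
    show "(\<lambda>z. Complex (fst z) (snd z)) \<in> lborel \<rightarrow>\<^sub>M borel" by simp
    show "AE z in distr lborel borel (\<lambda>z. Complex (fst z) (snd z)). P z"
      unfolding distr_lborel_Complex by (rule assms)
  qed
  moreover have "AE z in lborel \<Otimes>\<^sub>M lborel. P (Complex (snd z) (fst z))"
    unfolding lborel_prod
  proof (rule AE_distrD[where P = P and f = "\<lambda>z. Complex (snd z) (fst z)"])
    show "(\<lambda>z. Complex (snd z) (fst z)) \<in> lborel \<rightarrow>\<^sub>M borel" by simp
    show "AE z in distr lborel borel (\<lambda>z. Complex (snd z) (fst z)). P z"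
      unfolding distr_lborel_Complex by (rule assms)
  qed
  ultimately show "AE x in lborel. AE y in lborel. P (Complex x y)" "AE y in lborel. AE x in lborel. P (Complex x y)"
    by (fastforce dest: lborel_pair.AE_pair)+
qed

text \<open>The balls of this norm are squares with sides parallel to the axes, so the sides of their frames are lines on which absolute
continuity is available.\<close>

definition square_norm :: "complex \<Rightarrow> real" where
  "square_norm z = max \<bar>Re z\<bar> \<bar>Im z\<bar>"

lemma AE_shift_reflect:
  assumes "AE x in lborel. P (x :: real)"
  shows "AE s in lborel. P (c + s) \<and> P (c - s)"
proof -
  obtain N where N: "N \<in> null_sets lborel" "{x. \<not> P x} \<subseteq> N"
    using assms by (rule AE_E3) (use that in auto)
  have nN: "AE x in lborel. x \<notin> N" using N(1) by (rule AE_not_in)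
  have p: "Measurable.pred borel (\<lambda>x. x \<notin> N)" using null_setsD2[OF N(1)] by simp
  have "AE s in lborel. c + 1 * s \<notin> N" by (rule AE_borel_affine[OF _ p nN]) simp
  moreover have "AE s in lborel. c + (-1) * s \<notin> N" by (rule AE_borel_affine[OF _ p nN]) simp
  ultimately show ?thesis by eventually_elim (use N(2) in auto)
qed

lemma nn_integral_shift_reflect_le:
  fixes W :: "real \<Rightarrow> ennreal"
  assumes W: "W \<in> borel_measurable borel" and s: "0 \<le> s1"
  shows "(\<integral>\<^sup>+s\<in>{s1..s2}. W (c + s) + W (c - s) \<partial>lborel) \<le> 2 * (\<integral>\<^sup>+x\<in>{c - s2..c + s2}. W x \<partial>lborel)"
proof -
  let ?g = "\<lambda>x. W x * indicator {c - s2..c + s2} x"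
  have g: "?g \<in> borel_measurable borel" using W by measurable
  have "(\<integral>\<^sup>+s\<in>{s1..s2}. W (c + s) + W (c - s) \<partial>lborel) \<le> (\<integral>\<^sup>+s. ?g (c + 1 * s) + ?g (c + (-1) * s) \<partial>lborel)"
    by (rule nn_integral_mono) (use s in \<open>auto simp: indicator_def\<close>)
  also have "\<dots> = (\<integral>\<^sup>+s. ?g (c + 1 * s) \<partial>lborel) + (\<integral>\<^sup>+s. ?g (c + (-1) * s) \<partial>lborel)"
    by (rule nn_integral_add) (use W in measurable)
  also have "\<dots> = 2 * (\<integral>\<^sup>+x. ?g x \<partial>lborel)"
    using nn_integral_real_affine[OF g, of 1 c] nn_integral_real_affine[OF g, of "-1" c] by (simp add: mult_2)
  finally show ?thesis .
qed

text \<open>A point of a frame can be joined to the lower left corner along sides of the frame. For almost every radius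
the increment of \<open>G\<close> along a side is at most the integral of \<open>\<mu>\<close> over the chord of the big square that contains
the side. Integrating over the radius, Fubini's theorem bounds the contribution of each of the four
sides by the integral over the big square; the two endpoints double this.\<close>

lemma frame_oscillation:
  fixes G :: "complex \<Rightarrow> real" and \<mu> :: "complex \<Rightarrow> ennreal"
  assumes \<mu>: "\<mu> \<in> borel_measurable borel" and s: "0 < s1" "s1 \<le> s2" and L: "0 \<le> L"
    and vert: "AE x in lborel. \<forall>y1 y2. y1 \<le> y2 \<longrightarrow>
       ennreal \<bar>G (Complex x y2) - G (Complex x y1)\<bar> \<le> (\<integral>\<^sup>+y\<in>{y1..y2}. \<mu> (Complex x y) \<partial>lborel)"
    and horiz: "AE y in lborel. \<forall>x1 x2. x1 \<le> x2 \<longrightarrow>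
       ennreal \<bar>G (Complex x2 y) - G (Complex x1 y)\<bar> \<le> (\<integral>\<^sup>+x\<in>{x1..x2}. \<mu> (Complex x y) \<partial>lborel)"
    and osc: "\<And>s. s1 < s \<Longrightarrow> s < s2 \<Longrightarrow> \<exists>z w. square_norm (z - c) = s \<and> square_norm (w - c) = s \<and> L \<le> \<bar>G z - G w\<bar>"
  shows "ennreal ((s2 - s1) * L) \<le> 8 * (\<integral>\<^sup>+z. \<mu> z * indicator {z. square_norm (z - c) \<le> s2} z \<partial>lborel)"
proof -
  let ?Q = "{z. square_norm (z - c) \<le> s2}"
  have Q: "?Q \<in> sets borel"
    unfolding square_norm_def by (intro borel_closed closed_Collect_le continuous_intros)
  have \<mu>Q: "(\<lambda>z. \<mu> z * indicator ?Q z) \<in> borel_measurable borel" using \<mu> Q by measurable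
  define V where "V x = (\<integral>\<^sup>+y. \<mu> (Complex x y) * indicator ?Q (Complex x y) \<partial>lborel)" for x
  define H where "H y = (\<integral>\<^sup>+x. \<mu> (Complex x y) * indicator ?Q (Complex x y) \<partial>lborel)" for y
  have mc: "(\<lambda>z. \<mu> (Complex (fst z) (snd z)) * indicator ?Q (Complex (fst z) (snd z))) \<in> borel_measurable borel"
    "(\<lambda>z. \<mu> (Complex (snd z) (fst z)) * indicator ?Q (Complex (snd z) (fst z))) \<in> borel_measurable borel"
    using measurable_compose[OF Complex_borel_measurable(1) \<mu>Q] measurable_compose[OF Complex_borel_measurable(2) \<mu>Q] by auto
  have VH: "V \<in> borel_measurable borel" "H \<in> borel_measurable borel"
    unfolding V_def[abs_def] H_def[abs_def]
    using lborel.borel_measurable_nn_integral_fst[of _ lborel, unfolded lborel_prod, simplified, OF mc(1)]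
      lborel.borel_measurable_nn_integral_fst[of _ lborel, unfolded lborel_prod, simplified, OF mc(2)] by auto
  let ?I = "\<integral>\<^sup>+z. \<mu> z * indicator ?Q z \<partial>lborel"
  have I: "?I = (\<integral>\<^sup>+x. V x \<partial>lborel)" "?I = (\<integral>\<^sup>+y. H y \<partial>lborel)"
    unfolding V_def H_def using nn_integral_Complex[OF \<mu>Q] by auto
  define T where "T s = (V (Re c + s) + V (Re c - s)) + (H (Im c + s) + H (Im c - s))" for s
  have side: "ennreal L \<le> 2 * T s"
    if s': "s1 < s" "s < s2"
     and v: "\<forall>x\<in>{Re c + s, Re c - s}. \<forall>y1 y2. y1 \<le> y2 \<longrightarrow>
       ennreal \<bar>G (Complex x y2) - G (Complex x y1)\<bar> \<le> (\<integral>\<^sup>+y\<in>{y1..y2}. \<mu> (Complex x y) \<partial>lborel)"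
     and h: "\<forall>y\<in>{Im c + s, Im c - s}. \<forall>x1 x2. x1 \<le> x2 \<longrightarrow>
       ennreal \<bar>G (Complex x2 y) - G (Complex x1 y)\<bar> \<le> (\<integral>\<^sup>+x\<in>{x1..x2}. \<mu> (Complex x y) \<partial>lborel)" for s
  proof -
    have v1: "ennreal \<bar>G (Complex x y2) - G (Complex x y1)\<bar> \<le> V x"
      if x: "x \<in> {Re c + s, Re c - s}" and y: "y1 \<in> {Im c - s..Im c + s}" "y2 \<in> {Im c - s..Im c + s}" "y1 \<le> y2" for x y1 y2
    proof -
      have "ennreal \<bar>G (Complex x y2) - G (Complex x y1)\<bar> \<le> (\<integral>\<^sup>+y\<in>{y1..y2}. \<mu> (Complex x y) \<partial>lborel)"
        using v x y(3) by blast
      also have "\<dots> \<le> V x" unfolding V_def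
        by (rule nn_integral_mono) (use x y s' s in \<open>auto simp: indicator_def square_norm_def\<close>)
      finally show ?thesis .
    qed
    have h1: "ennreal \<bar>G (Complex x2 y) - G (Complex x1 y)\<bar> \<le> H y"
      if y: "y \<in> {Im c + s, Im c - s}" and x: "x1 \<in> {Re c - s..Re c + s}" "x2 \<in> {Re c - s..Re c + s}" "x1 \<le> x2" for y x1 x2
    proof -
      have "ennreal \<bar>G (Complex x2 y) - G (Complex x1 y)\<bar> \<le> (\<integral>\<^sup>+x\<in>{x1..x2}. \<mu> (Complex x y) \<partial>lborel)"
        using h y x(3) by blast
      also have "\<dots> \<le> H y" unfolding H_def
        by (rule nn_integral_mono) (use x y s' s in \<open>auto simp: indicator_def square_norm_def\<close>)
      finally show ?thesis .
    qed
    have "s > 0" using s s' by simp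
    let ?a = "Re c - s" and ?b = "Re c + s" and ?d = "Im c - s" and ?e = "Im c + s"
    have corner: "ennreal \<bar>G z - G (Complex ?a ?d)\<bar> \<le> T s" if z: "square_norm (z - c) = s" for z
    proof -
      have r: "Re z \<in> {?a..?b}" "Im z \<in> {?d..?e}" and or: "Re z = ?a \<or> Re z = ?b \<or> Im z = ?d \<or> Im z = ?e"
        using z by (auto simp: square_norm_def max_def abs_if split: if_splits)
      have zz: "z = Complex (Re z) (Im z)" by simp
      from or consider "Re z = ?a" | "Re z = ?b" | "Im z = ?d" | "Im z = ?e" by blast
      then show ?thesis
      proof cases
        case 1
        have "ennreal \<bar>G (Complex ?a (Im z)) - G (Complex ?a ?d)\<bar> \<le> V ?a"
          by (rule v1) (use r \<open>s > 0\<close> in auto)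
        also have "\<dots> \<le> T s" by (simp add: T_def add_increasing add_increasing2)
        finally show ?thesis using 1 zz by metis
      next
        case 2
        have a1: "ennreal \<bar>G (Complex ?b (Im z)) - G (Complex ?b ?d)\<bar> \<le> V ?b"
          by (rule v1) (use r \<open>s > 0\<close> in auto)
        have a2: "ennreal \<bar>G (Complex ?b ?d) - G (Complex ?a ?d)\<bar> \<le> H ?d"
          by (rule h1) (use r \<open>s > 0\<close> in auto)
        have "ennreal \<bar>G z - G (Complex ?a ?d)\<bar> \<le> ennreal (\<bar>G (Complex ?b (Im z)) - G (Complex ?b ?d)\<bar> + \<bar>G (Complex ?b ?d) - G (Complex ?a ?d)\<bar>)"
          using 2 zz by (intro ennreal_leI) (metis abs_triangle_ineq add_diff_eq diff_add_cancel)
        also have "\<dots> \<le> V ?b + H ?d" using a1 a2 by (simp add: add_mono)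
        also have "\<dots> \<le> T s" by (simp add: T_def add_mono add_increasing add_increasing2)
        finally show ?thesis .
      next
        case 3
        have "ennreal \<bar>G (Complex (Re z) ?d) - G (Complex ?a ?d)\<bar> \<le> H ?d"
          by (rule h1) (use r \<open>s > 0\<close> in auto)
        also have "\<dots> \<le> T s" by (simp add: T_def add_increasing add_increasing2)
        finally show ?thesis using 3 zz by metis
      next
        case 4
        have a1: "ennreal \<bar>G (Complex (Re z) ?e) - G (Complex ?a ?e)\<bar> \<le> H ?e"
          by (rule h1) (use r \<open>s > 0\<close> in auto)
        have a2: "ennreal \<bar>G (Complex ?a ?e) - G (Complex ?a ?d)\<bar> \<le> V ?a"
          by (rule v1) (use r \<open>s > 0\<close> in auto)
        have "ennreal \<bar>G z - G (Complex ?a ?d)\<bar> \<le> ennreal (\<bar>G (Complex (Re z) ?e) - G (Complex ?a ?e)\<bar> + \<bar>G (Complex ?a ?e) - G (Complex ?a ?d)\<bar>)"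
          using 4 zz by (intro ennreal_leI) (metis abs_triangle_ineq add_diff_eq diff_add_cancel)
        also have "\<dots> \<le> H ?e + V ?a" using a1 a2 by (simp add: add_mono)
        also have "\<dots> = V ?a + H ?e" by (rule add.commute)
        also have "\<dots> \<le> T s" by (simp add: T_def add_mono add_increasing add_increasing2)
        finally show ?thesis .
      qed
    qed
    obtain z w where zw: "square_norm (z - c) = s" "square_norm (w - c) = s" "L \<le> \<bar>G z - G w\<bar>"
      using osc s' by blast
    have "ennreal L \<le> ennreal (\<bar>G z - G (Complex ?a ?d)\<bar> + \<bar>G w - G (Complex ?a ?d)\<bar>)"
      by (rule ennreal_leI) (use zw(3) in linarith)
    also have "\<dots> \<le> T s + T s" using corner[OF zw(1)] corner[OF zw(2)] by (simp add: add_mono)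
    finally show ?thesis by (simp add: mult_2)
  qed
  have "AE s in lborel. s1 < s \<longrightarrow> s < s2 \<longrightarrow> ennreal L \<le> 2 * T s"
    using AE_shift_reflect[OF vert, of "Re c"] AE_shift_reflect[OF horiz, of "Im c"]
    by eventually_elim (intro impI side, auto)
  moreover have "AE s in lborel. s \<noteq> s1 \<and> s \<noteq> s2"
    using AE_lborel_singleton[of s1] AE_lborel_singleton[of s2] by eventually_elim auto
  ultimately have ae: "AE s in lborel. ennreal L * indicator {s1..s2} s \<le> 2 * T s * indicator {s1..s2} s"
    by eventually_elim (auto simp: indicator_def)
  have "ennreal ((s2 - s1) * L) = (\<integral>\<^sup>+s. ennreal L * indicator {s1..s2} s \<partial>lborel)"
    using s L by (simp add: nn_integral_cmult_indicator ennreal_mult mult.commute)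
  also have "\<dots> \<le> (\<integral>\<^sup>+s. 2 * T s * indicator {s1..s2} s \<partial>lborel)"
    by (rule nn_integral_mono_AE[OF ae])
  also have "\<dots> = 2 * (\<integral>\<^sup>+s. (V (Re c + s) + V (Re c - s)) * indicator {s1..s2} s + (H (Im c + s) + H (Im c - s)) * indicator {s1..s2} s \<partial>lborel)"
    using VH by (subst nn_integral_cmult[symmetric]) (auto simp: T_def algebra_simps)
  also have "(\<integral>\<^sup>+s. (V (Re c + s) + V (Re c - s)) * indicator {s1..s2} s + (H (Im c + s) + H (Im c - s)) * indicator {s1..s2} s \<partial>lborel)
     = (\<integral>\<^sup>+s\<in>{s1..s2}. V (Re c + s) + V (Re c - s) \<partial>lborel) + (\<integral>\<^sup>+s\<in>{s1..s2}. H (Im c + s) + H (Im c - s) \<partial>lborel)"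
    by (rule nn_integral_add) (use VH in measurable)
  also have "\<dots> \<le> 2 * (\<integral>\<^sup>+x\<in>{Re c - s2..Re c + s2}. V x \<partial>lborel) + 2 * (\<integral>\<^sup>+x\<in>{Im c - s2..Im c + s2}. H x \<partial>lborel)"
    by (intro add_mono nn_integral_shift_reflect_le VH) (use s in auto)
  also have "\<dots> \<le> 2 * (\<integral>\<^sup>+x. V x \<partial>lborel) + 2 * (\<integral>\<^sup>+y. H y \<partial>lborel)"
    by (intro add_mono mult_left_mono nn_integral_mono) (auto simp: indicator_def)
  also have "\<dots> = 2 * ?I + 2 * ?I" unfolding I[symmetric] ..
  also have "\<dots> = 4 * ?I" by (simp add: distrib_right[symmetric])
  finally have "ennreal ((s2 - s1) * L) \<le> 2 * (4 * ?I)" by (simp add: mult_left_mono)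
  then show ?thesis by (simp add: mult.assoc[symmetric])
qed

section \<open>The logarithmic density\<close>

text \<open>The logarithm of the distance to \<open>p\<close>, modified to be Lipschitz near \<open>p\<close> and constant at distance \<open>R\<close> and beyond. The
function \<open>log_density\<close> below is an upper gradient of it, with room to spare.\<close>

definition log_radius :: "complex \<Rightarrow> real \<Rightarrow> real \<Rightarrow> complex \<Rightarrow> real" where
  "log_radius p r R w = ln (r + min (cmod (w - p)) R)"

definition log_density :: "complex \<Rightarrow> real \<Rightarrow> real \<Rightarrow> complex \<Rightarrow> real" where
  "log_density p r R w = (if cmod (w - p) \<le> 2 * R then 2 / (r + cmod (w - p)) else 0)"

lemma ln_diff_le:
  fixes x y :: real
  assumes "0 < c" "c \<le> x" "c \<le> y"
  shows "\<bar>ln x - ln y\<bar> \<le> \<bar>x - y\<bar> / c"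
proof -
  have *: "ln x - ln y \<le> (x - y) / c" if "c \<le> y" "y \<le> x" for x y :: real
  proof -
    have "ln x - ln y \<le> (x - y) / y"
      using ln_diff_le[of x y] that assms(1) by (simp add: ln_diff_le)
    also have "\<dots> \<le> (x - y) / c" using that assms(1) by (intro divide_left_mono) auto
    finally show ?thesis .
  qed
  have mono: "ln a \<le> ln b" if "c \<le> a" "a \<le> b" for a b using that assms(1) by simp
  show ?thesis
    using *[of x y] *[of y x] mono[of x y] mono[of y x] assms by (cases "x \<le> y") (auto simp: abs_if field_simps)
qed

lemma log_radius_Lipschitz:
  assumes "0 < r" "0 \<le> R"
  shows "\<bar>log_radius p r R w - log_radius p r R w'\<bar> \<le> cmod (w - w') / r"
proof -
  have "\<bar>log_radius p r R w - log_radius p r R w'\<bar> \<le> \<bar>(r + min (cmod (w - p)) R) - (r + min (cmod (w' - p)) R)\<bar> / r"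
    unfolding log_radius_def by (rule ln_diff_le) (use assms in auto)
  also have "\<dots> \<le> cmod (w - w') / r"
    using norm_triangle_ineq3[of "w - p" "w' - p"] assms by (intro divide_right_mono) auto
  finally show ?thesis .
qed

lemma log_radius_local:
  assumes r: "0 < r" "r \<le> R" and c: "cmod (w - w0) \<le> r / 2" "cmod (w' - w0) \<le> r / 2"
  shows "\<bar>log_radius p r R w - log_radius p r R w'\<bar> \<le> log_density p r R w0 * cmod (w - w')"
proof (cases "cmod (w0 - p) \<le> 2 * R")
  case True
  have near: "cmod (u - p) \<ge> cmod (w0 - p) - r / 2" if "cmod (u - w0) \<le> r / 2" for u
    using norm_triangle_ineq2[of "w0 - p" "w0 - u"] that by (simp add: norm_minus_commute)
  have R': "(r + cmod (w0 - p)) / 2 - r \<le> R"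
    using True r by (simp add: field_simps)
  have half: "(r + cmod (w0 - p)) / 2 - r \<le> x" if x: "x \<ge> cmod (w0 - p) - r / 2" for x
  proof -
    have "cmod (w0 - p) \<ge> 0" by simp
    then show ?thesis using x r by argo
  qed
  have "\<bar>log_radius p r R w - log_radius p r R w'\<bar> \<le>
      \<bar>(r + min (cmod (w - p)) R) - (r + min (cmod (w' - p)) R)\<bar> / ((r + cmod (w0 - p)) / 2)"
    unfolding log_radius_def
  proof (rule ln_diff_le)
    show "0 < (r + cmod (w0 - p)) / 2" using r by (simp add: add_pos_nonneg)
    have "(r + cmod (w0 - p)) / 2 - r \<le> min (cmod (w - p)) R"
      by (rule min.boundedI[OF half[OF near[OF c(1)]] R'])
    then show "(r + cmod (w0 - p)) / 2 \<le> r + min (cmod (w - p)) R" by linarith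
    have "(r + cmod (w0 - p)) / 2 - r \<le> min (cmod (w' - p)) R"
      by (rule min.boundedI[OF half[OF near[OF c(2)]] R'])
    then show "(r + cmod (w0 - p)) / 2 \<le> r + min (cmod (w' - p)) R" by linarith
  qed
  also have "\<dots> \<le> cmod (w - w') / ((r + cmod (w0 - p)) / 2)"
    using norm_triangle_ineq3[of "w - p" "w' - p"] r by (intro divide_right_mono) auto
  finally show ?thesis using True by (simp add: log_density_def mult.commute)
next
  case False
  have far: "cmod (u - p) \<ge> R" if "cmod (u - w0) \<le> r / 2" for u
    using norm_triangle_ineq2[of "w0 - p" "w0 - u"] that False r by (simp add: norm_minus_commute)
  show ?thesis using far[OF c(1)] far[OF c(2)] False by (simp add: log_radius_def log_density_def min_def)
qed

lemma log_density_bounds: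
  assumes "0 < r"
  shows "0 \<le> log_density p r R w" "log_density p r R w \<le> 2 / r"
  using assms by (auto simp: log_density_def add_nonneg_nonneg intro!: divide_left_mono mult_pos_pos add_pos_nonneg)

lemma log_density_borel [measurable]: "log_density p r R \<in> borel_measurable borel"
  unfolding log_density_def[abs_def] by measurable

text \<open>On the ring between the radii \<open>2 ^ (j - 1) * r\<close> and \<open>2 ^ j * r\<close> the density is at most \<open>4 / (2 ^ j * r)\<close>, so each
of the \<open>n + 2\<close> dyadic discs contributes at most \<open>16 * pi \<le> 64\<close>. The integral thus grows only like the
logarithm of the ratio of the radii.\<close>

lemma log_density_square_integral:
  assumes r: "0 < r"
  shows "(\<integral>\<^sup>+w. ennreal ((log_density p r (2 ^ n * r) w)\<^sup>2) \<partial>lborel) \<le> ennreal (64 * (real n + 2))"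
proof -
  let ?b = "\<lambda>j. ennreal (16 / (2 ^ j * r)\<^sup>2)"
  have pt: "ennreal ((log_density p r (2 ^ n * r) w)\<^sup>2) \<le> (\<Sum>j<n + 2. ?b j * indicator (cball p (2 ^ j * r)) w)" for w
  proof (cases "cmod (w - p) \<le> 2 * (2 ^ n * r)")
    case True
    then have ex: "cmod (w - p) \<le> 2 ^ (Suc n) * r" by simp
    define j where "j = (LEAST j. cmod (w - p) \<le> 2 ^ j * r)"
    have j: "cmod (w - p) \<le> 2 ^ j * r" "j \<le> Suc n"
      unfolding j_def using ex by (rule LeastI, intro Least_le)
    have "2 ^ j * r / 2 \<le> r + cmod (w - p)"
    proof (cases j)
      case (Suc i)
      then have "\<not> cmod (w - p) \<le> 2 ^ i * r"
        using not_less_Least[of i "\<lambda>j. cmod (w - p) \<le> 2 ^ j * r"] unfolding j_def[symmetric] by simp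
      then show ?thesis using Suc r by simp
    qed (use r in auto)
    then have "2 / (r + cmod (w - p)) \<le> 2 / (2 ^ j * r / 2)"
      using r by (intro divide_left_mono mult_pos_pos) (auto intro: add_pos_nonneg)
    then have le: "log_density p r (2 ^ n * r) w \<le> 4 / (2 ^ j * r)"
      using True by (simp add: log_density_def)
    have "ennreal ((log_density p r (2 ^ n * r) w)\<^sup>2) \<le> ennreal ((4 / (2 ^ j * r))\<^sup>2)"
      by (intro ennreal_leI power_mono le log_density_bounds r)
    also have "\<dots> = ?b j * indicator (cball p (2 ^ j * r)) w"
      using j(1) by (simp add: power_divide dist_norm norm_minus_commute)
    also have "\<dots> \<le> (\<Sum>j<n + 2. ?b j * indicator (cball p (2 ^ j * r)) w)"
      by (rule member_le_sum) (use j(2) in auto)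
    finally show ?thesis .
  qed (simp add: log_density_def)
  have "(\<integral>\<^sup>+w. ennreal ((log_density p r (2 ^ n * r) w)\<^sup>2) \<partial>lborel)
      \<le> (\<integral>\<^sup>+w. (\<Sum>j<n + 2. ?b j * indicator (cball p (2 ^ j * r)) w) \<partial>lborel)"
    by (rule nn_integral_mono) (rule pt)
  also have "\<dots> = (\<Sum>j<n + 2. ?b j * emeasure lborel (cball p (2 ^ j * r)))"
  proof (subst nn_integral_sum)
    show "(\<lambda>w. ?b j * indicator (cball p (2 ^ j * r)) w) \<in> borel_measurable lborel" for j
    proof -
      have "cball p (2 ^ j * r) \<in> sets borel" by simp
      then show ?thesis by measurable
    qed
  qed (auto simp: nn_integral_cmult_indicator)
  also have "\<dots> \<le> (\<Sum>j<n + 2. ennreal 64)"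
  proof (rule sum_mono)
    fix j
    have "?b j * emeasure lborel (cball p (2 ^ j * r)) = ennreal (16 / (2 ^ j * r)\<^sup>2 * (pi * (2 ^ j * r)\<^sup>2))"
      using emeasure_cball[of "2 ^ j * r" p] r by (subst ennreal_mult) (auto simp: unit_ball_vol_2)
    also have "16 / (2 ^ j * r)\<^sup>2 * (pi * (2 ^ j * r)\<^sup>2) = 16 * pi" using r by simp
    also have "ennreal (16 * pi) \<le> ennreal 64" using pi_less_4 by (intro ennreal_leI) auto
    finally show "?b j * emeasure lborel (cball p (2 ^ j * r)) \<le> ennreal 64" .
  qed
  also have "\<dots> = ennreal (64 * (real n + 2))"
    by (subst sum_ennreal) (auto simp: algebra_simps)
  finally show ?thesis .
qed

lemma abs_continuous_on_interval_Lipschitz: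
  assumes AC: "abs_continuous_on_interval a b F" and c: "0 < c"
    and lip: "\<And>w w'. \<bar>\<Phi> w - \<Phi> w'\<bar> \<le> c * cmod (w - w')"
  shows "abs_continuous_on_interval a b (\<lambda>t. complex_of_real (\<Phi> (F t)))"
  unfolding abs_continuous_on_interval_def
proof (intro allI impI)
  fix e :: real assume e: "e > 0"
  obtain d where d: "d > 0" "\<forall>\<D>. \<D> division_of \<Union>\<D> \<and> \<Union>\<D> \<subseteq> {a..b} \<and> (\<Sum>I\<in>\<D>. Sup I - Inf I) < d \<longrightarrow>
        (\<Sum>I\<in>\<D>. dist (F (Inf I)) (F (Sup I))) < e / c"
    using AC[unfolded abs_continuous_on_interval_def, rule_format, of "e / c"] e c by auto
  have "(\<Sum>I\<in>\<D>. dist (complex_of_real (\<Phi> (F (Inf I)))) (complex_of_real (\<Phi> (F (Sup I))))) < e"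
    if \<D>: "\<D> division_of \<Union>\<D> \<and> \<Union>\<D> \<subseteq> {a..b} \<and> (\<Sum>I\<in>\<D>. Sup I - Inf I) < d" for \<D>
  proof -
    have "(\<Sum>I\<in>\<D>. dist (complex_of_real (\<Phi> (F (Inf I)))) (complex_of_real (\<Phi> (F (Sup I))))) \<le> (\<Sum>I\<in>\<D>. c * dist (F (Inf I)) (F (Sup I)))"
      by (rule sum_mono) (use lip in \<open>simp add: dist_norm flip: of_real_diff\<close>)
    also have "\<dots> = c * (\<Sum>I\<in>\<D>. dist (F (Inf I)) (F (Sup I)))" by (simp add: sum_distrib_left)
    also have "\<dots> < c * (e / c)" using d(2) \<D> c by (intro mult_strict_left_mono) auto
    finally show ?thesis using c by simp
  qed
  then show "\<exists>d>0. \<forall>\<D>. \<D> division_of \<Union>\<D> \<and> \<Union>\<D> \<subseteq> {a..b} \<and> (\<Sum>I\<in>\<D>. Sup I - Inf I) < d \<longrightarrow>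
        (\<Sum>I\<in>\<D>. dist (complex_of_real (\<Phi> (F (Inf I)))) (complex_of_real (\<Phi> (F (Sup I))))) < e"
    using d(1) by blast
qed

lemma log_radius_increment:
  fixes F :: "real \<Rightarrow> complex" and m :: "real \<Rightarrow> real"
  assumes ab: "a \<le> b" and AC: "abs_continuous_on_interval a b F"
    and F: "F \<in> borel_measurable borel" and m: "m \<in> borel_measurable borel" "\<And>t. 0 \<le> m t"
    and r: "0 < r" "r \<le> R"
    and ae: "AE t in lborel. \<forall>e>0. \<exists>d>0. \<forall>s. \<bar>s - t\<bar> < d \<longrightarrow> cmod (F s - F t) \<le> (m t + e) * \<bar>s - t\<bar>"
  shows "ennreal \<bar>log_radius p r R (F b) - log_radius p r R (F a)\<bar>
    \<le> (\<integral>\<^sup>+t\<in>{a..b}. ennreal (log_density p r R (F t) * m t) \<partial>lborel)"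
proof (rule AC_increment_le_integral_gradient[OF ab])
  show "abs_continuous_on_interval a b (\<lambda>t. complex_of_real (log_radius p r R (F t)))"
    by (rule abs_continuous_on_interval_Lipschitz[OF AC, where c = "1 / r"])
       (use r log_radius_Lipschitz[of r R p] in auto)
  have "(\<lambda>t. log_density p r R (F t)) \<in> borel_measurable borel"
    by (rule measurable_compose[OF F log_density_borel])
  then show "(\<lambda>t. log_density p r R (F t) * m t) \<in> borel_measurable borel"
    using m(1) by measurable
  show "0 \<le> log_density p r R (F t) * m t" for t
    using log_density_bounds(1)[OF r(1)] m(2) by simp
  show "AE t in lborel. t \<in> {a..b} \<longrightarrow> (\<forall>e>0. \<exists>d>0. \<forall>u v. u \<in> {a..b} \<longrightarrow> v \<in> {a..b} \<longrightarrow>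
        u \<le> t \<longrightarrow> t \<le> v \<longrightarrow> v - u < d \<longrightarrow>
        \<bar>log_radius p r R (F v) - log_radius p r R (F u)\<bar> \<le> (log_density p r R (F t) * m t + e) * (v - u))"
    using ae
  proof (eventually_elim, intro impI allI)
    fix t e :: real
    assume t: "\<forall>e>0. \<exists>d>0. \<forall>s. \<bar>s - t\<bar> < d \<longrightarrow> cmod (F s - F t) \<le> (m t + e) * \<bar>s - t\<bar>" and e: "e > 0"
    define e' where "e' = e * r / 2"
    have e': "e' > 0" using e r by (simp add: e'_def)
    obtain d where d: "d > 0" "\<And>s. \<bar>s - t\<bar> < d \<Longrightarrow> cmod (F s - F t) \<le> (m t + e') * \<bar>s - t\<bar>"
      using t e' by metis
    define d' where "d' = min d (r / (2 * (m t + e')))"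
    have M: "m t + e' > 0" using m(2)[of t] e' by linarith
    have d': "d' > 0" using d(1) M r by (simp add: d'_def)
    have close: "cmod (F s - F t) \<le> r / 2" if "\<bar>s - t\<bar> < d'" for s
    proof -
      have "cmod (F s - F t) \<le> (m t + e') * \<bar>s - t\<bar>" using d(2) that by (simp add: d'_def)
      also have "\<dots> \<le> (m t + e') * (r / (2 * (m t + e')))"
        by (rule mult_left_mono) (use that M in \<open>auto simp: d'_def\<close>)
      also have "\<dots> = r / 2"
      proof -
        have "x * (r / (2 * x)) = r / 2" if "x > 0" for x :: real using that by simp
        then show ?thesis using M by blast
      qed
      finally show ?thesis .
    qed
    have "\<bar>log_radius p r R (F v) - log_radius p r R (F u)\<bar> \<le> (log_density p r R (F t) * m t + e) * (v - u)"
      if uv: "u \<le> t" "t \<le> v" "v - u < d'" for u v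
    proof -
      have uv': "\<bar>u - t\<bar> < d'" "\<bar>v - t\<bar> < d'" using uv by auto
      then have "\<bar>u - t\<bar> < d" "\<bar>v - t\<bar> < d" by (auto simp: d'_def)
      then have "cmod (F u - F t) \<le> (m t + e') * (t - u)" "cmod (F v - F t) \<le> (m t + e') * (v - t)"
        using d(2)[of u] d(2)[of v] uv by auto
      moreover have "cmod (F v - F u) \<le> cmod (F v - F t) + cmod (F u - F t)"
        using norm_triangle_ineq4[of "F v - F t" "F u - F t"] by simp
      ultimately have "cmod (F v - F u) \<le> (m t + e') * (v - u)" by (simp add: algebra_simps)
      then have "log_density p r R (F t) * cmod (F v - F u) \<le> log_density p r R (F t) * ((m t + e') * (v - u))"
        by (rule mult_left_mono[OF _ log_density_bounds(1)[OF r(1)]])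
      moreover have "\<bar>log_radius p r R (F v) - log_radius p r R (F u)\<bar> \<le> log_density p r R (F t) * cmod (F v - F u)"
        by (rule log_radius_local[OF r]) (use close uv' in auto)
      moreover have "log_density p r R (F t) * e' * (v - u) \<le> e * (v - u)"
      proof (rule mult_right_mono)
        have "log_density p r R (F t) * e' \<le> 2 / r * e'"
          by (rule mult_right_mono[OF log_density_bounds(2)[OF r(1)]]) (use e' in auto)
        also have "\<dots> = e" using r by (simp add: e'_def)
        finally show "log_density p r R (F t) * e' \<le> e" .
      qed (use uv in auto)
      ultimately show ?thesis by (simp add: algebra_simps)
    qed
    then show "\<exists>d>0. \<forall>u v. u \<in> {a..b} \<longrightarrow> v \<in> {a..b} \<longrightarrow> u \<le> t \<longrightarrow> t \<le> v \<longrightarrow> v - u < d \<longrightarrow>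
        \<bar>log_radius p r R (F v) - log_radius p r R (F u)\<bar> \<le> (log_density p r R (F t) * m t + e) * (v - u)"
      using d' by blast
  qed
qed

section \<open>Quasiconformal maps and round rings\<close>

lemma continuous_on_stereo_iff:
  fixes g :: "'a::metric_space \<Rightarrow> riemann_sphere"
  shows "continuous_on S g \<longleftrightarrow> continuous_on S (\<lambda>x. stereo (g x))"
  by (simp add: continuous_on_iff dist_riemann_sphere_def)

lemma continuous_on_Fin: "continuous_on S Fin"
proof -
  have nz: "complex_of_real (1 + (cmod z)\<^sup>2) \<noteq> 0" "(cmod z)\<^sup>2 + 1 \<noteq> 0" for z
    by (simp_all only: of_real_eq_0_iff) (smt (verit) zero_le_power2)+
  show ?thesis
    unfolding continuous_on_stereo_iff stereo.simps
    by (intro continuous_intros ballI nz)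
qed

definition coord :: "riemann_sphere \<Rightarrow> complex" where
  "coord = inv_into UNIV Fin"

lemma coord_Fin [simp]: "coord (Fin z) = z"
  by (simp add: coord_def inj_charts(1))

lemma range_Fin: "range Fin = - {Infty}"
proof (rule Set.set_eqI)
  show "x \<in> range Fin \<longleftrightarrow> x \<in> - {Infty}" for x by (cases x) auto
qed

lemma open_range_Fin: "open (range Fin)"
  unfolding range_Fin by (rule open_Compl) simp

lemma continuous_on_coord: "continuous_on (range Fin) coord"
proof -
  have c: "continuous_on (range Fin) stereo"
    using continuous_on_stereo_iff[of "range Fin" "\<lambda>x. x"] by simp
  have nz: "1 - snd (stereo x) \<noteq> 0" "coord x = fst (stereo x) / of_real (1 - snd (stereo x))" if "x \<in> range Fin" for x
  proof -
    obtain z where z: "x = Fin z" using \<open>x \<in> range Fin\<close> by blast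
    have p: "(cmod z)\<^sup>2 + 1 > 0" by (smt (verit) zero_le_power2)
    have e: "1 - snd (stereo x) = 2 / ((cmod z)\<^sup>2 + 1)" using p by (simp add: z field_simps)
    then show "1 - snd (stereo x) \<noteq> 0" using p by simp
    have "complex_of_real (1 + (cmod z)\<^sup>2) \<noteq> 0" using p by (simp only: of_real_eq_0_iff)
    then show "coord x = fst (stereo x) / of_real (1 - snd (stereo x))"
      unfolding e by (simp add: z add.commute)
  qed
  have "continuous_on (range Fin) (\<lambda>x. fst (stereo x) / of_real (1 - snd (stereo x)))"
    by (intro continuous_intros c) (use nz in auto)
  then show ?thesis by (rule continuous_on_cong[THEN iffD1, OF refl, rotated]) (use nz in auto)
qed

lemma abs_continuous_on_interval_subset:
  assumes "abs_continuous_on_interval a b F" "a \<le> a'" "b' \<le> b"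
  shows "abs_continuous_on_interval a' b' F"
  unfolding abs_continuous_on_interval_def
proof (intro allI impI)
  fix e :: real assume "e > 0"
  then obtain d where d: "d > 0" "\<forall>\<D>. \<D> division_of \<Union>\<D> \<and> \<Union>\<D> \<subseteq> {a..b} \<and> (\<Sum>I\<in>\<D>. Sup I - Inf I) < d \<longrightarrow>
        (\<Sum>I\<in>\<D>. dist (F (Inf I)) (F (Sup I))) < e"
    using assms(1)[unfolded abs_continuous_on_interval_def] by blast
  have "{a'..b'} \<subseteq> {a..b}" using assms by auto
  then show "\<exists>d>0. \<forall>\<D>. \<D> division_of \<Union>\<D> \<and> \<Union>\<D> \<subseteq> {a'..b'} \<and> (\<Sum>I\<in>\<D>. Sup I - Inf I) < d \<longrightarrow>
        (\<Sum>I\<in>\<D>. dist (F (Inf I)) (F (Sup I))) < e"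
    using d by (meson order_trans)
qed

text \<open>Every \<open>x\<close> other than \<open>a\<close> lies in a rational interval that avoids \<open>a\<close>, and every bounded interval of the other
variable lies in some \<open>{-N..N}\<close> with \<open>N\<close> a natural number; there are only countably many such slabs. In the
application \<open>a\<close> is a coordinate of a possible pole of a quasiconformal map.\<close>

lemma abs_continuous_on_almost_every_slice:
  assumes slab: "\<And>q1 q2 N. a \<notin> {q1..q2} \<Longrightarrow>
      AE x in lborel. x \<in> {q1..q2} \<longrightarrow> abs_continuous_on_interval (- N) N (F x)"
  shows "AE x in lborel. \<forall>y1 y2. abs_continuous_on_interval y1 y2 (F (x :: real))"
proof -
  let ?P = "\<lambda>(q1, q2, n) x. a \<notin> {of_rat q1..of_rat q2} \<longrightarrow> x \<in> {of_rat q1..of_rat q2} \<longrightarrow>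
      abs_continuous_on_interval (- real n) (real n) (F x)"
  have "AE x in lborel. \<forall>i :: rat \<times> rat \<times> nat. ?P i x"
    unfolding AE_all_countable
  proof (intro allI)
    fix i :: "rat \<times> rat \<times> nat"
    obtain q1 q2 n where i: "i = (q1, q2, n)" by (cases i)
    show "AE x in lborel. ?P i x"
      using slab[of "of_rat q1" "of_rat q2" "real n"] unfolding i by (cases "a \<notin> {of_rat q1..of_rat q2}") auto
  qed
  moreover have "AE x in lborel. x \<noteq> a" by (rule AE_lborel_singleton)
  ultimately show ?thesis
  proof (eventually_elim, intro allI)
    fix x y1 y2 :: real
    assume A: "\<forall>i :: rat \<times> rat \<times> nat. ?P i x" and ne: "x \<noteq> a"
    obtain q1 where q1: "x - \<bar>x - a\<bar> < of_rat q1" "of_rat q1 < x"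
      using of_rat_dense[of "x - \<bar>x - a\<bar>" x] ne by auto
    obtain q2 where q2: "x < of_rat q2" "of_rat q2 < x + \<bar>x - a\<bar>"
      using of_rat_dense[of x "x + \<bar>x - a\<bar>"] ne by auto
    obtain N :: nat where N: "max \<bar>y1\<bar> \<bar>y2\<bar> \<le> real N" using real_arch_simple by blast
    have "abs_continuous_on_interval (- real N) (real N) (F x)"
      using A[rule_format, of "(q1, q2, N)"] q1 q2 ne by (auto simp: abs_if split: if_splits)
    then show "abs_continuous_on_interval y1 y2 (F x)"
      by (rule abs_continuous_on_interval_subset) (use N in auto)
  qed
qed

lemma abs_continuous_on_almost_every_line:
  assumes acl: "abs_continuous_on_lines D f" and D: "- {z0} \<subseteq> D"
  shows "AE x in lborel. \<forall>y1 y2. abs_continuous_on_interval y1 y2 (\<lambda>y. f (Complex x y))"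
    "AE y in lborel. \<forall>x1 x2. abs_continuous_on_interval x1 x2 (\<lambda>x. f (Complex x y))"
proof -
  note acl' = acl[unfolded abs_continuous_on_lines_def AE_completion_iff, rule_format]
  show "AE x in lborel. \<forall>y1 y2. abs_continuous_on_interval y1 y2 (\<lambda>y. f (Complex x y))"
  proof (rule abs_continuous_on_almost_every_slice[where a = "Re z0"])
    fix q1 q2 N :: real assume "Re z0 \<notin> {q1..q2}"
    then have "cbox (Complex q1 (- N)) (Complex q2 N) \<subseteq> D" using D by (auto simp: in_cbox_complex_iff)
    from acl'[OF this]
    show "AE x in lborel. x \<in> {q1..q2} \<longrightarrow> abs_continuous_on_interval (- N) N (\<lambda>y. f (Complex x y))" by simp
  qed
  show "AE y in lborel. \<forall>x1 x2. abs_continuous_on_interval x1 x2 (\<lambda>x. f (Complex x y))"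
  proof (rule abs_continuous_on_almost_every_slice[where a = "Im z0"])
    fix q1 q2 N :: real assume "Im z0 \<notin> {q1..q2}"
    then have "cbox (Complex (- N) q1) (Complex N q2) \<subseteq> D" using D by (auto simp: in_cbox_complex_iff)
    from acl'[OF this]
    show "AE y in lborel. y \<in> {q1..q2} \<longrightarrow> abs_continuous_on_interval (- N) N (\<lambda>x. f (Complex x y))" by simp
  qed
qed

text \<open>Suppose that all frames with radii in \<open>(s, 3 / 2 * s)\<close> meet the preimages of the inner disc and of the
exterior of a ring of ratio \<open>2 ^ n\<close>. Then the logarithmic radius of \<open>h\<close> varies along each of them by at
least \<open>(n - 1) * ln 2\<close>. On the other hand, by \<open>frame_oscillation\<close> and the Cauchy-Schwarz inequality, the square of
\<open>(n - 1) * s\<close> is at most a multiple of the area of the big square, which is \<open>9 * s\<^sup>2\<close>, times the integral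
of the squared density, which is linear in \<open>n\<close>. So \<open>n\<close> is bounded, independently of the ring and of the frames.\<close>

lemma quasiconformal_ring_bound:
  assumes qc: "quasiconformal K UNIV UNIV h"
  obtains n0 :: nat where "\<And>n p r c s. n0 \<le> n \<Longrightarrow> 0 < r \<Longrightarrow> 0 < s \<Longrightarrow>
    \<exists>s'. s < s' \<and> s' < 3 / 2 * s \<and> \<not> (\<exists>z w. square_norm (z - c) = s' \<and> square_norm (w - c) = s' \<and>
      h (Fin z) \<in> Fin ` cball p r \<and> h (Fin w) \<notin> Fin ` ball p (2 ^ n * r))"
proof -
  define D where "D = {z. h (Fin z) \<in> range Fin}"
  define f where "f z = coord (h (Fin z))" for z
  define \<kappa> where "\<kappa> = (K - 1) / (K + 1)"
  have K: "K \<ge> 1" using qc by (simp add: quasiconformal_def)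
  then have \<kappa>: "0 \<le> \<kappa>" "\<kappa> < 1" by (auto simp: \<kappa>_def)
  obtain k where hk: "homeomorphism UNIV UNIV h k" using qc by (auto simp: quasiconformal_def)
  have hkx: "h (k x) = x" "k (h x) = x" for x using hk by (auto simp: homeomorphism_def)
  have ch: "continuous_on UNIV h" "continuous_on UNIV k" using hk by (auto simp: homeomorphism_def)
  have fD: "Fin (f z) = h (Fin z)" if "z \<in> D" for z using that by (auto simp: D_def f_def)
  have ff: "(inv_into UNIV Fin \<circ> h \<circ> Fin) = f" by (auto simp: f_def coord_def)
  have DD: "{z. Fin z \<in> UNIV \<and> h (Fin z) \<in> range Fin} = D" by (simp add: D_def)
  have all: "\<forall>\<phi>\<in>{Fin, recip_chart}. \<forall>\<psi>\<in>{Fin, recip_chart}.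
        let D = {z. \<phi> z \<in> UNIV \<and> h (\<phi> z) \<in> range \<psi>}; f = inv_into UNIV \<psi> \<circ> h \<circ> \<phi> in
          orientation_preserving_on D f \<and>
          abs_continuous_on_lines D f \<and>
          (AE z in lebesgue. z \<in> D \<longrightarrow>
             has_partials_at f z \<and>
             cmod (partial_zbar f z) \<le> (K - 1) / (K + 1) * cmod (partial_z f z))"
    using qc unfolding quasiconformal_def by blast
  have acl: "abs_continuous_on_lines D f"
    and ae: "AE z in lborel. z \<in> D \<longrightarrow> has_partials_at f z \<and> cmod (partial_zbar f z) \<le> \<kappa> * cmod (partial_z f z)"
    using bspec[OF bspec[OF all, of Fin], of Fin] unfolding Let_def ff DD \<kappa>_def AE_completion_iff by auto
  \<comment> \<open>The only possible pole of \<open>f\<close>; if \<open>h\<close> fixes \<open>Infty\<close>, there is no pole and \<open>z0\<close> is arbitrary.\<close>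
  define z0 where "z0 = coord (k Infty)"
  have z0: "- {z0} \<subseteq> D"
  proof (rule subsetI, rule ccontr)
    fix z assume "z \<in> - {z0}" "z \<notin> D"
    then have "z \<noteq> z0" "h (Fin z) \<notin> range Fin" by (auto simp: D_def)
    then have "h (Fin z) = Infty" by (simp add: range_Fin)
    then have "k Infty = Fin z" using hkx(2)[of "Fin z"] by simp
    then show False using \<open>z \<noteq> z0\<close> by (simp add: z0_def)
  qed
  have chF: "continuous_on UNIV (\<lambda>z. h (Fin z))" "continuous_on UNIV (\<lambda>z. k (Fin z))"
    using continuous_on_compose2[OF ch(1) continuous_on_Fin] continuous_on_compose2[OF ch(2) continuous_on_Fin] by auto
  have oD: "open D"
    using open_vimage[OF open_range_Fin chF(1)] by (simp add: D_def vimage_def)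
  have Db: "D \<in> sets borel" using oD by auto
  have cf: "continuous_on D f" unfolding f_def
    by (rule continuous_on_compose2[OF continuous_on_coord continuous_on_subset[OF chF(1)]]) (auto simp: D_def)
  define g where "g w = coord (k (Fin w))" for w
  have gf: "g (f z) = z" if "z \<in> D" for z using fD[OF that] hkx(2) by (simp add: g_def)
  have im: "f ` D = {w. k (Fin w) \<in> range Fin}"
  proof (intro subset_antisym subsetI)
    fix w assume "w \<in> f ` D"
    then show "w \<in> {w. k (Fin w) \<in> range Fin}" using fD hkx(2) by auto
  next
    fix w assume "w \<in> {w. k (Fin w) \<in> range Fin}"
    then obtain z where "k (Fin w) = Fin z" by auto
    then have z: "h (Fin z) = Fin w" using hkx(1)[of "Fin w"] by simp
    then have "z \<in> D" "f z = w" by (auto simp: D_def f_def)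
    then show "w \<in> f ` D" by blast
  qed
  have ofD: "open (f ` D)"
    using open_vimage[OF open_range_Fin chF(2)] by (simp add: im vimage_def)
  have cg: "continuous_on (f ` D) g" unfolding g_def im
    by (rule continuous_on_compose2[OF continuous_on_coord continuous_on_subset[OF chF(2)]]) auto
  obtain m :: "complex \<Rightarrow> real" where m: "m \<in> borel_measurable borel" "\<And>z. 0 \<le> m z"
    "\<And>z. z \<in> D \<Longrightarrow> has_partials_at f z \<Longrightarrow> cmod (partial_zbar f z) \<le> \<kappa> * cmod (partial_z f z) \<Longrightarrow>
       cmod (partial_x f z) \<le> m z \<and> cmod (partial_y f z) \<le> m z"
    "\<And>\<phi>. \<phi> \<in> borel_measurable borel \<Longrightarrow>
       (\<integral>\<^sup>+z\<in>D. \<phi> (f z) * ennreal ((m z)\<^sup>2) \<partial>lborel) \<le> ennreal (1152 / (1 - \<kappa>)\<^sup>2) * (\<integral>\<^sup>+w. \<phi> w \<partial>lborel)"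
    by (rule conformal_density[OF oD cf gf ofD cg \<kappa>]) (assumption | (rule that; assumption))+
  define C where "C = 1152 / (1 - \<kappa>)\<^sup>2"
  have C: "C \<ge> 0" by (simp add: C_def)
  define F where "F z = (if z \<in> D then f z else 0)" for z
  have Fb: "F \<in> borel_measurable borel" unfolding F_def[abs_def]
    by (rule borel_measurable_continuous_on_if) (use oD cf in auto)
  have loc: "\<forall>e>0. \<exists>d>0. \<forall>t. \<bar>t\<bar> < d \<longrightarrow> cmod (f (z + \<omega> * of_real t) - f z) \<le> (m z + e) * \<bar>t\<bar>"
    if z: "z \<in> D" "z \<in> D \<longrightarrow> has_partials_at f z \<and> cmod (partial_zbar f z) \<le> \<kappa> * cmod (partial_z f z)"
      and \<omega>: "\<omega> \<in> {1, \<i>}" for z \<omega>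
  proof (intro allI impI)
    fix e :: real assume e: "e > 0"
    have hp: "has_partials_at f z" and le: "cmod (partial_x f z) \<le> m z" "cmod (partial_y f z) \<le> m z"
      using m(3)[of z] z by auto
    obtain \<delta> where \<delta>: "\<delta> > 0"
      "\<And>t. \<bar>t\<bar> < \<delta> \<Longrightarrow> cmod (f (z + of_real t) - f z - of_real t * partial_x f z) \<le> e * \<bar>t\<bar>"
      "\<And>t. \<bar>t\<bar> < \<delta> \<Longrightarrow> cmod (f (z + \<i> * of_real t) - f z - of_real t * partial_y f z) \<le> e * \<bar>t\<bar>"
      by (rule has_partials_at_approx[OF hp e]) (rule that; assumption)
    define f' where "f' = (if \<omega> = 1 then partial_x f z else partial_y f z)"
    have f': "cmod f' \<le> m z" using le by (simp add: f'_def)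
    have "cmod (f (z + \<omega> * of_real t) - f z) \<le> (m z + e) * \<bar>t\<bar>" if t: "\<bar>t\<bar> < \<delta>" for t
    proof -
      have "cmod (f (z + \<omega> * of_real t) - f z - of_real t * f') \<le> e * \<bar>t\<bar>"
      proof (cases "\<omega> = 1")
        case True
        then show ?thesis using \<delta>(2)[OF t] by (simp add: f'_def)
      next
        case False
        then show ?thesis using \<omega> \<delta>(3)[OF t] by (simp add: f'_def)
      qed
      moreover have "cmod (of_real t * f') \<le> m z * \<bar>t\<bar>"
        using mult_right_mono[OF f', of "\<bar>t\<bar>"] by (simp add: norm_mult mult.commute)
      ultimately show ?thesis
        using norm_triangle_sub[of "f (z + \<omega> * of_real t) - f z" "of_real t * f'"] by (simp add: distrib_right)
    qed
    then show "\<exists>d>0. \<forall>t. \<bar>t\<bar> < d \<longrightarrow> cmod (f (z + \<omega> * of_real t) - f z) \<le> (m z + e) * \<bar>t\<bar>"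
      using \<delta>(1) by blast
  qed
  \<comment> \<open>The final inequality reads \<open>n - 1 \<le> 2359296 * C\<close>.\<close>
  define n0 where "n0 = nat \<lceil>2359296 * C\<rceil> + 3"
  show thesis
  proof (rule that[of n0], rule ccontr)
    fix n :: nat and p c :: complex and r s :: real
    assume n: "n0 \<le> n" and r: "0 < r" and s: "0 < s"
      and "\<not> (\<exists>s'. s < s' \<and> s' < 3 / 2 * s \<and> \<not> (\<exists>z w. square_norm (z - c) = s' \<and> square_norm (w - c) = s' \<and>
        h (Fin z) \<in> Fin ` cball p r \<and> h (Fin w) \<notin> Fin ` ball p (2 ^ n * r)))"
    then have ring: "\<exists>z w. square_norm (z - c) = s' \<and> square_norm (w - c) = s' \<and>
        h (Fin z) \<in> Fin ` cball p r \<and> h (Fin w) \<notin> Fin ` ball p (2 ^ n * r)"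
      if "s < s'" "s' < 3 / 2 * s" for s' using that by blast
    define R where "R = 2 ^ n * r"
    have R: "r \<le> R" "0 < R" using r by (auto simp: R_def)
    define \<rho> where "\<rho> = log_density p r R"
    define G where "G z = (if z \<in> D then log_radius p r R (f z) else ln (r + R))" for z
    define \<mu> where "\<mu> z = ennreal (\<rho> (F z) * m z) * indicator D z" for z
    have \<rho>b: "(\<lambda>z. \<rho> (F z)) \<in> borel_measurable borel" unfolding \<rho>_def by (rule measurable_compose[OF Fb log_density_borel])
    have \<mu>b: "\<mu> \<in> borel_measurable borel" unfolding \<mu>_def[abs_def] using \<rho>b m(1) Db by measurable
    have chord: "AE x in lborel. \<forall>y1 y2. y1 \<le> y2 \<longrightarrow>
        ennreal \<bar>G (\<gamma> x y2) - G (\<gamma> x y1)\<bar> \<le> (\<integral>\<^sup>+y\<in>{y1..y2}. \<mu> (\<gamma> x y) \<partial>lborel)"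
      if dir: "\<omega> \<in> {1, \<i>}" "\<And>x s t. \<gamma> x t + \<omega> * of_real (s - t) = \<gamma> x s"
        and ae\<gamma>: "AE x in lborel. AE y in lborel. \<gamma> x y \<in> D \<longrightarrow> has_partials_at f (\<gamma> x y) \<and>
          cmod (partial_zbar f (\<gamma> x y)) \<le> \<kappa> * cmod (partial_z f (\<gamma> x y))"
        and ac\<gamma>: "AE x in lborel. \<forall>y1 y2. abs_continuous_on_interval y1 y2 (\<lambda>y. f (\<gamma> x y))"
        and D\<gamma>: "AE x in lborel. \<forall>y. \<gamma> x y \<in> D" for \<gamma> :: "real \<Rightarrow> real \<Rightarrow> complex" and \<omega>
      using ae\<gamma> ac\<gamma> D\<gamma>
    proof (eventually_elim, intro allI impI)
      fix x y1 y2 :: real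
      assume A: "AE y in lborel. \<gamma> x y \<in> D \<longrightarrow> has_partials_at f (\<gamma> x y) \<and>
          cmod (partial_zbar f (\<gamma> x y)) \<le> \<kappa> * cmod (partial_z f (\<gamma> x y))"
        and B: "\<forall>y1 y2. abs_continuous_on_interval y1 y2 (\<lambda>y. f (\<gamma> x y))"
        and inD: "\<forall>y. \<gamma> x y \<in> D" and le: "y1 \<le> y2"
      have "(\<lambda>y. \<gamma> x 0 + \<omega> * of_real (y - 0)) \<in> borel_measurable borel"
        by (intro borel_measurable_continuous_onI continuous_intros)
      then have m\<gamma>: "(\<lambda>y. \<gamma> x y) \<in> borel_measurable borel" unfolding dir(2) .
      have Ff: "(\<lambda>y. F (\<gamma> x y)) = (\<lambda>y. f (\<gamma> x y))" using inD by (simp add: F_def)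
      have "ennreal \<bar>log_radius p r R (f (\<gamma> x y2)) - log_radius p r R (f (\<gamma> x y1))\<bar>
         \<le> (\<integral>\<^sup>+t\<in>{y1..y2}. ennreal (log_density p r R (f (\<gamma> x t)) * m (\<gamma> x t)) \<partial>lborel)"
      proof (rule log_radius_increment[OF le _ _ measurable_compose[OF m\<gamma> m(1)] m(2) r R(1)])
        show "abs_continuous_on_interval y1 y2 (\<lambda>y. f (\<gamma> x y))" using B by blast
        show "(\<lambda>y. f (\<gamma> x y)) \<in> borel_measurable borel" using measurable_compose[OF m\<gamma> Fb] unfolding Ff .
        show "AE t in lborel. \<forall>e>0. \<exists>d>0. \<forall>s. \<bar>s - t\<bar> < d \<longrightarrow>
            cmod (f (\<gamma> x s) - f (\<gamma> x t)) \<le> (m (\<gamma> x t) + e) * \<bar>s - t\<bar>"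
          using A
        proof eventually_elim
          fix t assume "\<gamma> x t \<in> D \<longrightarrow> has_partials_at f (\<gamma> x t) \<and>
            cmod (partial_zbar f (\<gamma> x t)) \<le> \<kappa> * cmod (partial_z f (\<gamma> x t))"
          from loc[OF inD[rule_format] this dir(1)]
          show "\<forall>e>0. \<exists>d>0. \<forall>s. \<bar>s - t\<bar> < d \<longrightarrow>
            cmod (f (\<gamma> x s) - f (\<gamma> x t)) \<le> (m (\<gamma> x t) + e) * \<bar>s - t\<bar>"
            using dir(2) by metis
        qed
      qed
      then show "ennreal \<bar>G (\<gamma> x y2) - G (\<gamma> x y1)\<bar> \<le> (\<integral>\<^sup>+y\<in>{y1..y2}. \<mu> (\<gamma> x y) \<partial>lborel)"
        using inD by (simp add: G_def \<mu>_def F_def \<rho>_def)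
    qed
    have vert: "AE x in lborel. \<forall>y1 y2. y1 \<le> y2 \<longrightarrow>
       ennreal \<bar>G (Complex x y2) - G (Complex x y1)\<bar> \<le> (\<integral>\<^sup>+y\<in>{y1..y2}. \<mu> (Complex x y) \<partial>lborel)"
    proof (rule chord[where \<omega> = \<i>])
      show "AE x in lborel. \<forall>y. Complex x y \<in> D"
        using AE_lborel_singleton[of "Re z0"] by eventually_elim (use z0 in auto)
    qed (use AE_Complex(1)[OF ae] abs_continuous_on_almost_every_line(1)[OF acl z0] in \<open>auto simp: complex_eq_iff\<close>)
    have horiz: "AE y in lborel. \<forall>x1 x2. x1 \<le> x2 \<longrightarrow>
       ennreal \<bar>G (Complex x2 y) - G (Complex x1 y)\<bar> \<le> (\<integral>\<^sup>+x\<in>{x1..x2}. \<mu> (Complex x y) \<partial>lborel)"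
    proof (rule chord[where \<omega> = 1])
      show "AE y in lborel. \<forall>x. Complex x y \<in> D"
        using AE_lborel_singleton[of "Im z0"] by eventually_elim (use z0 in auto)
    qed (use AE_Complex(2)[OF ae] abs_continuous_on_almost_every_line(2)[OF acl z0] in \<open>auto simp: complex_eq_iff\<close>)
    have n3: "real n \<ge> 3" using n by (simp add: n0_def)
    have osc: "\<exists>z w. square_norm (z - c) = s' \<and> square_norm (w - c) = s' \<and> (real n - 1) / 2 \<le> \<bar>G z - G w\<bar>"
      if s': "s < s'" "s' < 3 / 2 * s" for s'
    proof -
      obtain z w where zw: "square_norm (z - c) = s'" "square_norm (w - c) = s'"
        "h (Fin z) \<in> Fin ` cball p r" "h (Fin w) \<notin> Fin ` ball p R" using ring[OF s'] unfolding R_def by blast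
      have zD: "z \<in> D" and fz: "cmod (f z - p) \<le> r"
        using zw(3) by (auto simp: D_def f_def dist_norm norm_minus_commute)
      have Gz: "G z \<le> ln (2 * r)"
        using zD fz r R by (simp add: G_def log_radius_def min_def add_pos_nonneg)
      have Gw: "G w = ln (r + R)"
      proof (cases "w \<in> D")
        case True
        then have "f w \<notin> ball p R" using zw(4) fD[OF True] by (metis imageI)
        then show ?thesis using True by (simp add: G_def log_radius_def min_def dist_norm norm_minus_commute)
      qed (simp add: G_def)
      have "ln (2 ^ n * r) \<le> ln (r + R)" using r R by (simp add: R_def add_pos_pos)
      moreover have "ln (2 ^ n * r) = real n * ln 2 + ln r" "ln (2 * r) = ln 2 + ln r"
        using r by (simp_all add: ln_mult ln_realpow)
      moreover have "(real n - 1) * (1 / 2) \<le> (real n - 1) * ln 2"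
        by (rule mult_left_mono) (use ln2_ge_two_thirds n3 in auto)
      ultimately have "(real n - 1) / 2 \<le> G w - G z" using Gz Gw by (simp add: algebra_simps)
      then show ?thesis using zw(1,2) by (intro exI[of _ z] exI[of _ w] conjI; linarith)
    qed
    let ?s2 = "3 / 2 * s"
    let ?Q = "{z. square_norm (z - c) \<le> ?s2}"
    have "ennreal ((?s2 - s) * ((real n - 1) / 2)) \<le> 8 * (\<integral>\<^sup>+z. \<mu> z * indicator ?Q z \<partial>lborel)"
      by (rule frame_oscillation[OF \<mu>b s _ _ vert horiz osc]) (use s n3 in auto)
    then have "(ennreal ((?s2 - s) * ((real n - 1) / 2)))\<^sup>2 \<le> (8 * (\<integral>\<^sup>+z. \<mu> z * indicator ?Q z \<partial>lborel))\<^sup>2"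
      by (rule power_mono) simp
    also have "\<dots> = 64 * (\<integral>\<^sup>+z. \<mu> z * indicator ?Q z \<partial>lborel)\<^sup>2" by (simp add: power_mult_distrib)
    also have "\<dots> \<le> 64 * ((\<integral>\<^sup>+z. (\<mu> z)\<^sup>2 \<partial>lborel) * (\<integral>\<^sup>+z. (indicator ?Q z)\<^sup>2 \<partial>lborel))"
    proof -
      have Q: "?Q \<in> sets borel"
        unfolding square_norm_def by (intro borel_closed closed_Collect_le continuous_intros)
      have "(indicator ?Q :: complex \<Rightarrow> ennreal) \<in> borel_measurable lborel" using Q by simp
      then show ?thesis using \<mu>b by (intro mult_left_mono Cauchy_Schwarz_nn_integral) auto
    qed
    also have "(\<integral>\<^sup>+z. (indicator ?Q z :: ennreal)\<^sup>2 \<partial>lborel) = ennreal (9 * s\<^sup>2)"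
    proof -
      have "{z. square_norm (z - c) \<le> t} = cbox (c - Complex t t) (c + Complex t t)" for t
        by (auto simp: square_norm_def in_cbox_complex_iff abs_le_iff)
      then have Qbox: "?Q = cbox (c - Complex ?s2 ?s2) (c + Complex ?s2 ?s2)" .
      have "(\<integral>\<^sup>+z. (indicator ?Q z :: ennreal)\<^sup>2 \<partial>lborel) = (\<integral>\<^sup>+z. indicator ?Q z \<partial>lborel)"
        by (rule nn_integral_cong) (auto simp: indicator_def)
      also have "\<dots> = emeasure lborel ?Q" unfolding Qbox by (rule nn_integral_indicator) simp
      also have "\<dots> = ennreal (9 * s\<^sup>2)"
        unfolding Qbox emeasure_lborel_cbox_eq using s by (simp add: Basis_complex_def power2_eq_square)
      finally show ?thesis .
    qed
    also have "(\<integral>\<^sup>+z. (\<mu> z)\<^sup>2 \<partial>lborel) \<le> ennreal (C * (64 * (real n + 2)))"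
    proof -
      have "(\<integral>\<^sup>+z. (\<mu> z)\<^sup>2 \<partial>lborel) = (\<integral>\<^sup>+z\<in>D. ennreal ((\<rho> (f z))\<^sup>2) * ennreal ((m z)\<^sup>2) \<partial>lborel)"
        by (rule nn_integral_cong)
           (use m(2) log_density_bounds(1)[OF r] in \<open>auto simp: \<mu>_def F_def \<rho>_def indicator_def ennreal_power power_mult_distrib ennreal_mult\<close>)
      also have "\<dots> \<le> ennreal C * (\<integral>\<^sup>+w. ennreal ((\<rho> w)\<^sup>2) \<partial>lborel)"
        unfolding C_def by (rule m(4)) (simp add: \<rho>_def)
      also have "\<dots> \<le> ennreal C * ennreal (64 * (real n + 2))"
        unfolding \<rho>_def R_def by (intro mult_left_mono log_density_square_integral r) simp
      also have "\<dots> = ennreal (C * (64 * (real n + 2)))" using C by (simp add: ennreal_mult)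
      finally show ?thesis .
    qed
    finally have "(ennreal ((?s2 - s) * ((real n - 1) / 2)))\<^sup>2 \<le> 64 * (ennreal (C * (64 * (real n + 2))) * ennreal (9 * s\<^sup>2))"
      by (simp add: mult_left_mono mult_right_mono)
    also have "\<dots> = ennreal (64 * ((C * (64 * (real n + 2))) * (9 * s\<^sup>2)))"
    proof -
      have "64 * (ennreal A * ennreal B) = ennreal (64 * (A * B))" if "0 \<le> A" "0 \<le> B" for A B
        using that by (simp add: ennreal_mult)
      then show ?thesis using C by simp
    qed
    also have "(ennreal ((?s2 - s) * ((real n - 1) / 2)))\<^sup>2 = ennreal (((?s2 - s) * ((real n - 1) / 2))\<^sup>2)"
      using s n3 by (simp add: ennreal_power)
    finally have "((?s2 - s) * ((real n - 1) / 2))\<^sup>2 \<le> 64 * ((C * (64 * (real n + 2))) * (9 * s\<^sup>2))"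
      using C by (subst (asm) ennreal_le_iff) auto
    then have "s\<^sup>2 * (real n - 1)\<^sup>2 \<le> s\<^sup>2 * (589824 * C * (real n + 2))"
      by (simp add: power2_eq_square algebra_simps)
    then have "(real n - 1)\<^sup>2 \<le> 589824 * C * (real n + 2)" using s by simp
    also have "\<dots> \<le> 589824 * C * (4 * (real n - 1))" by (rule mult_left_mono) (use n3 C in auto)
    finally have "(real n - 1) * (real n - 1) \<le> (2359296 * C) * (real n - 1)" by (simp add: power2_eq_square algebra_simps)
    then have "real n - 1 \<le> 2359296 * C" using n3 by simp
    moreover have "2359296 * C \<le> real n0 - 3" using C by (simp add: n0_def)
    ultimately show False using n by linarith
  qed
qed

section \<open>A Jordan curve with cusps\<close>

text \<open>Up to scaling and translation this is the curve \<open>y\<^sup>2 = (1 - x\<^sup>2) ^ 3\<close>, with cusps at \<open>x = 1\<close> and \<open>x = -1\<close>. There are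
two cusps because a homeomorphism of the sphere may send \<open>Infty\<close> to the tip of one of them; the argument then
works at the other one.\<close>

definition cusp_curve :: "complex \<Rightarrow> real \<Rightarrow> riemann_sphere set" where
  "cusp_curve z0 e = (\<lambda>\<zeta>. Fin (z0 + of_real e * Complex (Re \<zeta>) (Im \<zeta> ^ 3))) ` sphere 0 1"

lemma jordan_curve_cusp_curve:
  assumes "e > 0"
  shows "jordan_curve (cusp_curve z0 e)"
  unfolding jordan_curve_def cusp_curve_def
proof (intro exI conjI)
  have "continuous_on (sphere 0 1) (\<lambda>\<zeta>. z0 + of_real e * Complex (Re \<zeta>) (Im \<zeta> ^ 3))"
    unfolding Complex_eq by (intro continuous_intros)
  then show "continuous_on (sphere 0 1) (\<lambda>\<zeta>. Fin (z0 + of_real e * Complex (Re \<zeta>) (Im \<zeta> ^ 3)))"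
    by (rule continuous_on_compose2[OF continuous_on_Fin[of UNIV]]) auto
  show "inj_on (\<lambda>\<zeta>. Fin (z0 + of_real e * Complex (Re \<zeta>) (Im \<zeta> ^ 3))) (sphere 0 1)"
  proof (rule inj_onI)
    fix x y assume "Fin (z0 + of_real e * Complex (Re x) (Im x ^ 3)) = Fin (z0 + of_real e * Complex (Re y) (Im y ^ 3))"
    then have "Re x = Re y" "Im x ^ 3 = Im y ^ 3" using assms by (auto simp: complex_eq_iff)
    moreover have "Im x = Im y"
    proof -
      have "odd (3::nat)" by simp
      then show ?thesis using odd_real_root_power_cancel \<open>Im x ^ 3 = Im y ^ 3\<close> by metis
    qed
    ultimately show "x = y" by (simp add: complex_eq_iff)
  qed
qed simp

lemma cusp_curveD:
  assumes "Fin w \<in> cusp_curve z0 e" "e > 0"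
  obtains x y where "w = z0 + of_real e * Complex x y" "y\<^sup>2 = (1 - x\<^sup>2) ^ 3" "x\<^sup>2 \<le> 1"
proof -
  obtain \<zeta> where \<zeta>: "cmod \<zeta> = 1" "w = z0 + of_real e * Complex (Re \<zeta>) (Im \<zeta> ^ 3)"
    using assms(1) by (auto simp: cusp_curve_def)
  have 1: "(Re \<zeta>)\<^sup>2 + (Im \<zeta>)\<^sup>2 = 1" using \<zeta>(1) cmod_power2[of \<zeta>] by simp
  then have 2: "(Im \<zeta>)\<^sup>2 = 1 - (Re \<zeta>)\<^sup>2" by simp
  have "(Im \<zeta> ^ 3)\<^sup>2 = ((Im \<zeta>)\<^sup>2) ^ 3" by (simp add: power_mult[symmetric])
  then have "(Im \<zeta> ^ 3)\<^sup>2 = (1 - (Re \<zeta>)\<^sup>2) ^ 3" by (simp only: 2)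
  moreover have "(Re \<zeta>)\<^sup>2 \<le> 1" using 1 zero_le_power2[of "Im \<zeta>"] by linarith
  ultimately show thesis using that \<zeta>(2) by blast
qed

text \<open>The parametrization is the restriction of a Moebius transformation to the real line. For a line \<open>\<kappa>\<close> is
\<open>0\<close>; for a circle with centre \<open>c\<close> the point at infinity goes to the point opposite to \<open>t\<close>.\<close>

lemma round_circle_parametrization:
  assumes "round_circle C" "Fin t \<in> C"
  obtains \<tau> \<kappa> where "\<tau> \<noteq> 0" "\<And>u::real. Fin (t + \<tau> * of_real u / (1 + \<i> * of_real (\<kappa> * u))) \<in> C"
  using assms(1) unfolding round_circle_def
proof (elim disjE exE conjE)
  fix c r assume r: "r > 0" and C: "C = Fin ` sphere c r"
  define \<rho> where "\<rho> = t - c"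
  have t: "cmod \<rho> = r" using assms(2) C by (auto simp: \<rho>_def dist_norm norm_minus_commute)
  show thesis
  proof (rule that[of "- 2 * \<i> * \<rho>" 1])
    show "- 2 * \<i> * \<rho> \<noteq> 0" using t r by auto
    fix u :: real
    have nz: "1 + \<i> * of_real u \<noteq> 0" by (simp add: complex_eq_iff)
    have "t + - 2 * \<i> * \<rho> * of_real u / (1 + \<i> * of_real (1 * u)) - c = \<rho> * ((1 - \<i> * of_real u) / (1 + \<i> * of_real u))"
      using nz by (simp add: \<rho>_def field_simps)
    moreover have "cmod (1 - \<i> * of_real u) = cmod (1 + \<i> * of_real u)" by (simp add: cmod_def)
    then have "cmod ((1 - \<i> * of_real u) / (1 + \<i> * of_real u)) = 1" using nz by (simp add: norm_divide)
    ultimately have "cmod (t + - 2 * \<i> * \<rho> * of_real u / (1 + \<i> * of_real (1 * u)) - c) = r"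
      by (simp only: norm_mult t)
    then show "Fin (t + - 2 * \<i> * \<rho> * of_real u / (1 + \<i> * of_real (1 * u))) \<in> C"
      unfolding C by (intro imageI) (simp add: dist_norm norm_minus_commute)
  qed
next
  fix a d assume d: "d \<noteq> 0" and C: "C = insert Infty (Fin ` range (\<lambda>t::real. a + of_real t * d))"
  obtain t0 :: real where t0: "t = a + of_real t0 * d" using assms(2) C by auto
  show thesis
  proof (rule that[of d 0])
    fix u :: real
    have "t + d * of_real u / (1 + \<i> * of_real (0 * u)) = a + of_real (t0 + u) * d" by (simp add: t0 algebra_simps)
    then show "Fin (t + d * of_real u / (1 + \<i> * of_real (0 * u))) \<in> C" unfolding C by blast
  qed (rule d)
qed

lemma square_norm_triangle: "square_norm (x + y) \<le> square_norm x + square_norm y"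
proof -
  have "\<bar>Re (x + y)\<bar> \<le> square_norm x + square_norm y"
    unfolding square_norm_def plus_complex.simps by (rule order_trans[OF abs_triangle_ineq add_mono]) auto
  moreover have "\<bar>Im (x + y)\<bar> \<le> square_norm x + square_norm y"
    unfolding square_norm_def plus_complex.simps by (rule order_trans[OF abs_triangle_ineq add_mono]) auto
  ultimately show ?thesis by (simp only: square_norm_def[of "x + y"] max.bounded_iff)
qed

lemma square_norm_minus: "square_norm (x - y) = square_norm (y - x)"
  by (simp add: square_norm_def abs_minus_commute)

lemma square_norm_le_cmod: "square_norm z \<le> cmod z"
  by (simp add: square_norm_def abs_Re_le_cmod abs_Im_le_cmod)

lemma cmod_le_square_norm: "cmod z \<le> 2 * square_norm z"
  using cmod_le[of z] by (auto simp: square_norm_def max_def)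

lemma square_norm_of_real_mult: "square_norm (z * of_real u) = square_norm z * \<bar>u\<bar>"
  by (simp add: square_norm_def abs_mult max_mult_distrib_right)

lemma square_norm_nonneg: "0 \<le> square_norm z" by (simp add: square_norm_def)

lemma square_norm_eq_0: "square_norm z = 0 \<longleftrightarrow> z = 0"
  by (auto simp: square_norm_def max_def complex_eq_iff split: if_splits)

lemma connected_meets_frame:
  assumes E: "connected E" and a: "Fin z1 \<in> E" "square_norm (z1 - c) < s"
    and b: "x2 \<in> E" "x2 \<notin> Fin ` {z. square_norm (z - c) \<le> s}"
  shows "\<exists>z. square_norm (z - c) = s \<and> Fin z \<in> E"
proof (rule ccontr)
  assume no: "\<not> ?thesis"
  let ?A = "Fin ` {z. square_norm (z - c) < s}" and ?B = "- Fin ` {z. square_norm (z - c) \<le> s}"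
  have cs: "continuous_on UNIV (\<lambda>z. square_norm (z - c))" unfolding square_norm_def by (intro continuous_intros)
  have "?A = {x \<in> range Fin. coord x \<in> {z. square_norm (z - c) < s}}" by force
  moreover have o: "open {z. square_norm (z - c) < s}" by (intro open_Collect_less cs continuous_intros)
  ultimately have oA: "open ?A"
    using continuous_open_preimage[OF continuous_on_coord open_range_Fin o] by (simp add: Int_def vimage_def)
  have Q: "{z. square_norm (z - c) \<le> s} = cbox (c - Complex s s) (c + Complex s s)"
    by (auto simp: square_norm_def in_cbox_complex_iff abs_le_iff)
  have "compact (Fin ` {z. square_norm (z - c) \<le> s})"
    unfolding Q by (rule compact_continuous_image[OF continuous_on_Fin compact_cbox])
  then have oB: "open ?B" by (simp add: compact_imp_closed open_Compl)
  have "E \<subseteq> ?A \<union> ?B"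
  proof
    fix x assume x: "x \<in> E"
    have "\<not> (\<exists>z. x = Fin z \<and> square_norm (z - c) = s)" using no x by blast
    then show "x \<in> ?A \<union> ?B" by (auto simp: less_le)
  qed
  moreover have "?A \<inter> ?B \<inter> E = {}" by auto
  moreover have "?A \<inter> E \<noteq> {}" "?B \<inter> E \<noteq> {}" using a b by auto
  ultimately show False using E oA oB unfolding connected_def by blast
qed

text \<open>The preimage of the inner disc is connected and contains \<open>c\<close> and \<open>q\<close>; the preimage of the (finite part of the)
exterior is connected and contains \<open>t\<close> and \<open>x2\<close>. Every frame about \<open>c\<close> with radius in the interval in question separates
\<open>c\<close> from \<open>q\<close> and \<open>t\<close> from \<open>x2\<close>, so it meets both.\<close>

lemma ring_obstruction:
  assumes hk: "homeomorphism UNIV UNIV h k"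
    and ring: "\<And>p r c s. 0 < r \<Longrightarrow> 0 < s \<Longrightarrow>
      \<exists>s'. s < s' \<and> s' < 3 / 2 * s \<and> \<not> (\<exists>z w. square_norm (z - c) = s' \<and> square_norm (w - c) = s' \<and>
        h (Fin z) \<in> Fin ` cball p r \<and> h (Fin w) \<notin> Fin ` ball p (2 ^ n * r))"
    and pts: "h (Fin c) = Fin P" "h (Fin q) = Fin Q" "h (Fin t) = Fin T" "h x2 = Fin T2"
    and PQ: "P \<noteq> Q" "2 ^ n * cmod (P - Q) \<le> cmod (T - P)" "2 ^ n * cmod (P - Q) \<le> cmod (T2 - P)"
    and far: "c \<noteq> t" "3 / 2 * square_norm (t - c) \<le> square_norm (q - c)"
      "\<And>z. x2 = Fin z \<Longrightarrow> 3 / 2 * square_norm (t - c) \<le> square_norm (z - c)"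
  shows False
proof -
  define s where "s = square_norm (t - c)"
  define r where "r = cmod (P - Q)"
  have r: "r > 0" using PQ by (simp add: r_def)
  have s: "s > 0" using far(1) square_norm_nonneg[of "t - c"] square_norm_eq_0[of "t - c"] by (simp add: s_def less_le)
  have hkx: "h (k x) = x" "k (h x) = x" for x using hk by (auto simp: homeomorphism_def)
  have ck: "continuous_on UNIV k" using hk by (auto simp: homeomorphism_def)
  obtain s' where s': "s < s'" "s' < 3 / 2 * s" and no: "\<not> (\<exists>z w. square_norm (z - c) = s' \<and> square_norm (w - c) = s' \<and>
        h (Fin z) \<in> Fin ` cball P r \<and> h (Fin w) \<notin> Fin ` ball P (2 ^ n * r))"
    using ring[OF r s, of c P] by blast
  have conn: "connected (k ` Fin ` S)" if "connected S" for S
    using connected_continuous_image[OF continuous_on_subset[OF ck] connected_continuous_image[OF continuous_on_Fin that]] by simp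
  have "\<exists>z. square_norm (z - c) = s' \<and> Fin z \<in> k ` Fin ` cball P r"
  proof (rule connected_meets_frame)
    show "connected (k ` Fin ` cball P r)" by (rule conn) simp
    have "Fin P \<in> Fin ` cball P r" using r by simp
    then show "Fin c \<in> k ` Fin ` cball P r" using hkx(2)[of "Fin c"] pts(1) by force
    show "square_norm (c - c) < s'" using s s' by (simp add: square_norm_def)
    have "Fin Q \<in> Fin ` cball P r" by (simp add: r_def dist_norm)
    then show "Fin q \<in> k ` Fin ` cball P r" using hkx(2)[of "Fin q"] pts(2) by force
    show "Fin q \<notin> Fin ` {z. square_norm (z - c) \<le> s'}" using far(2) s' by (auto simp: s_def)
  qed
  then obtain z where z: "square_norm (z - c) = s'" "h (Fin z) \<in> Fin ` cball P r" using hkx(1) by auto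
  have "\<exists>z. square_norm (z - c) = s' \<and> Fin z \<in> k ` Fin ` (- ball P (2 ^ n * r))"
  proof (rule connected_meets_frame)
    show "connected (k ` Fin ` (- ball P (2 ^ n * r)))"
      by (rule conn, rule connected_complement_bounded_convex) auto
    have "T \<in> - ball P (2 ^ n * r)" using PQ(2) by (simp add: r_def dist_norm norm_minus_commute)
    then have "Fin T \<in> Fin ` (- ball P (2 ^ n * r))" by blast
    then show "Fin t \<in> k ` Fin ` (- ball P (2 ^ n * r))" using hkx(2)[of "Fin t"] pts(3) by force
    show "square_norm (t - c) < s'" using s' by (simp add: s_def)
    have "T2 \<in> - ball P (2 ^ n * r)" using PQ(3) by (simp add: r_def dist_norm norm_minus_commute)
    then have "Fin T2 \<in> Fin ` (- ball P (2 ^ n * r))" by blast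
    then show "x2 \<in> k ` Fin ` (- ball P (2 ^ n * r))" using hkx(2)[of x2] pts(4) by force
    show "x2 \<notin> Fin ` {z. square_norm (z - c) \<le> s'}" using far(3) s' by (force simp: s_def)
  qed
  then obtain w where w: "square_norm (w - c) = s'" "h (Fin w) \<in> Fin ` (- ball P (2 ^ n * r))" using hkx(1) by auto
  then have "h (Fin w) \<notin> Fin ` ball P (2 ^ n * r)" by auto
  then show False using no z w(1) by blast
qed

text \<open>Here \<open>v\<close> is the difference of the abscissae of the pair and of the tip, in units of \<open>e\<close>. The two points have distance at most
\<open>e * sqrt (32 * v ^ 3)\<close>, while their distance from the tip is at least \<open>e * v\<close>.\<close>

lemma cusp_curve_pair:
  assumes e: "e > 0" and \<sigma>: "\<sigma> = 1 \<or> \<sigma> = (-1::real)"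
    and pq: "Fin p \<in> cusp_curve z0 e" "Fin q \<in> cusp_curve z0 e"
    and v: "\<sigma> * Re (p - z0) = e * (1 - v)" "\<sigma> * Re (q - z0) = e * (1 - v)" and v0: "0 < v" "v \<le> 1 / (32 * 4 ^ n)"
  shows "2 ^ n * cmod (p - q) \<le> cmod (z0 + of_real (e * \<sigma>) - p)" "2 ^ n * cmod (p - q) \<le> cmod (z0 - of_real (e * \<sigma>) - p)"
proof -
  obtain x y where p: "p = z0 + of_real e * Complex x y" "y\<^sup>2 = (1 - x\<^sup>2) ^ 3" "x\<^sup>2 \<le> 1"
    by (rule cusp_curveD[OF pq(1) e])
  obtain x' y' where q: "q = z0 + of_real e * Complex x' y'" "y'\<^sup>2 = (1 - x'\<^sup>2) ^ 3" "x'\<^sup>2 \<le> 1"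
    by (rule cusp_curveD[OF pq(2) e])
  have ss: "\<sigma> * \<sigma> = 1" using \<sigma> by auto
  have "\<sigma> * x = 1 - v" "\<sigma> * x' = 1 - v" using v e p(1) q(1) by auto
  then have x: "x = \<sigma> * (1 - v)" "x' = \<sigma> * (1 - v)" using \<sigma> by auto
  have v1: "v \<le> 1"
  proof -
    have "1 \<le> 32 * (4::real) ^ n" using one_le_power[of "4::real" n] by linarith
    then have "1 / (32 * 4 ^ n) \<le> (1::real)" by (simp add: divide_le_eq)
    then show ?thesis using v0(2) by linarith
  qed
  have "1 - x\<^sup>2 = v * (2 - v)" using ss by (simp add: x power2_eq_square algebra_simps) (metis (no_types, opaque_lifting) \<open>\<sigma> * \<sigma> = 1\<close> mult.assoc mult.commute mult.right_neutral add.commute)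
  then have xv: "1 - x\<^sup>2 = v * (2 - v)" .
  have le: "(1 - x\<^sup>2) ^ 3 \<le> (2 * v) ^ 3"
    unfolding xv by (rule power_mono) (use v0 v1 in \<open>auto simp: mult_left_le algebra_simps\<close>)
  have pqd: "cmod (p - q) = e * \<bar>y - y'\<bar>"
  proof -
    have "p - q = of_real e * (\<i> * of_real (y - y'))" using x by (simp add: p(1) q(1) complex_eq_iff algebra_simps)
    then show ?thesis using e by (simp only: norm_mult norm_ii norm_of_real)
  qed
  have "(y - y')\<^sup>2 \<le> 2 * y\<^sup>2 + 2 * y'\<^sup>2" using zero_le_power2[of "y + y'"] by (simp add: power2_eq_square algebra_simps)
  also have "\<dots> \<le> 4 * (2 * v) ^ 3" using le x by (simp add: p(2) q(2))
  finally have y: "(y - y')\<^sup>2 \<le> 32 * v ^ 3" by (simp add: power_mult_distrib)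
  have "(2 ^ n * \<bar>y - y'\<bar>)\<^sup>2 = 4 ^ n * (y - y')\<^sup>2"
  proof -
    have "((2::real) ^ n)\<^sup>2 = 4 ^ n" by (simp add: power2_eq_square flip: power_mult_distrib)
    then show ?thesis by (simp only: power_mult_distrib power2_abs)
  qed
  also have "\<dots> \<le> 4 ^ n * (32 * v ^ 3)" using y by (intro mult_left_mono) auto
  also have "\<dots> = (32 * 4 ^ n * v) * v\<^sup>2" by (simp add: power2_eq_square power3_eq_cube)
  also have "\<dots> \<le> 1 * v\<^sup>2" using v0 by (intro mult_right_mono) (auto simp: field_simps)
  finally have "2 ^ n * \<bar>y - y'\<bar> \<le> v" using v0 by (simp add: power2_le_iff_abs_le)
  then have small: "2 ^ n * cmod (p - q) \<le> e * v"
    using e mult_left_mono[of "2 ^ n * \<bar>y - y'\<bar>" v e] unfolding pqd by (simp add: algebra_simps)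
  have "Re (z0 + of_real (e * \<sigma>) - p) = \<sigma> * (e * v)" by (simp add: p(1) x(1) algebra_simps)
  then have "e * v \<le> cmod (z0 + of_real (e * \<sigma>) - p)"
    using abs_Re_le_cmod[of "z0 + of_real (e * \<sigma>) - p"] \<sigma> e v0 by (auto simp: abs_mult)
  then show "2 ^ n * cmod (p - q) \<le> cmod (z0 + of_real (e * \<sigma>) - p)" using small by simp
  have "Re (z0 - of_real (e * \<sigma>) - p) = - \<sigma> * (e * (2 - v))" by (simp add: p(1) x(1) algebra_simps)
  then have "e * (2 - v) \<le> cmod (z0 - of_real (e * \<sigma>) - p)"
    using abs_Re_le_cmod[of "z0 - of_real (e * \<sigma>) - p"] \<sigma> e v0 v1 by (auto simp: abs_mult)
  moreover have "e * v \<le> e * (2 - v)" using e v1 by simp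
  ultimately show "2 ^ n * cmod (p - q) \<le> cmod (z0 - of_real (e * \<sigma>) - p)" using small by simp
qed

text \<open>Close to \<open>0\<close> the curve \<open>\<eta>\<close> is linear up to a relative error of \<open>1 / 20\<close>. For a linear curve and parameters of
opposite signs the last estimate would hold with the factor \<open>2\<close>; the error reduces it to \<open>3 / 2\<close>.\<close>

lemma opposite_sides_distance:
  fixes \<tau> :: complex and \<kappa> :: real
  defines "\<eta> \<equiv> \<lambda>u::real. \<tau> * of_real u / (1 + \<i> * of_real (\<kappa> * u))"
  assumes u: "0 \<le> u" "u \<le> u0" "u' \<le> 0" "- u' \<le> u0" and u0: "\<bar>\<kappa>\<bar> * u0 \<le> 1 / 40"
  shows "square_norm (\<eta> u) \<le> 2 * square_norm \<tau> * u0" "square_norm (\<eta> u') \<le> 2 * square_norm \<tau> * u0"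
    "3 / 2 * min (square_norm (\<eta> u)) (square_norm (\<eta> u')) \<le> square_norm (\<eta> u - \<eta> u')"
proof -
  let ?N = square_norm
  have approx: "?N (\<eta> v - \<tau> * of_real v) \<le> ?N \<tau> * \<bar>v\<bar> / 20" if v: "\<bar>v\<bar> \<le> u0" for v
  proof -
    let ?d = "1 + \<i> * of_real (\<kappa> * v)"
    have d: "cmod ?d \<ge> 1" using abs_Re_le_cmod[of ?d] by simp
    then have nz: "?d \<noteq> 0" by auto
    have "\<eta> v - \<tau> * of_real v = - (\<tau> * of_real v * (\<i> * of_real (\<kappa> * v))) / ?d"
      using nz by (simp add: \<eta>_def field_simps)
    then have "cmod (\<eta> v - \<tau> * of_real v) = cmod \<tau> * \<bar>v\<bar> * (\<bar>\<kappa>\<bar> * \<bar>v\<bar>) / cmod ?d"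
      by (simp add: norm_mult norm_divide abs_mult)
    also have "\<dots> \<le> cmod \<tau> * \<bar>v\<bar> * (\<bar>\<kappa>\<bar> * \<bar>v\<bar>) / 1"
      using d by (intro divide_left_mono) auto
    also have "\<dots> \<le> cmod \<tau> * \<bar>v\<bar> * (1 / 40)"
      unfolding div_by_1 by (intro mult_left_mono order_trans[OF mult_left_mono[OF v] u0]) auto
    also have "\<dots> \<le> 2 * ?N \<tau> * \<bar>v\<bar> * (1 / 40)"
      using cmod_le_square_norm[of \<tau>] by (intro mult_right_mono) auto
    also have "\<dots> = ?N \<tau> * \<bar>v\<bar> / 20" by simp
    finally show ?thesis by (rule order_trans[OF square_norm_le_cmod])
  qed
  have Nu: "?N (\<tau> * of_real v) = ?N \<tau> * \<bar>v\<bar>" for v by (rule square_norm_of_real_mult)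
  define A where "A = ?N \<tau> * u"
  define B where "B = ?N \<tau> * (- u')"
  define M where "M = ?N \<tau> * u0"
  have A: "?N (\<tau> * of_real u) = A" "0 \<le> A" "A \<le> M"
    using Nu[of u] u(1,2) square_norm_nonneg[of \<tau>] by (auto simp: A_def M_def intro: mult_left_mono)
  have B: "?N (\<tau> * of_real u') = B" "0 \<le> B" "B \<le> M"
  proof -
    show "?N (\<tau> * of_real u') = B" using Nu[of u'] u(3) by (simp add: B_def)
    show "0 \<le> B" unfolding B_def by (rule mult_nonneg_nonneg) (use u(3) square_norm_nonneg in auto)
    show "B \<le> M" unfolding B_def M_def by (rule mult_left_mono[OF u(4) square_norm_nonneg])
  qed
  have a: "?N (\<eta> u - \<tau> * of_real u) \<le> A / 20" using approx[of u] u(1,2) by (simp add: A_def)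
  have b: "?N (\<eta> u' - \<tau> * of_real u') \<le> B / 20" using approx[of u'] u(3,4) by (simp add: B_def)
  have a1: "?N (\<eta> u) \<le> A + A / 20"
    using square_norm_triangle[of "\<tau> * of_real u" "\<eta> u - \<tau> * of_real u"] a A(1) by simp
  have b1: "?N (\<eta> u') \<le> B + B / 20"
    using square_norm_triangle[of "\<tau> * of_real u'" "\<eta> u' - \<tau> * of_real u'"] b B(1) by simp
  show "?N (\<eta> u) \<le> 2 * ?N \<tau> * u0" using a1 A unfolding mult.assoc M_def[symmetric] by linarith
  show "?N (\<eta> u') \<le> 2 * ?N \<tau> * u0" using b1 B unfolding mult.assoc M_def[symmetric] by linarith
  have "?N (\<tau> * of_real (u - u')) \<le> ?N (\<eta> u - \<eta> u') + (?N (\<eta> u - \<tau> * of_real u) + ?N (\<eta> u' - \<tau> * of_real u'))"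
  proof -
    have "\<tau> * of_real (u - u') = (\<eta> u - \<eta> u') + ((\<tau> * of_real u - \<eta> u) + (\<eta> u' - \<tau> * of_real u'))" by (simp add: algebra_simps)
    from arg_cong[OF this, of square_norm] show ?thesis
      using square_norm_triangle[of "\<eta> u - \<eta> u'" "(\<tau> * of_real u - \<eta> u) + (\<eta> u' - \<tau> * of_real u')"]
        square_norm_triangle[of "\<tau> * of_real u - \<eta> u" "\<eta> u' - \<tau> * of_real u'"] square_norm_minus[of "\<eta> u" "\<tau> * of_real u"] by linarith
  qed
  moreover have "?N (\<tau> * of_real (u - u')) = A + B"
    using Nu[of "u - u'"] u(1,3) by (simp add: A_def B_def algebra_simps)
  ultimately have "A + B - A / 20 - B / 20 \<le> ?N (\<eta> u - \<eta> u')"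
    using a b by linarith
  moreover have "2 * min (?N (\<eta> u)) (?N (\<eta> u')) \<le> ?N (\<eta> u) + ?N (\<eta> u')" by simp
  ultimately show "3 / 2 * min (?N (\<eta> u)) (?N (\<eta> u')) \<le> ?N (\<eta> u - \<eta> u')"
    using a1 b1 A(2) B(2) by linarith
qed

text \<open>Parametrize the circle by \<open>\<eta>\<close>, starting at the preimage \<open>t\<close> of a tip, and follow the abscissa along the image. It
is extremal only at the tip, so by the intermediate value theorem some abscissa close to that of the tip is
attained at parameters of both signs. This gives two points of the curve with equal
abscissae and with preimages on opposite sides of \<open>t\<close>.\<close>

lemma cusp_curve_not_quasicircle:
  assumes e: "e > 0"
  shows "\<not> quasicircle K (cusp_curve z0 e)"
proof
  assume "quasicircle K (cusp_curve z0 e)"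
  then obtain h C where qc: "quasiconformal K UNIV UNIV h" and C: "round_circle C" and J: "cusp_curve z0 e = h ` C"
    by (auto simp: quasicircle_def)
  obtain k where hk: "homeomorphism UNIV UNIV h k" using qc by (auto simp: quasiconformal_def)
  have hkx: "h (k x) = x" "k (h x) = x" for x using hk by (auto simp: homeomorphism_def)
  have ch: "continuous_on UNIV h" using hk by (auto simp: homeomorphism_def)
  have injh: "h x = h y \<Longrightarrow> x = y" for x y using hkx(2) by metis
  obtain n :: nat where n: "\<And>p r c s. 0 < r \<Longrightarrow> 0 < s \<Longrightarrow>
    \<exists>s'. s < s' \<and> s' < 3 / 2 * s \<and> \<not> (\<exists>z w. square_norm (z - c) = s' \<and> square_norm (w - c) = s' \<and>
      h (Fin z) \<in> Fin ` cball p r \<and> h (Fin w) \<notin> Fin ` ball p (2 ^ n * r))"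
    by (rule quasiconformal_ring_bound[OF qc]) (rule that, blast)
  have tips: "Fin (z0 + of_real (e * \<sigma>)) \<in> cusp_curve z0 e" if "\<sigma> = 1 \<or> \<sigma> = (-1::real)" for \<sigma>
    unfolding cusp_curve_def
    by (rule image_eqI[where x = "of_real \<sigma>"]) (use that in \<open>auto simp: complex_eq_iff\<close>)
  obtain \<sigma> :: real and t where \<sigma>: "\<sigma> = 1 \<or> \<sigma> = (-1::real)" and t: "h (Fin t) = Fin (z0 + of_real (e * \<sigma>))"
  proof -
    have "z0 + of_real (e * 1) \<noteq> z0 + of_real (e * (-1))" using e by simp
    then have "k (Fin (z0 + of_real (e * 1))) \<noteq> k (Fin (z0 + of_real (e * (-1))))" using hkx(1) riemann_sphere.inject by metis
    then consider t where "k (Fin (z0 + of_real (e * 1))) = Fin t" | t where "k (Fin (z0 + of_real (e * (-1)))) = Fin t"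
      by (metis riemann_sphere.exhaust)
    then show thesis
    proof cases
      case 1
      then show thesis using that[of 1] hkx(1) by metis
    next
      case 2
      then show thesis using that[of "-1"] hkx(1) by metis
    qed
  qed
  have "Fin t \<in> C" using tips[OF \<sigma>] J t injh by (metis imageE)
  then obtain \<tau> \<kappa> where \<tau>: "\<tau> \<noteq> 0" and par: "\<And>u::real. Fin (t + \<tau> * of_real u / (1 + \<i> * of_real (\<kappa> * u))) \<in> C"
    by (rule round_circle_parametrization[OF C]) (rule that; assumption)
  define \<eta> where "\<eta> u = \<tau> * of_real u / (1 + \<i> * of_real (\<kappa> * u))" for u :: real
  have nz: "1 + \<i> * of_real (\<kappa> * u) \<noteq> 0" for u by (simp add: complex_eq_iff)
  have inj\<eta>: "u = v" if "\<eta> u = \<eta> v" for u v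
  proof -
    have "of_real u * (1 + \<i> * of_real (\<kappa> * v)) = (of_real v * (1 + \<i> * of_real (\<kappa> * u)) :: complex)"
      using that \<tau> nz[of u] nz[of v] by (simp add: \<eta>_def frac_eq_eq mult.assoc)
    then show ?thesis by (simp add: complex_eq_iff)
  qed
  have \<eta>0: "\<eta> 0 = 0" by (simp add: \<eta>_def)
  have c\<eta>: "continuous_on UNIV (\<lambda>u. t + \<eta> u)"
    unfolding \<eta>_def by (intro continuous_intros ballI nz)
  define W where "W u = coord (h (Fin (t + \<eta> u)))" for u
  have inJ: "h (Fin (t + \<eta> u)) \<in> cusp_curve z0 e" for u using par J by (auto simp: \<eta>_def)
  have W: "h (Fin (t + \<eta> u)) = Fin (W u)" for u using inJ[of u] by (auto simp: W_def cusp_curve_def)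
  have WJ: "Fin (W u) \<in> cusp_curve z0 e" for u using inJ[of u] W by simp
  have injW: "u = v" if "W u = W v" for u v
    using injh[of "Fin (t + \<eta> u)" "Fin (t + \<eta> v)"] W that inj\<eta> by simp
  have W0: "W 0 = z0 + of_real (e * \<sigma>)" using W[of 0] t by (simp add: \<eta>0)
  have cW: "continuous_on UNIV W"
  proof -
    have "continuous_on UNIV (\<lambda>u. h (Fin (t + \<eta> u)))"
      by (rule continuous_on_compose2[OF ch continuous_on_compose2[OF continuous_on_Fin[of UNIV] c\<eta>]]) auto
    then show ?thesis unfolding W_def
      by (rule continuous_on_compose2[OF continuous_on_coord]) (use W in auto)
  qed
  \<comment> \<open>The difference of abscissae between the tip and the image point, in units of \<open>e\<close>.\<close>
  define X where "X u = 1 - \<sigma> * Re (W u - z0) / e" for u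
  have cX: "continuous_on S X" for S
    unfolding X_def using e by (intro continuous_intros continuous_on_subset[OF cW]) auto
  have X0: "X 0 = 0" using \<sigma> e by (auto simp: X_def W0)
  have Xpos: "X u > 0" if "u \<noteq> 0" for u
  proof -
    obtain x y where xy: "W u = z0 + of_real e * Complex x y" "y\<^sup>2 = (1 - x\<^sup>2) ^ 3" "x\<^sup>2 \<le> 1"
      by (rule cusp_curveD[OF WJ e])
    have Xu: "X u = 1 - \<sigma> * x" using e by (simp add: X_def xy(1))
    have "\<bar>x\<bar> \<le> 1" using xy(3) by (simp add: abs_square_le_1)
    then have "X u \<ge> 0" using \<sigma> Xu by auto
    moreover have "X u \<noteq> 0"
    proof
      assume "X u = 0"
      then have "x = \<sigma>" using Xu \<sigma> by auto
      then have "y = 0" using xy(2) \<sigma> by auto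
      then have "W u = W 0" using xy(1) \<open>x = \<sigma>\<close> W0 by (simp add: complex_eq_iff)
      then show False using injW that by blast
    qed
    ultimately show ?thesis by simp
  qed
  define x2 where "x2 = k (Fin (z0 - of_real (e * \<sigma>)))"
  have x2: "h x2 = Fin (z0 - of_real (e * \<sigma>))" using hkx(1) by (simp add: x2_def)
  \<comment> \<open>The preimage \<open>x2\<close> of the other tip has to stay outside of the frames; \<open>Infty\<close> is outside anyway.\<close>
  define d where "d = (case x2 of Fin z \<Rightarrow> square_norm (z - t) | Infty \<Rightarrow> 1)"
  have d: "d > 0"
  proof (cases x2)
    case (Fin z)
    have "z \<noteq> t"
    proof
      assume "z = t"
      then have "z0 - of_real (e * \<sigma>) = z0 + of_real (e * \<sigma>)" using x2 t Fin by simp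
      then show False using e \<sigma> by (auto simp: complex_eq_iff)
    qed
    then show ?thesis using square_norm_nonneg[of "z - t"] square_norm_eq_0[of "z - t"] Fin by (simp add: d_def less_le)
  qed (simp add: d_def)
  define N\<tau> where "N\<tau> = square_norm \<tau>"
  have N\<tau>: "N\<tau> > 0" using \<tau> square_norm_nonneg[of \<tau>] square_norm_eq_0[of \<tau>] by (simp add: N\<tau>_def less_le)
  define u0 where "u0 = min (1 / (40 * (\<bar>\<kappa>\<bar> + 1))) (d / (5 * N\<tau>))"
  have u0: "u0 > 0" using d N\<tau> by (auto simp: u0_def add_nonneg_pos)
  have "\<bar>\<kappa>\<bar> * u0 \<le> \<bar>\<kappa>\<bar> * (1 / (40 * (\<bar>\<kappa>\<bar> + 1)))" by (rule mult_left_mono) (auto simp: u0_def)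
  also have "\<dots> \<le> 1 / 40" by (simp add: divide_simps)
  finally have \<kappa>u0: "\<bar>\<kappa>\<bar> * u0 \<le> 1 / 40" .
  have du0: "5 * N\<tau> * u0 \<le> d"
  proof -
    have "5 * N\<tau> * u0 \<le> 5 * N\<tau> * (d / (5 * N\<tau>))" by (rule mult_left_mono) (use N\<tau> in \<open>auto simp: u0_def\<close>)
    then show ?thesis using N\<tau> by simp
  qed
  define v where "v = min (1 / (32 * 4 ^ n)) (min (X u0) (X (- u0)))"
  have v: "0 < v" "v \<le> 1 / (32 * 4 ^ n)" "v \<le> X u0" "v \<le> X (- u0)"
    using Xpos[of u0] Xpos[of "- u0"] u0 by (auto simp: v_def)
  obtain u where u: "0 \<le> u" "u \<le> u0" "X u = v"
    using IVT'[of X 0 v u0] X0 v u0 cX by auto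
  obtain u' where u': "- u0 \<le> u'" "u' \<le> 0" "X u' = v"
    using IVT2'[of X 0 v "- u0"] X0 v u0 cX by auto
  have une: "u \<noteq> 0" "u' \<noteq> 0" using u(3) u'(3) X0 v(1) by auto
  have "u \<noteq> u'" using u u' une by auto
  then have Wne: "W u \<noteq> W u'" using injW by blast
  have Re: "\<sigma> * Re (W u - z0) = e * (1 - v)" "\<sigma> * Re (W u' - z0) = e * (1 - v)"
    using u(3) u'(3) e by (auto simp: X_def field_simps)
  note dist = opposite_sides_distance[of u u0 u' \<kappa> \<tau>, folded \<eta>_def, OF u(1,2) u'(2) _ \<kappa>u0]
  have u'': "- u' \<le> u0" using u'(1) by simp
  have st: "square_norm (t - (t + \<eta> w)) = square_norm (\<eta> w)" for w
    by (simp add: square_norm_def)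
  have obstruct: False
    if ab: "square_norm (\<eta> a) \<le> 2 * square_norm \<tau> * u0" "3 / 2 * square_norm (\<eta> a) \<le> square_norm (\<eta> b - \<eta> a)" "a \<noteq> 0"
      "W a \<noteq> W b" "\<sigma> * Re (W a - z0) = e * (1 - v)" "\<sigma> * Re (W b - z0) = e * (1 - v)" for a b
  proof (rule ring_obstruction[OF hk n, of "t + \<eta> a" "W a" "t + \<eta> b" "W b" t "z0 + of_real (e * \<sigma>)" x2 "z0 - of_real (e * \<sigma>)"])
    show "2 ^ n * cmod (W a - W b) \<le> cmod (z0 + of_real (e * \<sigma>) - W a)" "2 ^ n * cmod (W a - W b) \<le> cmod (z0 - of_real (e * \<sigma>) - W a)"
      by (rule cusp_curve_pair[OF e \<sigma> WJ WJ ab(5,6) v(1,2)])+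
    show "t + \<eta> a \<noteq> t" using inj\<eta>[of a 0] ab(3) \<eta>0 by auto
    show "3 / 2 * square_norm (t - (t + \<eta> a)) \<le> square_norm (t + \<eta> b - (t + \<eta> a))"
      using ab(2) unfolding st by simp
    show "3 / 2 * square_norm (t - (t + \<eta> a)) \<le> square_norm (z - (t + \<eta> a))" if z: "x2 = Fin z" for z
    proof -
      have "d \<le> square_norm (z - (t + \<eta> a)) + square_norm (\<eta> a)"
        using square_norm_triangle[of "z - (t + \<eta> a)" "\<eta> a"] z by (simp add: d_def)
      then show ?thesis using ab(1) du0 unfolding st by (simp add: N\<tau>_def)
    qed
  qed (use W t x2 ab(4) in auto)
  \<comment> \<open>The frames are centred at the preimage nearer to \<open>t\<close>.\<close>
  show False
  proof (cases "square_norm (\<eta> u) \<le> square_norm (\<eta> u')")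
    case True
    show False
      by (rule obstruct[of u u']) (use dist[OF u''] True une Wne Re square_norm_minus[of "\<eta> u" "\<eta> u'"] in auto)
  next
    case False
    show False
      by (rule obstruct[of u' u]) (use dist[OF u''] False une Wne Re in auto)
  qed
qed

section \<open>Moebius transformations in homogeneous coordinates\<close>

text \<open>Homogeneous coordinates turn the case distinctions in the definition of a Moebius transformation and of the
chordal metric into linear algebra.\<close>

definition sphere_vec :: "riemann_sphere \<Rightarrow> complex \<times> complex" where
  "sphere_vec x = (case x of Fin z \<Rightarrow> (z, 1) | Infty \<Rightarrow> (1, 0))"

definition mat_vec :: "complex^2^2 \<Rightarrow> complex \<times> complex \<Rightarrow> complex \<times> complex" where
  "mat_vec A v = (A$1$1 * fst v + A$1$2 * snd v, A$2$1 * fst v + A$2$2 * snd v)"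

definition vec_det :: "complex \<times> complex \<Rightarrow> complex \<times> complex \<Rightarrow> complex" where
  "vec_det v w = fst v * snd w - snd v * fst w"

definition vec_class :: "complex \<times> complex \<Rightarrow> riemann_sphere" where
  "vec_class v = (if snd v = 0 then Infty else Fin (fst v / snd v))"

lemma sphere_vec_nonzero: "sphere_vec x \<noteq> 0"
  by (cases x) (auto simp: sphere_vec_def zero_prod_def)

lemma vec_class_sphere_vec [simp]: "vec_class (sphere_vec x) = x"
  by (cases x) (auto simp: sphere_vec_def vec_class_def)

lemma sphere_vec_class:
  assumes "v \<noteq> 0"
  obtains c where "c \<noteq> 0" "v = (c * fst (sphere_vec (vec_class v)), c * snd (sphere_vec (vec_class v)))"
proof (cases "snd v = 0")
  case True
  then show thesis using that[of "fst v"] assms by (cases v) (auto simp: vec_class_def sphere_vec_def zero_prod_def)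
next
  case False
  then show thesis using that[of "snd v"] by (cases v) (auto simp: vec_class_def sphere_vec_def)
qed

lemma dist_sphere_vec: "dist x y = 2 * cmod (vec_det (sphere_vec x) (sphere_vec y)) / (norm (sphere_vec x) * norm (sphere_vec y))"
proof -
  have fin: "dist (Fin z) (Fin w) = 2 * cmod (z - w) / (sqrt (1 + (cmod z)\<^sup>2) * sqrt (1 + (cmod w)\<^sup>2))" for z w
  proof -
    let ?a = "1 + (cmod z)\<^sup>2" and ?b = "1 + (cmod w)\<^sup>2"
    have ab: "?a > 0" "?b > 0" by (simp_all add: add_pos_nonneg)
    have nz: "complex_of_real ?a \<noteq> 0" "complex_of_real ?b \<noteq> 0" using ab by (simp_all only: of_real_eq_0_iff)
    have 1: "2 * z / of_real ?a - 2 * w / of_real ?b = 2 * (z * of_real ?b - w * of_real ?a) / of_real (?a * ?b)"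
    proof -
      have "2 * z / a - 2 * w / b = 2 * (z * b - w * a) / (a * b)" if "a \<noteq> 0" "b \<noteq> 0" for a b :: complex
        using that by (simp add: field_simps)
      from this[OF nz] show ?thesis by (simp only: of_real_mult)
    qed
    have 2: "((cmod z)\<^sup>2 - 1) / ((cmod z)\<^sup>2 + 1) - ((cmod w)\<^sup>2 - 1) / ((cmod w)\<^sup>2 + 1) = 2 * (?a - ?b) / (?a * ?b)"
      using ab by (simp add: field_simps)
    have "(dist (Fin z) (Fin w))\<^sup>2 = (cmod (2 * z / of_real ?a - 2 * w / of_real ?b))\<^sup>2
       + (((cmod z)\<^sup>2 - 1) / ((cmod z)\<^sup>2 + 1) - ((cmod w)\<^sup>2 - 1) / ((cmod w)\<^sup>2 + 1))\<^sup>2"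
      by (simp add: dist_riemann_sphere_def dist_prod_def dist_norm power2_abs)
    also have "\<dots> = (4 * (cmod (z * of_real ?b - w * of_real ?a))\<^sup>2 + 4 * (?a - ?b)\<^sup>2) / (?a * ?b)\<^sup>2"
      unfolding 1 2 norm_divide norm_mult norm_of_real power_divide power_mult_distrib power2_abs
      by (simp add: add_divide_distrib)
    also have "4 * (cmod (z * of_real ?b - w * of_real ?a))\<^sup>2 + 4 * (?a - ?b)\<^sup>2 = 4 * (cmod (z - w))\<^sup>2 * (?a * ?b)"
      unfolding cmod_power2 by (simp add: power2_eq_square algebra_simps)
    also have "4 * (cmod (z - w))\<^sup>2 * (?a * ?b) / (?a * ?b)\<^sup>2 = 4 * (cmod (z - w))\<^sup>2 / (?a * ?b)"
      using ab by (simp add: power2_eq_square)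
    also have "\<dots> = (2 * cmod (z - w) / (sqrt ?a * sqrt ?b))\<^sup>2"
      using ab by (simp add: power_divide power_mult_distrib)
    finally show ?thesis
      by (rule power2_eq_imp_eq) (use ab in auto)
  qed
  have inf: "dist (Fin z) Infty = 2 / sqrt (1 + (cmod z)\<^sup>2)" for z
  proof -
    let ?a = "1 + (cmod z)\<^sup>2"
    have a: "?a > 0" by (simp add: add_pos_nonneg)
    have 2: "((cmod z)\<^sup>2 - 1) / ((cmod z)\<^sup>2 + 1) - 1 = - 2 / ?a"
      using a by (simp add: field_simps)
    have "(dist (Fin z) Infty)\<^sup>2 = (cmod (2 * z / of_real ?a))\<^sup>2 + (((cmod z)\<^sup>2 - 1) / ((cmod z)\<^sup>2 + 1) - 1)\<^sup>2"
      by (simp add: dist_riemann_sphere_def dist_prod_def dist_norm power2_abs)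
    also have "\<dots> = 4 * ?a / ?a\<^sup>2"
      unfolding 2 norm_divide norm_mult norm_of_real power_divide power_mult_distrib power2_abs
      by (simp add: add_divide_distrib)
    also have "\<dots> = (2 / sqrt ?a)\<^sup>2"
    proof -
      have "4 * b / b\<^sup>2 = (2 / sqrt b)\<^sup>2" if "b > 0" for b :: real
        using that by (simp add: power_divide) (simp add: power2_eq_square)
      then show ?thesis using a by blast
    qed
    finally show ?thesis by (rule power2_eq_imp_eq) (use a in auto)
  qed
  have n: "norm (z, 1::complex) = sqrt (1 + (cmod z)\<^sup>2)" "norm (1::complex, 0::complex) = 1" for z :: complex
    by (simp_all add: norm_prod_def add.commute)
  show ?thesis
    using fin inf dist_commute[of Infty]
    by (cases x; cases y) (simp_all add: sphere_vec_def vec_det_def n)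
qed

lemma moebius_eq_vec_class: "moebius A x = vec_class (mat_vec A (sphere_vec x))"
  by (cases x) (auto simp: vec_class_def mat_vec_def sphere_vec_def)

lemma vec_det_mat_vec: "det A = 1 \<Longrightarrow> vec_det (mat_vec A v) (mat_vec A w) = vec_det v w"
proof -
  assume "det A = 1"
  then have "A$1$1 * A$2$2 = 1 + A$1$2 * A$2$1" by (simp add: det_2 diff_eq_eq)
  moreover have "vec_det (mat_vec A v) (mat_vec A w) = (A$1$1 * A$2$2 - A$1$2 * A$2$1) * vec_det v w"
    by (simp add: vec_det_def mat_vec_def algebra_simps)
  ultimately show ?thesis by simp
qed

lemma mat_vec_matrix_mult: "mat_vec (A ** B) v = mat_vec A (mat_vec B v)"
  by (simp add: mat_vec_def matrix_matrix_mult_def sum_2 algebra_simps)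

lemma mat_vec_scale: "mat_vec A (c * a, c * b) = (c * fst (mat_vec A (a, b)), c * snd (mat_vec A (a, b)))"
  by (simp add: mat_vec_def algebra_simps)

definition adjugate :: "complex^2^2 \<Rightarrow> complex^2^2" where
  "adjugate A = vector [vector [A$2$2, - (A$1$2)], vector [- (A$2$1), A$1$1]]"

lemma adjugate_nth [simp]:
  "adjugate A $ 1 $ 1 = A$2$2" "adjugate A $ 1 $ 2 = - (A$1$2)" "adjugate A $ 2 $ 1 = - (A$2$1)" "adjugate A $ 2 $ 2 = A$1$1"
  by (simp_all add: adjugate_def vector_2)

lemma det_adjugate: "det (adjugate A) = det A"
  by (simp add: det_2 mult.commute)

lemma adjugate_mult:
  assumes "det A = 1"
  shows "adjugate A ** A = mat 1" "A ** adjugate A = mat 1"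
proof -
  have "A$1$1 * A$2$2 = 1 + A$1$2 * A$2$1" using assms by (simp add: det_2 diff_eq_eq)
  then show "adjugate A ** A = mat 1" "A ** adjugate A = mat 1"
    by (auto simp: vec_eq_iff forall_2 matrix_matrix_mult_def sum_2 mat_def algebra_simps)
qed

lemma mat_vec_id [simp]: "mat_vec (mat 1) v = v"
  by (simp add: mat_vec_def mat_def)

lemma mat_vec_nonzero: "det A = 1 \<Longrightarrow> v \<noteq> 0 \<Longrightarrow> mat_vec A v \<noteq> 0"
proof
  assume A: "det A = 1" "v \<noteq> 0" "mat_vec A v = 0"
  have "v = mat_vec (adjugate A) (mat_vec A v)" by (simp add: mat_vec_matrix_mult[symmetric] adjugate_mult[OF A(1)])
  also have "\<dots> = 0" by (simp add: A(3)) (simp add: mat_vec_def zero_prod_def)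
  finally show False using A(2) by simp
qed

lemma vec_class_scale: "c \<noteq> 0 \<Longrightarrow> vec_class (c * a, c * b) = vec_class (a, b)"
  by (auto simp: vec_class_def)

lemma moebius_vec_class:
  assumes "v \<noteq> 0"
  shows "moebius A (vec_class v) = vec_class (mat_vec A v)"
proof -
  obtain c where c: "c \<noteq> 0" "v = (c * fst (sphere_vec (vec_class v)), c * snd (sphere_vec (vec_class v)))"
    by (rule sphere_vec_class[OF assms])
  have "vec_class (mat_vec A v) = vec_class (mat_vec A (sphere_vec (vec_class v)))"
    by (subst c(2)) (simp add: mat_vec_scale vec_class_scale[OF c(1)])
  then show ?thesis by (simp add: moebius_eq_vec_class)
qed

lemma moebius_mult:
  assumes "det B = 1"
  shows "moebius (A ** B) x = moebius A (moebius B x)"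
proof -
  have "mat_vec B (sphere_vec x) \<noteq> 0" by (rule mat_vec_nonzero[OF assms sphere_vec_nonzero])
  then show ?thesis by (simp add: moebius_eq_vec_class[of _ x] moebius_vec_class mat_vec_matrix_mult)
qed

lemma moebius_id [simp]: "moebius (mat 1) x = x"
  by (simp add: moebius_eq_vec_class)

lemma dist_vec_class:
  assumes "v \<noteq> 0" "w \<noteq> 0"
  shows "dist (vec_class v) (vec_class w) = 2 * cmod (vec_det v w) / (norm v * norm w)"
proof -
  obtain c where c: "c \<noteq> 0" "v = (c * fst (sphere_vec (vec_class v)), c * snd (sphere_vec (vec_class v)))"
    by (rule sphere_vec_class[OF assms(1)])
  obtain d where d: "d \<noteq> 0" "w = (d * fst (sphere_vec (vec_class w)), d * snd (sphere_vec (vec_class w)))"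
    by (rule sphere_vec_class[OF assms(2)])
  have nn: "norm (a * fst u, a * snd u) = cmod a * norm u" for a :: complex and u :: "complex \<times> complex"
    by (simp add: norm_prod_def norm_mult power_mult_distrib real_sqrt_mult flip: distrib_left)
  have nv: "norm v = cmod c * norm (sphere_vec (vec_class v))" using c(2) nn by metis
  have nw: "norm w = cmod d * norm (sphere_vec (vec_class w))" using d(2) nn by metis
  have "vec_det v w = c * d * vec_det (sphere_vec (vec_class v)) (sphere_vec (vec_class w))"
    by (subst c(2), subst d(2)) (simp add: vec_det_def algebra_simps)
  then show ?thesis unfolding nv nw dist_sphere_vec using c(1) d(1) by (simp add: norm_mult field_simps)
qed

lemma dist_moebius:
  assumes "det A = 1"
  shows "dist (moebius A x) (moebius A y) = 2 * cmod (vec_det (sphere_vec x) (sphere_vec y)) /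
    (norm (mat_vec A (sphere_vec x)) * norm (mat_vec A (sphere_vec y)))"
  unfolding moebius_eq_vec_class
  by (subst dist_vec_class) (simp_all add: mat_vec_nonzero[OF assms] sphere_vec_nonzero vec_det_mat_vec[OF assms])

definition mat_size :: "complex^2^2 \<Rightarrow> real" where
  "mat_size A = cmod (A$1$1) + cmod (A$1$2) + cmod (A$2$1) + cmod (A$2$2)"

lemma norm_mat_vec_le: "norm (mat_vec A v) \<le> mat_size A * norm v"
proof -
  have f: "cmod (fst v) \<le> norm v" "cmod (snd v) \<le> norm v"
    using norm_fst_le[of "fst v" "snd v"] norm_snd_le[of "snd v" "fst v"] by simp_all
  have "norm (mat_vec A v) \<le> cmod (fst (mat_vec A v)) + cmod (snd (mat_vec A v))"
    by (simp add: norm_Pair_le mat_vec_def)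
  also have "\<dots> \<le> (cmod (A$1$1) * cmod (fst v) + cmod (A$1$2) * cmod (snd v)) + (cmod (A$2$1) * cmod (fst v) + cmod (A$2$2) * cmod (snd v))"
    unfolding mat_vec_def fst_conv snd_conv
    by (intro add_mono order_trans[OF norm_triangle_ineq]) (simp_all add: norm_mult)
  also have "\<dots> \<le> (cmod (A$1$1) * norm v + cmod (A$1$2) * norm v) + (cmod (A$2$1) * norm v + cmod (A$2$2) * norm v)"
    by (intro add_mono mult_left_mono f) auto
  finally show ?thesis by (simp add: mat_size_def algebra_simps)
qed

lemma continuous_on_moebius:
  assumes A: "det A = 1"
  shows "continuous_on S (moebius A)"
proof -
  let ?M = "mat_size (adjugate A)"
  have low: "norm v \<le> ?M * norm (mat_vec A v)" for v
    using norm_mat_vec_le[of "adjugate A" "mat_vec A v"] by (simp add: mat_vec_matrix_mult[symmetric] adjugate_mult[OF A])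
  have pos: "norm (sphere_vec x) > 0" "norm (mat_vec A (sphere_vec x)) > 0" for x
    by (simp_all add: sphere_vec_nonzero mat_vec_nonzero[OF A])
  have "dist (moebius A x) (moebius A y) \<le> ?M\<^sup>2 * dist x y" for x y
  proof -
    let ?d = "2 * cmod (vec_det (sphere_vec x) (sphere_vec y))"
    have "norm (sphere_vec x) * norm (sphere_vec y) \<le> (?M * norm (mat_vec A (sphere_vec x))) * (?M * norm (mat_vec A (sphere_vec y)))"
      by (intro mult_mono low) (auto intro: order_trans[OF norm_ge_zero low])
    then have "?d * (norm (sphere_vec x) * norm (sphere_vec y)) \<le> ?d * ((?M * norm (mat_vec A (sphere_vec x))) * (?M * norm (mat_vec A (sphere_vec y))))"
      by (rule mult_left_mono) simp
    then show ?thesis unfolding dist_moebius[OF A] dist_sphere_vec[of x y]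
      using pos[of x] pos[of y] by (simp add: field_simps power2_eq_square)
  qed
  then have "lipschitz_on (?M\<^sup>2) S (moebius A)" by (intro lipschitz_onI) auto
  then show ?thesis by (rule lipschitz_on_continuous_on)
qed

lemma inj_moebius:
  assumes "det A = 1"
  shows "inj (moebius A)"
proof (rule injI)
  fix x y assume "moebius A x = moebius A y"
  then have "moebius (adjugate A) (moebius A x) = moebius (adjugate A) (moebius A y)" by simp
  then show "x = y" by (simp add: moebius_mult[OF assms, symmetric] adjugate_mult[OF assms])
qed

lemma jordan_curve_moebius:
  assumes "det A = 1" "jordan_curve J"
  shows "jordan_curve (moebius A ` J)"
proof -
  obtain \<gamma> :: "complex \<Rightarrow> riemann_sphere" where g: "continuous_on (sphere 0 1) \<gamma>" "inj_on \<gamma> (sphere 0 1)" "J = \<gamma> ` sphere 0 1"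
    using assms(2) unfolding jordan_curve_def by blast
  show ?thesis unfolding jordan_curve_def
  proof (intro exI conjI)
    show "continuous_on (sphere 0 1) (moebius A \<circ> \<gamma>)"
      by (rule continuous_on_compose[OF g(1) continuous_on_moebius[OF assms(1)]])
    show "inj_on (moebius A \<circ> \<gamma>) (sphere 0 1)"
      by (rule comp_inj_on[OF g(2)]) (rule inj_on_subset[OF inj_moebius[OF assms(1)]], simp)
    show "moebius A ` J = (moebius A \<circ> \<gamma>) ` sphere 0 1" by (simp add: g(3) image_comp)
  qed
qed

text \<open>Completing the square in \<open>z\<close>; the constant term is given by Lagrange's identity for the vectors \<open>(P, R)\<close>
and \<open>(Q, S)\<close>.\<close>

lemma lagrange_identity:
  fixes P Q R S z :: complex
  assumes N: "N = (cmod P)\<^sup>2 + (cmod R)\<^sup>2" "N \<noteq> 0"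
  shows "(cmod (P * z + Q))\<^sup>2 + (cmod (R * z + S))\<^sup>2 =
    N * (cmod (z + (cnj P * Q + cnj R * S) / of_real N))\<^sup>2 + (cmod (P * S - Q * R))\<^sup>2 / N"
proof -
  let ?w = "cnj P * Q + cnj R * S"
  have nz: "complex_of_real N \<noteq> 0" using N(2) by simp
  have "N * ((cmod (P * z + Q))\<^sup>2 + (cmod (R * z + S))\<^sup>2) = (cmod (of_real N * z + ?w))\<^sup>2 + (cmod (P * S - Q * R))\<^sup>2"
    (is "?l = ?r")
  proof -
    have "complex_of_real ?l = of_real ?r"
      unfolding N(1) of_real_mult of_real_add complex_norm_square complex_cnj_add complex_cnj_mult
        complex_cnj_diff complex_cnj_cnj complex_cnj_complex_of_real
      by algebra
    then show ?thesis by (simp only: of_real_eq_iff)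
  qed
  moreover have "of_real N * z + ?w = of_real N * (z + ?w / of_real N)" using nz by (simp add: field_simps)
  then have "(cmod (of_real N * z + ?w))\<^sup>2 = N\<^sup>2 * (cmod (z + ?w / of_real N))\<^sup>2" by (simp only: norm_mult norm_of_real power_mult_distrib power2_abs)
  ultimately have "N * ((cmod (P * z + Q))\<^sup>2 + (cmod (R * z + S))\<^sup>2) =
     N * (N * (cmod (z + ?w / of_real N))\<^sup>2 + (cmod (P * S - Q * R))\<^sup>2 / N)"
    using N(2) by (simp add: power2_eq_square distrib_left)
  then show ?thesis using N(2) by simp
qed

section \<open>Discrete groups and their orbits\<close>

lemma norm_le_mat_size: "norm X \<le> mat_size X"
proof -
  have 1: "norm (v :: complex^2) \<le> cmod (v$1) + cmod (v$2)" for v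
    using L2_set_le_sum[of UNIV "\<lambda>i. norm (v$i)"] by (simp add: norm_vec_def sum_2)
  have "norm X \<le> norm (X$1) + norm (X$2)"
    using L2_set_le_sum[of UNIV "\<lambda>i. norm (X$i)"] by (simp add: norm_vec_def sum_2)
  then show ?thesis using 1[of "X$1"] 1[of "X$2"] by (simp add: mat_size_def)
qed

lemma mat_size_le_norm: "mat_size X \<le> 4 * norm X"
proof -
  have "cmod (X$i$j) \<le> norm X" for i j
    by (rule order_trans[OF Finite_Cartesian_Product.norm_nth_le Finite_Cartesian_Product.norm_nth_le])
  from this[of 1 1] this[of 1 2] this[of 2 1] this[of 2 2] show ?thesis by (simp add: mat_size_def)
qed

lemma mat_size_nonneg: "0 \<le> mat_size X" by (simp add: mat_size_def)

lemma mat_size_adjugate: "mat_size (adjugate A) = mat_size A"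
  by (simp add: mat_size_def)

lemma mat_size_mult: "mat_size (X ** Y) \<le> mat_size X * mat_size Y"
proof -
  have e: "cmod ((X ** Y)$i$j) \<le> cmod (X$i$1) * cmod (Y$1$j) + cmod (X$i$2) * cmod (Y$2$j)" for i j
    by (simp add: matrix_matrix_mult_def sum_2) (rule order_trans[OF norm_triangle_ineq], simp add: norm_mult)
  have "0 \<le> cmod (X$i$j) * cmod (Y$k$l)" for i j k l by simp
  note nn = this[of 1 1 2 1] this[of 1 1 2 2] this[of 1 2 1 1] this[of 1 2 1 2] this[of 2 1 2 1] this[of 2 1 2 2]
    this[of 2 2 1 1] this[of 2 2 1 2]
  show ?thesis
    using e[of 1 1] e[of 1 2] e[of 2 1] e[of 2 2] nn
    unfolding mat_size_def distrib_left distrib_right by linarith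
qed

lemma PSL2_member:
  assumes "g \<in> carrier PSL2" "A \<in> g"
  shows "det A = 1" "g = {A, - A}"
  using assms by (auto simp: carrier_PSL2 det_neg_2)

lemma PSL2_mult_member: "A \<in> g \<Longrightarrow> B \<in> g' \<Longrightarrow> A ** B \<in> g \<otimes>\<^bsub>PSL2\<^esub> g'"
  by (auto simp: PSL2_def FactGroup_def set_mult_def SL2_def)

lemma one_PSL2: "\<one>\<^bsub>PSL2\<^esub> = {mat 1, - mat 1}"
  by (simp add: PSL2_def FactGroup_def)

lemma PSL2_inv_member:
  assumes g: "g \<in> carrier PSL2" and A: "A \<in> g"
  shows "adjugate A \<in> inv\<^bsub>PSL2\<^esub> g"
proof -
  interpret group PSL2 by (rule group_PSL2)
  have d: "det A = 1" using PSL2_member[OF g A] by simp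
  let ?h = "{adjugate A, - adjugate A}"
  have h: "?h \<in> carrier PSL2" using d det_adjugate[of A] by (auto simp: carrier_PSL2)
  have hg: "?h \<otimes>\<^bsub>PSL2\<^esub> g \<in> carrier PSL2" by (rule m_closed[OF h g])
  have "mat 1 \<in> ?h \<otimes>\<^bsub>PSL2\<^esub> g" using PSL2_mult_member[of "adjugate A" ?h A g] A adjugate_mult(1)[OF d] by simp
  then have "?h \<otimes>\<^bsub>PSL2\<^esub> g = \<one>\<^bsub>PSL2\<^esub>" using PSL2_member(2)[OF hg] one_PSL2 by blast
  then have "inv\<^bsub>PSL2\<^esub> g = ?h" by (rule inv_equality[OF _ g h])
  then show ?thesis by simp
qed

lemma subgroup_lift_closed:
  assumes \<Gamma>: "subgroup \<Gamma> PSL2" and A: "A \<in> \<Union>\<Gamma>"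
  shows "det A = 1" "adjugate A \<in> \<Union>\<Gamma>" "B \<in> \<Union>\<Gamma> \<Longrightarrow> A ** B \<in> \<Union>\<Gamma>"
proof -
  obtain g where g: "g \<in> \<Gamma>" "A \<in> g" using A by blast
  have gc: "g \<in> carrier PSL2" using g(1) subgroup.subset[OF \<Gamma>] by blast
  show "det A = 1" by (rule PSL2_member[OF gc g(2)])
  show "adjugate A \<in> \<Union>\<Gamma>"
    using PSL2_inv_member[OF gc g(2)] subgroup.m_inv_closed[OF \<Gamma> g(1)] by blast
  show "A ** B \<in> \<Union>\<Gamma>" if "B \<in> \<Union>\<Gamma>"
    using that PSL2_mult_member[OF g(2)] subgroup.m_closed[OF \<Gamma> g(1)] by blast
qed

lemma discrete_subgroup_isolated_identity:
  assumes "discrete_subgroup \<Gamma>"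
  obtains e where "e > 0" "\<And>A. A \<in> \<Union>\<Gamma> \<Longrightarrow> dist A (mat 1) < e \<Longrightarrow> A = mat 1 \<or> A = - mat 1"
proof -
  have \<Gamma>: "subgroup \<Gamma> PSL2" and dt: "subtopology PSL2_topology \<Gamma> = discrete_topology \<Gamma>"
    using assms by (auto simp: discrete_subgroup_def)
  have "openin (subtopology PSL2_topology \<Gamma>) {\<one>\<^bsub>PSL2\<^esub>}"
    unfolding dt using subgroup.one_closed[OF \<Gamma>] by simp
  then obtain U where U: "openin PSL2_topology U" "{\<one>\<^bsub>PSL2\<^esub>} = U \<inter> \<Gamma>"
    unfolding openin_subtopology by blast
  then have Uc: "U \<subseteq> carrier PSL2" and "openin (top_of_set (carrier SL2)) (\<Union>U)"
    by (auto simp: openin_PSL2_topology)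
  then obtain W where W: "open W" "\<Union>U = carrier SL2 \<inter> W" unfolding openin_open by blast
  have "mat 1 \<in> \<Union>U" using U(2) one_PSL2 by blast
  then have "mat 1 \<in> W" using W by blast
  then obtain e where e: "e > 0" "ball (mat 1) e \<subseteq> W" using W(1) open_contains_ball by blast
  show thesis
  proof (rule that[OF e(1)])
    fix A assume A: "A \<in> \<Union>\<Gamma>" "dist A (mat 1) < e"
    have "A \<in> W" using A(2) e(2) by (auto simp: dist_commute)
    moreover have "A \<in> carrier SL2" using subgroup_lift_closed(1)[OF \<Gamma> A(1)] by (simp add: SL2_def)
    ultimately obtain g' where g': "g' \<in> U" "A \<in> g'" using W(2) by blast
    obtain g where g: "g \<in> \<Gamma>" "A \<in> g" using A(1) by blast
    have "g = {A, - A}" using PSL2_member(2)[of g A] g subgroup.subset[OF \<Gamma>] by blast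
    moreover have "g' = {A, - A}" using PSL2_member(2)[of g' A] g' Uc by blast
    ultimately have "g \<in> U \<inter> \<Gamma>" using g g' by simp
    then have "g = {mat 1, - mat 1}" using U(2) one_PSL2 by blast
    then show "A = mat 1 \<or> A = - mat 1" using g(2) by blast
  qed
qed

text \<open>An infinite bounded set of matrices accumulates somewhere, so it contains \<open>A\<close> and \<open>B\<close> close to each other. Then
\<open>A\<close> inverse times \<open>B\<close> is close to the identity, hence equal to \<open>mat 1\<close> or \<open>- mat 1\<close>; the second possibility is excluded by choosing
\<open>B\<close> different from \<open>- A\<close> as well.\<close>

lemma discrete_subgroup_finite_bounded:
  assumes "discrete_subgroup \<Gamma>"
  shows "finite {A \<in> \<Union>\<Gamma>. mat_size A \<le> M}"
proof (rule ccontr)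
  let ?S = "{A \<in> \<Union>\<Gamma>. mat_size A \<le> M}"
  assume inf: "infinite ?S"
  have \<Gamma>: "subgroup \<Gamma> PSL2" using assms by (auto simp: discrete_subgroup_def)
  obtain e where e: "e > 0" "\<And>A. A \<in> \<Union>\<Gamma> \<Longrightarrow> dist A (mat 1) < e \<Longrightarrow> A = mat 1 \<or> A = - mat 1"
    by (rule discrete_subgroup_isolated_identity[OF assms]) (rule that; assumption)
  obtain A0 where "A0 \<in> ?S" using infinite_imp_nonempty[OF inf] unfolding ex_in_conv[symmetric] by (elim exE)
  then have M: "M \<ge> 0" using mat_size_nonneg[of A0] by simp
  have "?S \<subseteq> cball 0 M" by (auto intro: order_trans[OF norm_le_mat_size])
  then obtain L where "L islimpt ?S"
    using compact_cball[of "0 :: complex^2^2" M] inf unfolding compact_eq_Bolzano_Weierstrass by blast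
  then have many: "infinite (?S \<inter> ball L d)" if "d > 0" for d using that by (simp add: islimpt_eq_infinite_ball)
  define d where "d = e / (8 * (M + 1))"
  have d: "d > 0" using e M by (simp add: d_def)
  obtain A where A: "A \<in> ?S \<inter> ball L d"
    using infinite_imp_nonempty[OF many[OF d]] unfolding ex_in_conv[symmetric] by (elim exE)
  have "infinite (?S \<inter> ball L d - {A, - A})" using many[OF d] by simp
  from infinite_imp_nonempty[OF this]
  obtain B where B: "B \<in> ?S \<inter> ball L d - {A, - A}" unfolding ex_in_conv[symmetric] by (elim exE)
  have detA: "det A = 1" using subgroup_lift_closed(1)[OF \<Gamma>] A by blast
  let ?C = "adjugate A ** B"
  have C: "?C \<in> \<Union>\<Gamma>" using subgroup_lift_closed(2,3)[OF \<Gamma>] A B by blast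
  have AB: "norm (B - A) < 2 * d"
    using A B norm_triangle_ineq4[of "B - L" "A - L"] by (simp add: dist_norm norm_minus_commute)
  have "?C - mat 1 = adjugate A ** (B - A)"
    by (simp only: diff_conv_add_uminus matrix_add_ldistrib matrix_mult_neg adjugate_mult[OF detA])
  then have "dist ?C (mat 1) \<le> mat_size (adjugate A ** (B - A))" using norm_le_mat_size by (simp add: dist_norm)
  also have "\<dots> \<le> mat_size A * mat_size (B - A)" using mat_size_mult[of "adjugate A" "B - A"] by (simp add: mat_size_adjugate)
  also have "\<dots> \<le> M * (4 * norm (B - A))"
    by (rule mult_mono) (use A M mat_size_le_norm mat_size_nonneg in auto)
  also have "\<dots> \<le> (M + 1) * (4 * norm (B - A))" by (rule mult_right_mono) auto
  also have "\<dots> < (M + 1) * (4 * (2 * d))" using AB M by (intro mult_strict_left_mono) auto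
  also have "\<dots> = 8 * (M + 1) * d" by simp
  also have "\<dots> = e"
    unfolding d_def times_divide_eq_right by (rule nonzero_mult_div_cancel_left) (use M in simp)
  finally have "?C = mat 1 \<or> ?C = - mat 1" using e(2)[OF C] by blast
  then have "A ** ?C = A \<or> A ** ?C = - A" by (auto simp: matrix_mult_neg)
  moreover have "A ** ?C = B" by (simp add: matrix_mul_assoc adjugate_mult[OF detA])
  ultimately have "B = A \<or> B = - A" by simp
  then show False using B by simp
qed

lemma poincare_ext_height_pos:
  assumes "det A = 1" "t > 0"
  shows "snd (poincare_ext A (z, t)) > 0"
proof -
  have "(cmod (A$2$1 * z + A$2$2))\<^sup>2 + (cmod (A$2$1))\<^sup>2 * t\<^sup>2 > 0"
  proof (cases "A$2$1 = 0")
    case True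
    then have "A$2$2 \<noteq> 0" using assms(1) by (auto simp: det_2)
    then show ?thesis using True by simp
  qed (use assms in \<open>auto intro: add_nonneg_pos\<close>)
  then show ?thesis using assms(2) by (simp add: Let_def)
qed

text \<open>The inverse of \<open>A\<close> maps the base point \<open>(w, t)\<close> to a point \<open>(\<zeta>, t / N)\<close> of the orbit. By \<open>lagrange_identity\<close>,
\<open>N * (\<bar>z - \<zeta>\<bar>\<^sup>2 + (t / N)\<^sup>2)\<close> is the squared norm of a vector obtained from \<open>A (z, 1)\<close> by a linear map that depends only
on \<open>w\<close> and \<open>t\<close>. As the orbit stays away from \<open>z\<close>, a bound for \<open>A (z, 1)\<close> gives a bound for \<open>N\<close>, which controls
the first column of \<open>A\<close>, and then one for the second column.\<close>

lemma escaping_matrices_finite: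
  assumes \<Gamma>: "discrete_subgroup \<Gamma>" and t: "t > 0" and \<delta>: "\<delta> > 0"
    and avoid: "\<And>g. g \<in> \<Gamma> \<Longrightarrow> dist (hyp3_act g (w, t)) (z0, 0) \<ge> \<delta>"
  shows "finite {A \<in> \<Union>\<Gamma>. \<exists>z\<in>ball z0 (\<delta> / 2). norm (mat_vec A (z, 1)) \<le> M}"
proof -
  have sub: "subgroup \<Gamma> PSL2" using \<Gamma> by (auto simp: discrete_subgroup_def)
  define B1 where "B1 = 4 / \<delta>\<^sup>2 * (((1 + cmod w) * M)\<^sup>2 + (t * M)\<^sup>2)"
  define s where "s = sqrt B1"
  define M1 where "M1 = s + s / t * cmod w"
  define M2 where "M2 = s / t"
  define Z where "Z = cmod z0 + \<delta>"
  have "mat_size A \<le> M1 + (M + M1 * Z) + M2 + (M + M2 * Z)"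
    if A: "A \<in> \<Union>\<Gamma>" and z: "z \<in> ball z0 (\<delta> / 2)" and le: "norm (mat_vec A (z, 1)) \<le> M" for A z
  proof -
    let ?a = "A$1$1" and ?b = "A$1$2" and ?c = "A$2$1" and ?d = "A$2$2"
    have det: "det A = 1" and adj: "adjugate A \<in> \<Union>\<Gamma>" using subgroup_lift_closed[OF sub A] by auto
    obtain g where g: "g \<in> \<Gamma>" "adjugate A \<in> g" using adj by blast
    have gc: "g \<in> carrier PSL2" using g(1) subgroup.subset[OF sub] by blast
    define P where "P = ?a - ?c * w"
    define Q where "Q = ?b - ?d * w"
    define R where "R = of_real t * ?c"
    define S where "S = of_real t * ?d"
    define N where "N = (cmod P)\<^sup>2 + (cmod R)\<^sup>2"
    have dd: "?a * ?d - ?b * ?c = 1" using det by (simp add: det_2)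
    have PS: "P * S - Q * R = of_real t"
    proof -
      have "P * S - Q * R = of_real t * (?a * ?d - ?b * ?c)" by (simp add: P_def Q_def R_def S_def algebra_simps)
      then show ?thesis using dd by simp
    qed
    have N0: "N \<noteq> 0"
    proof
      assume "N = 0"
      then have "(cmod P)\<^sup>2 = 0" "(cmod R)\<^sup>2 = 0" unfolding N_def by (simp_all add: add_nonneg_eq_0_iff)
      then have "P = 0" "R = 0" by auto
      then show False using PS t by simp
    qed
    have Np: "N > 0" using N0 unfolding N_def by (smt (verit) zero_le_power2)
    define \<zeta> where "\<zeta> = - ((cnj P * Q + cnj R * S) / of_real N)"
    have N': "(cmod (- ?c * w + ?a))\<^sup>2 + (cmod (- ?c))\<^sup>2 * t\<^sup>2 = N"
      unfolding N_def P_def R_def by (simp add: norm_mult power_mult_distrib mult.commute add.commute)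
    have "hyp3_act g (w, t) = poincare_ext (adjugate A) (w, t)"
      by (simp add: hyp3_act_eq[OF gc g(2)])
    also have "\<dots> = (\<zeta>, t / N)"
    proof -
      have "(?d * w + - ?b) * cnj (- ?c * w + ?a) + ?d * cnj (- ?c) * of_real (t\<^sup>2) = - (cnj P * Q + cnj R * S)"
        by (simp add: P_def Q_def R_def S_def power2_eq_square algebra_simps)
      then show ?thesis
        unfolding poincare_ext.simps Let_def adjugate_nth N' \<zeta>_def by (simp only: minus_divide_left)
    qed
    finally have "dist (\<zeta>, t / N) (z0, 0) \<ge> \<delta>" using avoid[OF g(1)] by simp
    moreover have "dist (z, 0::real) (z0, 0) < \<delta> / 2" using z by (simp add: dist_prod_def dist_commute)
    ultimately have "dist (\<zeta>, t / N) (z, 0) \<ge> \<delta> / 2"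
      using dist_triangle[of "(\<zeta>, t / N)" "(z0, 0)" "(z, 0)"] by simp
    then have "(\<delta> / 2)\<^sup>2 \<le> (dist (\<zeta>, t / N) (z, 0))\<^sup>2" using \<delta> by (intro power_mono) auto
    also have "\<dots> = (cmod (z - \<zeta>))\<^sup>2 + (t / N)\<^sup>2"
      by (simp add: dist_prod_def dist_norm norm_minus_commute power_divide)
    finally have far: "\<delta>\<^sup>2 / 4 \<le> (cmod (z - \<zeta>))\<^sup>2 + (t / N)\<^sup>2" by (simp add: power_divide)
    have "N * (\<delta>\<^sup>2 / 4) \<le> N * ((cmod (z - \<zeta>))\<^sup>2 + (t / N)\<^sup>2)" using far Np by (intro mult_left_mono) auto
    also have "\<dots> = N * (cmod (z - \<zeta>))\<^sup>2 + t\<^sup>2 / N" using N0 by (simp add: distrib_left power_divide power2_eq_square)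
    also have "\<dots> = (cmod (P * z + Q))\<^sup>2 + (cmod (R * z + S))\<^sup>2"
      using lagrange_identity[OF N_def N0, of z Q S] PS by (simp add: \<zeta>_def)
    also have "\<dots> \<le> ((1 + cmod w) * M)\<^sup>2 + (t * M)\<^sup>2"
    proof -
      have v: "cmod (?a * z + ?b) \<le> M" "cmod (?c * z + ?d) \<le> M"
        using le norm_fst_le[of "fst (mat_vec A (z, 1))" "snd (mat_vec A (z, 1))"]
          norm_snd_le[of "snd (mat_vec A (z, 1))" "fst (mat_vec A (z, 1))"] by (auto simp: mat_vec_def)
      have "P * z + Q = (?a * z + ?b) - w * (?c * z + ?d)" by (simp add: P_def Q_def algebra_simps)
      then have "cmod (P * z + Q) \<le> cmod (?a * z + ?b) + cmod w * cmod (?c * z + ?d)"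
        using norm_triangle_ineq4[of "?a * z + ?b" "w * (?c * z + ?d)"] by (simp add: norm_mult)
      also have "\<dots> \<le> M + cmod w * M" using v by (intro add_mono mult_left_mono) auto
      finally have 1: "cmod (P * z + Q) \<le> (1 + cmod w) * M" by (simp add: algebra_simps)
      have "R * z + S = of_real t * (?c * z + ?d)" by (simp add: R_def S_def algebra_simps)
      then have 2: "cmod (R * z + S) \<le> t * M" using v t by (simp add: norm_mult)
      show ?thesis by (intro add_mono power_mono 1 2) auto
    qed
    finally have "N \<le> B1" using \<delta> by (simp add: B1_def field_simps)
    then have "(cmod P)\<^sup>2 \<le> B1" "(cmod R)\<^sup>2 \<le> B1" unfolding N_def by (smt (verit) zero_le_power2)+
    then have PR: "cmod P \<le> s" "cmod R \<le> s" unfolding s_def by (auto intro: real_le_rsqrt)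
    have c: "cmod ?c \<le> M2" using PR(2) t by (simp add: R_def M2_def norm_mult field_simps)
    have "cmod ?a \<le> cmod P + cmod (?c * w)" using norm_triangle_ineq[of P "?c * w"] by (simp add: P_def)
    also have "\<dots> \<le> s + M2 * cmod w" unfolding norm_mult using PR(1) c by (intro add_mono mult_right_mono) auto
    finally have a: "cmod ?a \<le> M1" by (simp add: M1_def M2_def)
    have zZ: "cmod z \<le> Z" using z norm_triangle_sub[of z z0] \<delta> by (simp add: Z_def dist_norm norm_minus_commute)
    have v: "cmod (?a * z + ?b) \<le> M" "cmod (?c * z + ?d) \<le> M"
        using le norm_fst_le[of "fst (mat_vec A (z, 1))" "snd (mat_vec A (z, 1))"]
          norm_snd_le[of "snd (mat_vec A (z, 1))" "fst (mat_vec A (z, 1))"] by (auto simp: mat_vec_def)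
    have "cmod ?b \<le> M + cmod (?a * z)" using v(1) norm_triangle_ineq4[of "?a * z + ?b" "?a * z"] by simp
    moreover have "cmod (?a * z) \<le> M1 * Z" unfolding norm_mult using a zZ by (intro mult_mono) (auto intro: order_trans[OF norm_ge_zero])
    ultimately have b: "cmod ?b \<le> M + M1 * Z" by simp
    have "cmod ?d \<le> M + cmod (?c * z)" using v(2) norm_triangle_ineq4[of "?c * z + ?d" "?c * z"] by simp
    moreover have "cmod (?c * z) \<le> M2 * Z" unfolding norm_mult using c zZ by (intro mult_mono) (auto intro: order_trans[OF norm_ge_zero])
    ultimately have d: "cmod ?d \<le> M + M2 * Z" by simp
    show ?thesis using a b c d by (simp add: mat_size_def)
  qed
  then show ?thesis
    by (intro finite_subset[OF _ discrete_subgroup_finite_bounded[OF \<Gamma>, of "M1 + (M + M1 * Z) + M2 + (M + M2 * Z)"]]) blast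
qed

lemma large_images_finite:
  assumes \<Gamma>: "discrete_subgroup \<Gamma>" and t: "t > 0" and \<delta>: "\<delta> > 0"
    and avoid: "\<And>g. g \<in> \<Gamma> \<Longrightarrow> dist (hyp3_act g (w, t)) (z0, 0) \<ge> \<delta>"
    and J: "J \<subseteq> Fin ` ball z0 (\<delta> / 2)" and d: "d > 0"
  shows "finite {A \<in> \<Union>\<Gamma>. \<exists>x\<in>J. \<exists>y\<in>J. d < dist (moebius A x) (moebius A y)}"
proof -
  define M where "M = sqrt (2 * \<delta> / d)"
  have sub: "subgroup \<Gamma> PSL2" using \<Gamma> by (auto simp: discrete_subgroup_def)
  have M: "M > 0" "M * M = 2 * \<delta> / d" using \<delta> d by (auto simp: M_def)
  have "\<exists>z\<in>ball z0 (\<delta> / 2). norm (mat_vec A (z, 1)) \<le> M"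
    if A: "A \<in> \<Union>\<Gamma>" and xy: "x \<in> J" "y \<in> J" and far: "d < dist (moebius A x) (moebius A y)" for A x y
  proof (rule ccontr)
    assume no: "\<not> ?thesis"
    obtain z z' where z: "x = Fin z" "z \<in> ball z0 (\<delta> / 2)" "y = Fin z'" "z' \<in> ball z0 (\<delta> / 2)" using xy J by blast
    let ?n = "norm (mat_vec A (z, 1))" and ?n' = "norm (mat_vec A (z', 1))"
    have n: "M < ?n" "M < ?n'" using no z by force+
    have zz: "cmod (z - z') < \<delta>"
      using z norm_triangle_ineq4[of "z - z0" "z' - z0"] by (simp add: dist_norm norm_minus_commute)
    have "dist (moebius A x) (moebius A y) = 2 * cmod (z - z') / (?n * ?n')"
      unfolding dist_moebius[OF subgroup_lift_closed(1)[OF sub A]] by (simp add: z sphere_vec_def vec_det_def)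
    also have "\<dots> \<le> 2 * \<delta> / (M * M)"
      using n M(1) zz \<delta> by (intro frac_le mult_mono) auto
    also have "\<dots> = d" using M(2) \<delta> d by simp
    finally show False using far by simp
  qed
  then show ?thesis
    by (intro finite_subset[OF _ escaping_matrices_finite[OF \<Gamma> t \<delta> avoid, of M]]) blast
qed

text \<open>A set \<open>A\<close> that is not a singleton contains two points at some distance \<open>3 * \<eta>\<close>, and any set at Hausdorff distance
less than \<open>\<eta>\<close> from \<open>A\<close> contains two points at distance more than \<open>\<eta>\<close>. Only finitely many members of the family
do, and each has a positive distance from \<open>A\<close>.\<close>

lemma closedin_orbit:
  assumes fin: "\<And>d. d > 0 \<Longrightarrow> finite {B \<in> \<C>. \<exists>x\<in>B. \<exists>y\<in>B. d < dist x y}"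
    and sub: "\<C> \<subseteq> compacta\<^sub>0"
  shows "closedin compacta\<^sub>0_topology \<C>"
proof -
  interpret M: Metric_space compacta hausdorff_dist by (rule Metric_space_compacta)
  have top: "topspace compacta\<^sub>0_topology = compacta\<^sub>0"
    by (auto simp: compacta\<^sub>0_topology_def compacta\<^sub>0_def)
  have "openin compacta\<^sub>0_topology (compacta\<^sub>0 - \<C>)"
  proof (subst openin_subopen, intro ballI)
    fix A assume A: "A \<in> compacta\<^sub>0 - \<C>"
    then have Ac: "A \<in> compacta" "A \<noteq> {}" "\<not> is_singleton A" by (auto simp: compacta\<^sub>0_def compacta_def)
    obtain a where a: "a \<in> A" using Ac(2) by blast
    have "A \<noteq> {a}" using Ac(3) by (auto simp: is_singleton_def)
    then obtain b where b: "b \<in> A" "b \<noteq> a" using a by blast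
    define \<eta> where "\<eta> = dist a b / 3"
    have \<eta>: "\<eta> > 0" using b by (simp add: \<eta>_def)
    define F where "F = {B \<in> \<C>. \<exists>x\<in>B. \<exists>y\<in>B. \<eta> < dist x y}"
    have F: "finite F" unfolding F_def by (rule fin[OF \<eta>])
    define r where "r = Min (insert \<eta> (hausdorff_dist A ` F))"
    have hpos: "hausdorff_dist A B > 0" if "B \<in> \<C>" for B
    proof -
      have "B \<in> compacta" "B \<noteq> A" using that sub A by (auto simp: compacta\<^sub>0_def)
      then show ?thesis using M.mdist_pos_eq[OF Ac(1)] by auto
    qed
    have r: "r > 0" unfolding r_def using F \<eta> hpos by (subst Min_gr_iff) (auto simp: F_def)
    have rle: "r \<le> \<eta>" "\<And>B. B \<in> F \<Longrightarrow> r \<le> hausdorff_dist A B" unfolding r_def using F by auto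
    have "B \<notin> \<C>" if B: "B \<in> M.mball A r" for B
    proof
      assume BC: "B \<in> \<C>"
      have h: "hausdorff_dist A B < r" "B \<in> compacta" using B by auto
      then have Bne: "B \<noteq> {}" by (auto simp: compacta_def)
      have near: "\<exists>x'\<in>B. dist x x' < \<eta>" if "x \<in> A" for x
      proof -
        have "infdist x B \<le> hausdorff_dist A B"
          using hausdorff_dist_le_iff[OF Ac(2) Bne, of "hausdorff_dist A B"] that by blast
        then have "infdist x B < \<eta>" using h(1) rle(1) by linarith
        then show ?thesis using Bne by (simp add: infdist_notempty cINF_less_iff bdd_below_image_dist)
      qed
      obtain a' b' where ab: "a' \<in> B" "dist a a' < \<eta>" "b' \<in> B" "dist b b' < \<eta>" using near a b by blast
      have "dist a b \<le> dist a a' + dist a' b' + dist b b'"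
        using dist_triangle[of a b a'] dist_triangle[of a' b b'] by (simp add: dist_commute)
      then have "\<eta> < dist a' b'" using ab by (simp add: \<eta>_def)
      then have "B \<in> F" using BC ab by (auto simp: F_def)
      then show False using rle(2) h(1) by fastforce
    qed
    then have "M.mball A r \<inter> compacta\<^sub>0 \<subseteq> compacta\<^sub>0 - \<C>" by blast
    moreover have "A \<in> M.mball A r \<inter> compacta\<^sub>0" using A Ac r by simp
    moreover have "openin compacta\<^sub>0_topology (M.mball A r \<inter> compacta\<^sub>0)"
      unfolding compacta\<^sub>0_topology_def by (rule openin_subtopology_Int) simp
    ultimately show "\<exists>T. openin compacta\<^sub>0_topology T \<and> A \<in> T \<and> T \<subseteq> compacta\<^sub>0 - \<C>" by blast
  qed
  then show ?thesis using sub by (simp add: closedin_def top)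
qed

lemma jordan_curve_compacta\<^sub>0:
  assumes "jordan_curve J"
  shows "J \<in> compacta\<^sub>0"
proof -
  obtain \<gamma> :: "complex \<Rightarrow> riemann_sphere" where g: "continuous_on (sphere 0 1) \<gamma>" "inj_on \<gamma> (sphere 0 1)" "J = \<gamma> ` sphere 0 1"
    using assms unfolding jordan_curve_def by blast
  have "compact J" unfolding g(3) by (rule compact_continuous_image[OF g(1) compact_sphere])
  moreover have in1: "1 \<in> sphere (0::complex) 1" "-1 \<in> sphere (0::complex) 1" by auto
  then have "\<gamma> 1 \<noteq> \<gamma> (-1)" using g(2) by (metis inj_onD one_neq_neg_one)
  moreover have "\<gamma> 1 \<in> J" "\<gamma> (-1) \<in> J" using g(3) in1 by blast+
  ultimately show ?thesis by (auto simp: compacta\<^sub>0_def compacta_def is_singleton_def)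
qed

text \<open>A neighbourhood of \<open>x\<close> in the compactification contains a half-ball about \<open>x\<close>, or about a finite ideal point
far away if \<open>x\<close> is \<open>Infty\<close>.\<close>

lemma not_limit_point_avoids_half_ball:
  assumes \<Gamma>: "discrete_subgroup \<Gamma>" and p: "p \<in> hyp3" and x: "x \<notin> limit_set \<Gamma> p"
  obtains z0 \<delta> where "\<delta> > 0" "\<And>g. g \<in> \<Gamma> \<Longrightarrow> dist (hyp3_act g p) (z0, 0) \<ge> \<delta>"
proof -
  let ?H = "{(z :: complex, t :: real). t \<ge> 0}"
  obtain w t where wt: "p = (w, t)" "t > 0" using p by (auto simp: hyp3_def)
  have sub: "subgroup \<Gamma> PSL2" using \<Gamma> by (auto simp: discrete_subgroup_def)
  have pos: "snd (hyp3_act g p) > 0" if "g \<in> \<Gamma>" for g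
  proof -
    have gc: "g \<in> carrier PSL2" using that subgroup.subset[OF sub] by blast
    then obtain A where A: "A \<in> g" by (auto simp: carrier_PSL2)
    show ?thesis using poincare_ext_height_pos[OF PSL2_member(1)[OF gc A] wt(2)] by (simp add: hyp3_act_eq[OF gc A] wt(1))
  qed
  have inH: "hyp3_act g p \<in> ?H" if "g \<in> \<Gamma>" for g using pos[OF that] by (cases "hyp3_act g p") auto
  have nid: "Some (hyp3_act g p) \<noteq> ideal_point x" if "g \<in> \<Gamma>" for g
    using pos[OF that] by (cases x) auto
  have top: "ideal_point x \<in> topspace hyp3_compactification"
    by (cases x) (auto simp: hyp3_compactification_def)
  then obtain T where T: "openin hyp3_compactification T" "ideal_point x \<in> T"
      and noT: "\<And>g. g \<in> \<Gamma> \<Longrightarrow> Some (hyp3_act g p) \<notin> T"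
    using x nid unfolding limit_set_def in_derived_set_of by blast
  from T(1) consider
    (a) U where "openin (top_of_set ?H) U" "T = Some ` U"
    | (b) C where "compactin (top_of_set ?H) C" "closedin (top_of_set ?H) C" "T = insert None (Some ` (?H - C))"
    unfolding hyp3_compactification_def openin_Alexandroff_compactification by auto
  then have "\<exists>z0 \<delta>. \<delta> > 0 \<and> (\<forall>q\<in>?H. dist q (z0, 0) < \<delta> \<longrightarrow> Some q \<in> T)"
  proof cases
    case a
    then obtain z0 where z0: "(z0, 0) \<in> U" using T(2) by (cases x) auto
    obtain W where W: "open W" "U = ?H \<inter> W" using a(1) unfolding openin_open by blast
    obtain \<delta> where "\<delta> > 0" "ball (z0, 0) \<delta> \<subseteq> W" using W z0 open_contains_ball by blast
    moreover from this have "Some q \<in> T" if "q \<in> ?H" "dist q (z0, 0) < \<delta>" for q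
    proof -
      have "q \<in> ball (z0, 0) \<delta>" using that(2) by (simp add: dist_commute)
      then have "q \<in> U" using \<open>ball (z0, 0) \<delta> \<subseteq> W\<close> W(2) that(1) by blast
      then show ?thesis using a(2) by blast
    qed
    ultimately show ?thesis by blast
  next
    case b
    show ?thesis
    proof (cases x)
      case (Fin z0)
      then have "(z0, 0) \<in> ?H - C" using T(2) b(3) by auto
      moreover have "openin (top_of_set ?H) (?H - C)" using b(2) by (simp add: closedin_def)
      then obtain W where W: "open W" "?H - C = ?H \<inter> W" unfolding openin_open by blast
      ultimately obtain \<delta> where "\<delta> > 0" "ball (z0, 0) \<delta> \<subseteq> W" using open_contains_ball by blast
      moreover from this have "Some q \<in> T" if "q \<in> ?H" "dist q (z0, 0) < \<delta>" for q
      proof -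
        have "q \<in> ball (z0, 0) \<delta>" using that(2) by (simp add: dist_commute)
        then have "q \<in> ?H - C" using \<open>ball (z0, 0) \<delta> \<subseteq> W\<close> W(2) that(1) by blast
        then show ?thesis using b(3) by blast
      qed
      ultimately show ?thesis by blast
    next
      case Infty
      have "compact C" using b(1) by (simp add: compactin_subtopology)
      then have "bounded C" by (rule compact_imp_bounded)
      then obtain B where B: "B > 0" "\<forall>q\<in>C. norm q \<le> B" unfolding bounded_pos by blast
      let ?z0 = "complex_of_real (B + 1)"
      have "q \<notin> C" if q: "dist q (?z0, 0) < 1" for q :: "complex \<times> real"
      proof
        assume "q \<in> C"
        then have "norm q \<le> B" using B(2) by blast
        moreover have "norm (?z0, 0 :: real) = B + 1" using B(1) by (simp add: norm_prod_def del: of_real_add)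
        ultimately show False using q norm_triangle_sub[of "(?z0, 0)" q] by (simp add: dist_norm norm_minus_commute del: of_real_add)
      qed
      then show ?thesis using b(3) by (intro exI[of _ ?z0] exI[of _ 1]) auto
    qed
  qed
  then obtain z0 \<delta> where "\<delta> > 0" "\<And>q. q \<in> ?H \<Longrightarrow> dist q (z0, 0) < \<delta> \<Longrightarrow> Some q \<in> T" by blast
  then show thesis using noT inH that by (metis linorder_not_le)
qed

section \<open>Discrete BH groups are of the first kind\<close>

theorem theorem1p1:
  fixes \<Gamma> :: "(complex^2^2) set set"
  assumes "discrete_subgroup \<Gamma>"
    and "BH_group \<Gamma>"
  shows "first_kind \<Gamma>"
proof (rule ccontr)
  assume "\<not> first_kind \<Gamma>"
  then obtain p x where p: "p \<in> hyp3" and x: "x \<notin> limit_set \<Gamma> p" unfolding first_kind_def by blast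
  have sub: "subgroup \<Gamma> PSL2" using assms(1) by (auto simp: discrete_subgroup_def)
  obtain w t where wt: "p = (w, t)" "t > 0" using p by (auto simp: hyp3_def)
  obtain z0 \<delta> where \<delta>: "\<delta> > 0" and avoid: "\<And>g. g \<in> \<Gamma> \<Longrightarrow> dist (hyp3_act g (w, t)) (z0, 0) \<ge> \<delta>"
    using not_limit_point_avoids_half_ball[OF assms(1) p x] unfolding wt(1) by metis
  \<comment> \<open>The curve has points at distance at most \<open>2 * e\<close> from \<open>z0\<close>.\<close>
  define e where "e = \<delta> / 8"
  have e: "e > 0" using \<delta> by (simp add: e_def)
  define J where "J = cusp_curve z0 e"
  have jJ: "jordan_curve J" unfolding J_def by (rule jordan_curve_cusp_curve[OF e])
  have JB: "J \<subseteq> Fin ` ball z0 (\<delta> / 2)"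
  proof
    fix y assume "y \<in> J"
    then obtain \<zeta> where \<zeta>: "cmod \<zeta> = 1" "y = Fin (z0 + of_real e * Complex (Re \<zeta>) (Im \<zeta> ^ 3))"
      by (auto simp: J_def cusp_curve_def)
    have im: "\<bar>Im \<zeta>\<bar> \<le> 1" "\<bar>Re \<zeta>\<bar> \<le> 1" using abs_Im_le_cmod[of \<zeta>] abs_Re_le_cmod[of \<zeta>] \<zeta>(1) by auto
    have "\<bar>Im \<zeta> ^ 3\<bar> \<le> 1" using im(1) by (simp add: power_abs power_le_one)
    then have "cmod (Complex (Re \<zeta>) (Im \<zeta> ^ 3)) \<le> 2" using cmod_le[of "Complex (Re \<zeta>) (Im \<zeta> ^ 3)"] im by simp
    then have "e * cmod (Complex (Re \<zeta>) (Im \<zeta> ^ 3)) \<le> e * 2" using e by (intro mult_left_mono) auto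
    then have "z0 + of_real e * Complex (Re \<zeta>) (Im \<zeta> ^ 3) \<in> ball z0 (\<delta> / 2)"
      using e \<delta> by (simp add: dist_norm norm_mult e_def)
    then show "y \<in> Fin ` ball z0 (\<delta> / 2)" using \<zeta>(2) by blast
  qed
  define \<C> where "\<C> = {moebius A ` J | A. A \<in> \<Union>\<Gamma>}"
  have jC: "jordan_curve B" if "B \<in> \<C>" for B
    using that jordan_curve_moebius[OF subgroup_lift_closed(1)[OF sub] jJ] by (auto simp: \<C>_def)
  have "closedin compacta\<^sub>0_topology \<C>"
  proof (rule closedin_orbit)
    fix d :: real assume d: "d > 0"
    have "{B \<in> \<C>. \<exists>x\<in>B. \<exists>y\<in>B. d < dist x y} \<subseteq>
       (\<lambda>A. moebius A ` J) ` {A \<in> \<Union>\<Gamma>. \<exists>x\<in>J. \<exists>y\<in>J. d < dist (moebius A x) (moebius A y)}"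
      by (auto simp: \<C>_def)
    then show "finite {B \<in> \<C>. \<exists>x\<in>B. \<exists>y\<in>B. d < dist x y}"
      by (rule finite_subset) (intro finite_imageI large_images_finite[OF assms(1) wt(2) \<delta> avoid JB d])
  qed (use jC jordan_curve_compacta\<^sub>0 in blast)
  moreover have "sphere_act g ` B \<in> \<C>" if g: "g \<in> \<Gamma>" and B: "B \<in> \<C>" for g B
  proof -
    obtain A where A: "A \<in> \<Union>\<Gamma>" "B = moebius A ` J" using B unfolding \<C>_def by blast
    have gc: "g \<in> carrier PSL2" using g subgroup.subset[OF sub] by blast
    then obtain A' where A': "A' \<in> g" by (auto simp: carrier_PSL2)
    have "sphere_act g ` B = moebius (A' ** A) ` J"
      unfolding sphere_act_eq[OF gc A'] A(2) image_image
      by (simp add: moebius_mult[OF subgroup_lift_closed(1)[OF sub A(1)]])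
    moreover have "A' ** A \<in> \<Union>\<Gamma>" using subgroup_lift_closed(3)[OF sub _ A(1)] A' g by blast
    ultimately show ?thesis unfolding \<C>_def by blast
  qed
  ultimately obtain K where K: "\<forall>B\<in>\<C>. quasicircle K B"
    using assms(2) jC unfolding BH_group_def by blast
  have "mat 1 \<in> \<Union>\<Gamma>" using subgroup.one_closed[OF sub] one_PSL2 by blast
  moreover have "moebius (mat 1) ` J = J" by simp
  ultimately have "J \<in> \<C>" unfolding \<C>_def by (metis (mono_tags, lifting) mem_Collect_eq)
  then show False using K cusp_curve_not_quasicircle[OF e] unfolding J_def by blast
qed

end
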